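(* Let $n,m\ge1$, let $N\ge2$, let $a_1,\dots,a_N\in\mathbb{R}^m$ be distinct points, and let $W:\mathbb{R}^m\to\mathbb{R}$ satisfy $0=W(a_j)<W(u)$ for $j=1,\dots,N$ and $u\in\mathbb{R}^m\setminus\{a_1,\dots,a_N\}$, and satisfy hypothesis (HA) at $a=a_j$ for each $j=1,\dots,N$. Let $u:\mathbb{R}^n\to\mathbb{R}^m$ be nonconstant, minimal in the sense of hypothesis (HB) on $D=\mathbb{R}^n$, and uniformly bounded on $\mathbb{R}^n$. Then there is a constant $C>0$ such that for every $x_0\in\mathbb{R}^n$ there is $R(x_0)$ with $$\int_{B_R(x_0)}\Big(\frac12|\nabla u|^2+W(u)\Big)dx\ge C R^{n-1}\quad\text{for all } R\ge R(x_0),$$ where $C$ is independent of $x_0$.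
   Context: $B_R(x_0)\subset\mathbb{R}^n$ is the open ball; $W_u$ is the gradient and $W_{uu}$ the Hessian of $W$. Hypothesis (HA) at $a$: $W:\mathbb{R}^m\to\mathbb{R}$ is nonnegative, $W(a)=0$, and for some $\alpha\in(0,2]$, $W\in C^\alpha(\mathbb{R}^m;\mathbb{R})\cap C^1(\mathbb{R}^m\setminus\{a\};\mathbb{R})$ (here $C^\alpha$ means locally Hölder of exponent $\alpha$ if $0<\alpha<1$, locally Lipschitz if $\alpha=1$, $C^{1,\alpha-1}$ locally if $1<\alpha<2$, and $C^2$ if $\alpha=2$). If $0<\alpha<2$, there are constants $C^*>0$, $\rho_0>0$ with $W_u(a+\rho\nu)\cdot\nu\ge C^*\rho^{\alpha-1}$ for $0<\rho\le\rho_0$, $|\nu|=1$. If $\alpha=2$, there is a constant $C_0>0$ with $W_{uu}(a)\nu\cdot\nu\ge C_0$ for $|\nu|=1$. Hypothesis (HB) on $\mathbb{R}^n$: $u\in W^{1,2}_{\rm loc}(\mathbb{R}^n;\mathbb{R}^m)\cap L^\infty(\mathbb{R}^n;\mathbb{R}^m)$ is minimal, i.e. for every open bounded set $\Omega\subset\mathbb{R}^n$ and every $v\in W^{1,2}_0(\Omega;\mathbb{R}^m)$ one has $J_\Omega(u)\le J_\Omega(u+v)$, where $J_\Omega(u)=\int_\Omega\big(\frac12|\nabla u|^2+W(u)\big)dx$; moreover, for some constant $M>0$, $|u-a_j|<M$ ($j=1,\dots,N$) and $|\nabla u|<M$ on $\mathbb{R}^n$. *)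

theory Defs
  imports "HOL-Analysis.Analysis"
begin

section \<open>Classical regularity classes\<close>

(* Intended for open S. *)
primrec Ck_on ::
  "nat \<Rightarrow> 'a::euclidean_space set \<Rightarrow> ('a \<Rightarrow> 'b::real_normed_vector) \<Rightarrow> bool" where
  "Ck_on 0 S f \<longleftrightarrow> continuous_on S f"
| "Ck_on (Suc k) S f \<longleftrightarrow>
     (\<forall>x\<in>S. f differentiable (at x)) \<and>
     (\<forall>b\<in>Basis. Ck_on k S (\<lambda>x. frechet_derivative f (at x) b))"

definition grad :: "('a::euclidean_space \<Rightarrow> real) \<Rightarrow> 'a \<Rightarrow> 'a" where
  "grad f x = (\<Sum>b\<in>Basis. frechet_derivative f (at x) b *\<^sub>R b)"

definition hessian :: "(real ^ 'm \<Rightarrow> real) \<Rightarrow> real ^ 'm \<Rightarrow> real ^ 'm ^ 'm" where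
  "hessian f x = matrix (frechet_derivative (grad f) (at x))"

definition locally_holder ::
  "real \<Rightarrow> ('a::real_normed_vector \<Rightarrow> 'b::real_normed_vector) \<Rightarrow> bool" where
  "locally_holder \<gamma> f \<longleftrightarrow>
     (\<forall>x. \<exists>r>0. \<exists>L. \<forall>y\<in>ball x r. \<forall>z\<in>ball x r. norm (f y - f z) \<le> L * norm (y - z) powr \<gamma>)"

(* For \<alpha> = 1 the first clause is local Lipschitz continuity, not C^1. *)
definition holder_class :: "real \<Rightarrow> ('a::euclidean_space \<Rightarrow> real) \<Rightarrow> bool" where
  "holder_class \<alpha> f \<longleftrightarrow>
     (if \<alpha> \<le> 1 then locally_holder \<alpha> f
      else if \<alpha> < 2 then Ck_on 1 UNIV f \<and> locally_holder (\<alpha> - 1) (grad f)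
      else Ck_on 2 UNIV f)"

section \<open>Sobolev spaces\<close>

definition test_function ::
  "'a::euclidean_space set \<Rightarrow> ('a \<Rightarrow> 'b::real_normed_vector) \<Rightarrow> bool" where
  "test_function \<Omega> \<phi> \<longleftrightarrow>
     (\<forall>k. Ck_on k UNIV \<phi>) \<and>
     compact (closure {x. \<phi> x \<noteq> 0}) \<and> closure {x. \<phi> x \<noteq> 0} \<subseteq> \<Omega>"

definition L2_on ::
  "'a::euclidean_space set \<Rightarrow> ('a \<Rightarrow> 'b::euclidean_space) \<Rightarrow> bool" where
  "L2_on \<Omega> f \<longleftrightarrow>
     f \<in> borel_measurable (lebesgue_on \<Omega>) \<and>
     (\<lambda>x. (norm (f x))\<^sup>2) absolutely_integrable_on \<Omega>"

definition L2_loc_on ::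
  "'a::euclidean_space set \<Rightarrow> ('a \<Rightarrow> 'b::euclidean_space) \<Rightarrow> bool" where
  "L2_loc_on \<Omega> f \<longleftrightarrow> (\<forall>K. compact K \<and> K \<subseteq> \<Omega> \<longrightarrow> L2_on K f)"

definition L1_loc_on ::
  "'a::euclidean_space set \<Rightarrow> ('a \<Rightarrow> 'b::euclidean_space) \<Rightarrow> bool" where
  "L1_loc_on \<Omega> f \<longleftrightarrow> (\<forall>K. compact K \<and> K \<subseteq> \<Omega> \<longrightarrow> f absolutely_integrable_on K)"

(* G x $ j $ i is the i-th partial derivative of the j-th component of u, so that
   norm (G x) is the Frobenius norm of the Jacobian matrix. *)
definition is_weak_gradient ::
  "(real ^ 'n) set \<Rightarrow> (real ^ 'n \<Rightarrow> real ^ 'm) \<Rightarrow> (real ^ 'n \<Rightarrow> real ^ 'n ^ 'm) \<Rightarrow> bool" where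
  "is_weak_gradient \<Omega> u G \<longleftrightarrow>
     L1_loc_on \<Omega> u \<and> L1_loc_on \<Omega> G \<and>
     (\<forall>\<phi>::real ^ 'n \<Rightarrow> real. test_function \<Omega> \<phi> \<longrightarrow>
       (\<forall>i j. (LINT x:\<Omega>|lebesgue. u x $ j * frechet_derivative \<phi> (at x) (axis i 1)) =
              - (LINT x:\<Omega>|lebesgue. G x $ j $ i * \<phi> x)))"

(* Determined only up to null subsets of \<Omega>; arbitrary outside \<Omega>. *)
definition weak_grad ::
  "(real ^ 'n) set \<Rightarrow> (real ^ 'n \<Rightarrow> real ^ 'm) \<Rightarrow> real ^ 'n \<Rightarrow> real ^ 'n ^ 'm" where
  "weak_grad \<Omega> u = (SOME G. is_weak_gradient \<Omega> u G)"

definition W12_on :: "(real ^ 'n) set \<Rightarrow> (real ^ 'n \<Rightarrow> real ^ 'm) \<Rightarrow> bool" where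
  "W12_on \<Omega> u \<longleftrightarrow> L2_on \<Omega> u \<and> (\<exists>G. is_weak_gradient \<Omega> u G \<and> L2_on \<Omega> G)"

definition W12_loc_on :: "(real ^ 'n) set \<Rightarrow> (real ^ 'n \<Rightarrow> real ^ 'm) \<Rightarrow> bool" where
  "W12_loc_on \<Omega> u \<longleftrightarrow> L2_loc_on \<Omega> u \<and> (\<exists>G. is_weak_gradient \<Omega> u G \<and> L2_loc_on \<Omega> G)"

definition W12_norm :: "(real ^ 'n) set \<Rightarrow> (real ^ 'n \<Rightarrow> real ^ 'm) \<Rightarrow> real" where
  "W12_norm \<Omega> u =
     sqrt (LINT x:\<Omega>|lebesgue. (norm (u x))\<^sup>2 + (norm (weak_grad \<Omega> u x))\<^sup>2)"

definition W12_zero_on :: "(real ^ 'n) set \<Rightarrow> (real ^ 'n \<Rightarrow> real ^ 'm) \<Rightarrow> bool" where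
  "W12_zero_on \<Omega> v \<longleftrightarrow>
     W12_on \<Omega> v \<and>
     (\<exists>\<phi>::nat \<Rightarrow> real ^ 'n \<Rightarrow> real ^ 'm. (\<forall>k. test_function \<Omega> (\<phi> k)) \<and>
        (\<lambda>k. W12_norm \<Omega> (\<lambda>x. \<phi> k x - v x)) \<longlonglongrightarrow> 0)"

definition essentially_bounded ::
  "('a::euclidean_space \<Rightarrow> 'b::real_normed_vector) \<Rightarrow> bool" where
  "essentially_bounded u \<longleftrightarrow> (\<exists>K. AE x in lebesgue. norm (u x) \<le> K)"

section \<open>Energy and hypotheses\<close>

(* Valued in ennreal, because W (u + v) need not be integrable for an
   unbounded competitor u + v. *)
definition energy ::
  "(real ^ 'm \<Rightarrow> real) \<Rightarrow> (real ^ 'n) set \<Rightarrow> (real ^ 'n \<Rightarrow> real ^ 'm) \<Rightarrow> ennreal" where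
  "energy W \<Omega> u =
     (\<integral>\<^sup>+x\<in>\<Omega>. ennreal (1 / 2 * (norm (weak_grad \<Omega> u x))\<^sup>2 + W (u x)) \<partial>lebesgue)"

(* A is the set of all zeros of W; W is required to be C^1 off A, not merely off {a}.
   Requiring C^1 off {a} at two distinct zeros would make W of class C^1 everywhere,
   which is incompatible with the lower bound on the gradient when \<alpha> \<le> 1. *)
definition HA :: "(real ^ 'm \<Rightarrow> real) \<Rightarrow> (real ^ 'm) set \<Rightarrow> real ^ 'm \<Rightarrow> bool" where
  "HA W A a \<longleftrightarrow>
     (\<forall>v. 0 \<le> W v) \<and> W a = 0 \<and>
     (\<exists>\<alpha>. 0 < \<alpha> \<and> \<alpha> \<le> 2 \<and> holder_class \<alpha> W \<and> Ck_on 1 (UNIV - A) W \<and>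
       (\<alpha> < 2 \<longrightarrow>
         (\<exists>Cs>0. \<exists>\<rho>\<^sub>0>0. \<forall>\<rho> \<nu>. 0 < \<rho> \<and> \<rho> \<le> \<rho>\<^sub>0 \<and> norm \<nu> = 1 \<longrightarrow>
            grad W (a + \<rho> *\<^sub>R \<nu>) \<bullet> \<nu> \<ge> Cs * \<rho> powr (\<alpha> - 1))) \<and>
       (\<alpha> = 2 \<longrightarrow>
         (\<exists>C\<^sub>0>0. \<forall>\<nu>. norm \<nu> = 1 \<longrightarrow> (hessian W a *v \<nu>) \<bullet> \<nu> \<ge> C\<^sub>0)))"

definition minimal :: "(real ^ 'm \<Rightarrow> real) \<Rightarrow> (real ^ 'n \<Rightarrow> real ^ 'm) \<Rightarrow> bool" where
  "minimal W u \<longleftrightarrow>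
     (\<forall>\<Omega> v. open \<Omega> \<and> bounded \<Omega> \<and> W12_zero_on \<Omega> v \<longrightarrow>
        energy W \<Omega> u \<le> energy W \<Omega> (\<lambda>x. u x + v x))"

definition HB ::
  "(real ^ 'm \<Rightarrow> real) \<Rightarrow> (real ^ 'm) set \<Rightarrow> (real ^ 'n \<Rightarrow> real ^ 'm) \<Rightarrow> bool" where
  "HB W A u \<longleftrightarrow>
     W12_loc_on UNIV u \<and> essentially_bounded u \<and> minimal W u \<and>
     (\<exists>M>0. (\<forall>a\<in>A. AE x in lebesgue. norm (u x - a) < M) \<and>
            (AE x in lebesgue. norm (weak_grad UNIV u x) < M))"

end

theory Submission
  imports Defs
begin

text \<open>
  Let \<open>E r\<close> be the energy in the ball of radius \<open>r\<close> about the origin. A ball about another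
  centre contains the ball of half its radius about the origin as soon as its radius is large, so it
  is enough to bound \<open>E R\<close> from below by a multiple of \<open>R ^ (n - 1)\<close> for all large \<open>R\<close>.

  The heart of the proof is \<open>energy_halving\<close>: for some \<open>\<epsilon> > 0\<close> and every large \<open>R\<close>, if
  \<open>E R \<le> \<epsilon> * R ^ (n - 1)\<close> then \<open>E (R / 2) \<le> 2 ^ (- n) * E R\<close>. As \<open>R ^ (n - 1)\<close> loses only the factor
  \<open>2 ^ (n - 1)\<close> when \<open>R\<close> is halved, the smallness is inherited, and the halving can be iterated down
  to a fixed radius \<open>r\<close>: there the energy is at most a constant times \<open>r ^ n / R\<close>. If the energy were
  small in this sense for arbitrarily large \<open>R\<close>, it would therefore vanish identically
  (\<open>energy_dichotomy\<close>), the weak gradient would be zero, and \<open>u\<close> would be constant.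

  The halving comes from three facts. Assume \<open>E R \<le> \<epsilon> * R ^ (n - 1)\<close>.

  \<^item> \<open>W\<close> is bounded below away from its zeros, so \<open>u\<close> is near some zero outside a set of volume at most
    a constant times \<open>E R\<close>, and a single zero \<open>a\<close> claims a fixed fraction of the ball.

  \<^item> A smooth function of \<open>u\<close> that is 0 near \<open>a\<close> and 1 farther away changes only where \<open>W (u x)\<close> is
    bounded below, so its gradient is controlled by the energy density. A Poincare inequality for pairs
    of points at distance less than \<open>l\<close> (\<open>nonlocal_poincare\<close>) then bounds the volume of the set where
    \<open>u\<close> is far from \<open>a\<close> by a constant times \<open>l * E R\<close>, provided that every point of this set has \<open>u\<close> near \<open>a\<close>
    on a fixed fraction of the ball of radius \<open>l\<close> around it. With \<open>l = 2 * R\<close> this gives a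
    bound of order \<open>R * E R\<close>, which is small compared to \<open>(\<gamma> * R) ^ n\<close>; hence the proviso holds for \<open>l = \<gamma> * R\<close>, and the bound improves to order
    \<open>\<gamma> * R * E R\<close> with \<open>\<gamma>\<close> as small as desired.

  \<^item> Replace \<open>u\<close> in a ball by \<open>a\<close>, interpolating in a layer of thickness 3 (\<open>competitor_estimate\<close>).
    By minimality the energy in the ball is at most a constant times the energy of \<open>u\<close> in the layer
    plus the volume of the part of the layer where \<open>u\<close> is far from \<open>a\<close>; near \<open>a\<close>, hypothesis (HA) makes
    the interpolation cost no more than \<open>W (u x)\<close>. Between the radii \<open>R / 2\<close> and \<open>3 * R / 4\<close>
    there are of order \<open>R\<close> disjoint layers, and the cheapest one costs at most a constant times
    \<open>(1 / R + \<gamma>) * E R\<close>.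

  The analytic groundwork serves to pass from smooth maps to \<open>u\<close>: mollifications of \<open>u\<close> converge to \<open>u\<close>
  almost everywhere together with their gradients and obey the same uniform bounds, so that dominated convergence transfers the Poincare inequality and
  shows that the cut-off competitors are admissible.
\<close>

section \<open>Smooth functions and bump functions\<close>

definition smooth :: "('a::euclidean_space \<Rightarrow> 'b::real_normed_vector) \<Rightarrow> bool" where
  "smooth f \<longleftrightarrow> (\<forall>k. Ck_on k UNIV f)"

text \<open>
  The definition of \<open>Ck_on\<close> speaks about \<open>frechet_derivative\<close>; this rule and the next one allow any
  formula for the derivative to be used instead.
\<close>

lemma Ck_on_SucI:
  assumes "\<And>x. (f has_derivative f' x) (at x)"
    and "\<And>b. b \<in> Basis \<Longrightarrow> Ck_on k UNIV (\<lambda>x. f' x b)"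
  shows "Ck_on (Suc k) UNIV f"
proof -
  have "frechet_derivative f (at x) = f' x" for x
    using frechet_derivative_at[OF assms(1)] by simp
  then show ?thesis
    using assms by (auto simp: differentiable_def)
qed

lemma Ck_on_SucD:
  assumes "Ck_on (Suc k) UNIV f"
  shows "(f has_derivative frechet_derivative f (at x)) (at x)"
    and "b \<in> Basis \<Longrightarrow> Ck_on k UNIV (\<lambda>x. frechet_derivative f (at x) b)"
  using assms by (auto simp: frechet_derivative_works)

lemma Ck_on_continuous: "Ck_on k UNIV f \<Longrightarrow> continuous_on UNIV f"
  by (cases k) (auto intro!: continuous_at_imp_continuous_on differentiable_imp_continuous_within)

lemma Ck_on_Suc_imp: "Ck_on (Suc k) UNIV f \<Longrightarrow> Ck_on k UNIV f"
proof (induction k arbitrary: f)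
  case 0
  then show ?case using Ck_on_continuous[OF 0] by simp
next
  case (Suc k)
  then show ?case
    by (intro Ck_on_SucI[OF Ck_on_SucD(1)[OF Suc.prems]]) (use Ck_on_SucD(2)[OF Suc.prems] in auto)
qed

lemma Ck_on_const: "Ck_on k UNIV (\<lambda>x. c)"
proof (induction k arbitrary: c)
  case (Suc k)
  show ?case by (rule Ck_on_SucI[where f' = "\<lambda>x h. 0"]) (use Suc in auto)
qed simp

lemma Ck_on_add: "Ck_on k UNIV f \<Longrightarrow> Ck_on k UNIV g \<Longrightarrow> Ck_on k UNIV (\<lambda>x. f x + g x)"
proof (induction k arbitrary: f g)
  case 0
  then show ?case by (auto intro: continuous_intros)
next
  case (Suc k)
  show ?case
    by (rule Ck_on_SucI[OF has_derivative_add[OF Ck_on_SucD(1)[OF Suc.prems(1)] Ck_on_SucD(1)[OF Suc.prems(2)]]])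
       (use Suc.IH Ck_on_SucD(2)[OF Suc.prems(1)] Ck_on_SucD(2)[OF Suc.prems(2)] in blast)
qed

lemma Ck_on_scaleR:
  fixes f :: "'a::euclidean_space \<Rightarrow> real"
  shows "Ck_on k UNIV f \<Longrightarrow> Ck_on k UNIV g \<Longrightarrow> Ck_on k UNIV (\<lambda>x. f x *\<^sub>R g x)"
proof (induction k arbitrary: f g)
  case 0
  then show ?case by (auto intro: continuous_intros)
next
  case (Suc k)
  show ?case
    by (rule Ck_on_SucI[OF has_derivative_scaleR[OF Ck_on_SucD(1)[OF Suc.prems(1)] Ck_on_SucD(1)[OF Suc.prems(2)]]])
       (intro Ck_on_add Suc.IH Ck_on_Suc_imp[OF Suc.prems(1)] Ck_on_Suc_imp[OF Suc.prems(2)]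
          Ck_on_SucD(2)[OF Suc.prems(1)] Ck_on_SucD(2)[OF Suc.prems(2)])
qed

lemma Ck_on_bounded_linear: "bounded_linear f \<Longrightarrow> Ck_on k UNIV f"
proof (cases k)
  case 0
  assume "bounded_linear f"
  then show ?thesis using 0 by (simp add: linear_continuous_on)
next
  case (Suc j)
  assume "bounded_linear f"
  then show ?thesis unfolding Suc
    by (intro Ck_on_SucI[OF bounded_linear_imp_has_derivative] Ck_on_const)
qed

lemma Ck_on_affine:
  fixes f :: "'a::euclidean_space \<Rightarrow> 'b::real_normed_vector"
  shows "Ck_on k UNIV f \<Longrightarrow> Ck_on k UNIV (\<lambda>x. f (c *\<^sub>R x + d))"
proof (induction k arbitrary: f)
  case 0
  then show ?case by (auto intro!: continuous_on_compose2[of UNIV f] continuous_intros)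
next
  case (Suc k)
  have aff: "((\<lambda>x. c *\<^sub>R x + d) has_derivative (\<lambda>h. c *\<^sub>R h)) (at x)" for x :: 'a
    by (auto intro!: derivative_eq_intros)
  have "((\<lambda>x. f (c *\<^sub>R x + d)) has_derivative (\<lambda>h. frechet_derivative f (at (c *\<^sub>R x + d)) (c *\<^sub>R h))) (at x)" for x
    by (rule has_derivative_compose[OF aff Ck_on_SucD(1)[OF Suc.prems]])
  moreover have "frechet_derivative f (at y) (c *\<^sub>R h) = c *\<^sub>R frechet_derivative f (at y) h" for y h
    using has_derivative_linear[OF Ck_on_SucD(1)[OF Suc.prems]] by (simp add: linear_scale)
  ultimately have "((\<lambda>x. f (c *\<^sub>R x + d)) has_derivative (\<lambda>h. c *\<^sub>R frechet_derivative f (at (c *\<^sub>R x + d)) h)) (at x)" for x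
    by simp
  then show ?case
    by (rule Ck_on_SucI) (intro Ck_on_scaleR Ck_on_const Suc.IH[OF Ck_on_SucD(2)[OF Suc.prems]])
qed

text \<open>
  The functions \<open>exp (- 1 / t) / t ^ k\<close>, extended by 0. The family is closed under differentiation up to
  linear combinations, which is why the powers are carried along.
\<close>

definition flat :: "nat \<Rightarrow> real \<Rightarrow> real" where
  "flat k t = (if 0 < t then (1 / t) ^ k * exp (- (1 / t)) else 0)"

lemma flat_nonneg: "0 \<le> flat k t"
  by (simp add: flat_def)

lemma power_div_fact_le_exp:
  fixes x :: real
  assumes "0 \<le> x"
  shows "x ^ n / fact n \<le> exp x"
proof -
  have "(\<Sum>i\<in>{n}. x ^ i /\<^sub>R fact i) \<le> (\<Sum>i. x ^ i /\<^sub>R fact i)"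
    by (rule sum_le_suminf[OF summable_exp_generic]) (use assms in auto)
  then show ?thesis by (simp add: exp_def divide_inverse mult.commute)
qed

text \<open>
  The power series of \<open>exp (1 / t)\<close> dominates its term of order \<open>k + 2\<close>. A quadratic bound is what makes
  the derivative at 0 exist and vanish.
\<close>

lemma flat_le_square: "flat k t \<le> fact (k + 2) * t\<^sup>2"
proof (cases "0 < t")
  case True
  have "(1 / t) ^ (k + 2) \<le> fact (k + 2) * exp (1 / t)"
    using power_div_fact_le_exp[of "1/t" "k+2"] True by (simp add: field_simps del: fact_Suc)
  then have "(1 / t) ^ (k + 2) * exp (- (1 / t)) \<le> fact (k + 2)"
    using True by (simp add: exp_minus field_simps del: fact_Suc)
  then have "(1 / t) ^ (k + 2) * exp (- (1 / t)) * t\<^sup>2 \<le> fact (k + 2) * t\<^sup>2"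
    by (intro mult_right_mono) auto
  then show ?thesis using True
    by (simp add: flat_def power_add power2_eq_square field_simps del: fact_Suc)
qed (simp add: flat_def del: fact_Suc)

lemma flat_has_derivative:
  "(flat k has_real_derivative (flat (k + 2) t - real k * flat (k + 1) t)) (at t)"
proof -
  consider "0 < t" | "t < 0" | "t = 0" by linarith
  then show ?thesis
  proof cases
    case 1
    have "((\<lambda>t. (1 / t) ^ k * exp (- (1 / t))) has_real_derivative (flat (k + 2) t - real k * flat (k + 1) t)) (at t)"
    proof -
      have "((\<lambda>t. (1 / t) ^ k * exp (- (1 / t))) has_real_derivative
          (real k * (1 / t) ^ (k - 1) * (- 1 / t\<^sup>2)) * exp (- (1 / t)) + (1 / t) ^ k * (exp (- (1 / t)) * (1 / t\<^sup>2))) (at t)"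
        using 1 by (auto intro!: derivative_eq_intros simp: power2_eq_square)
      also have "(real k * (1 / t) ^ (k - 1) * (- 1 / t\<^sup>2)) * exp (- (1 / t)) + (1 / t) ^ k * (exp (- (1 / t)) * (1 / t\<^sup>2))
          = flat (k + 2) t - real k * flat (k + 1) t"
        using 1 by (cases k) (simp_all add: flat_def field_simps power2_eq_square)
      finally show ?thesis .
    qed
    then show ?thesis
      by (rule has_field_derivative_transform_within_open[of _ _ _ "{0<..}"]) (use 1 in \<open>auto simp: flat_def\<close>)
  next
    case 2
    have "((\<lambda>t. 0) has_real_derivative 0) (at t)" by simp
    then have "(flat k has_real_derivative 0) (at t)"
      by (rule has_field_derivative_transform_within_open[of _ _ _ "{..<0}"]) (use 2 in \<open>auto simp: flat_def\<close>)
    then show ?thesis using 2 by (simp add: flat_def)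
  next
    case 3
    have "((\<lambda>h. flat k h / h) \<longlongrightarrow> 0) (at 0)"
    proof (rule Lim_null_comparison)
      show "\<forall>\<^sub>F h in at 0. norm (flat k h / h) \<le> fact (k + 2) * \<bar>h\<bar>"
      proof (rule always_eventually, rule allI)
        fix h :: real
        show "norm (flat k h / h) \<le> fact (k + 2) * \<bar>h\<bar>"
          using flat_le_square[of k h] flat_nonneg[of k h]
          by (cases "h = 0") (auto simp: abs_mult divide_le_eq power2_eq_square abs_mult_self mult.assoc simp del: fact_Suc)
      qed
      show "((\<lambda>h. fact (k + 2) * \<bar>h\<bar>) \<longlongrightarrow> (0::real)) (at 0)"
        by (auto intro!: tendsto_eq_intros)
    qed
    then show ?thesis using 3 by (simp add: flat_def DERIV_def)
  qed
qed

text \<open>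
  Induction on the order of differentiability, for all \<open>k\<close> at once: each derivative is a product of a
  linear function with functions of the same form.
\<close>

lemma Ck_on_flat_ball:
  fixes c :: "'a::euclidean_space"
  shows "Ck_on n UNIV (\<lambda>x. flat k (d - (x - c) \<bullet> (x - c)))"
proof (induction n arbitrary: k)
  case 0
  have "continuous_on UNIV (flat k)"
    by (meson DERIV_continuous_on flat_has_derivative has_field_derivative_at_within)
  then show ?case by (auto intro!: continuous_on_compose2[of UNIV "flat k"] continuous_intros)
next
  case (Suc n)
  show ?case
  proof (rule Ck_on_SucI)
    fix x :: 'a
    have q: "((\<lambda>x. d - (x - c) \<bullet> (x - c)) has_derivative (\<lambda>h. - 2 * ((x - c) \<bullet> h))) (at x)"
      by (auto intro!: derivative_eq_intros simp: inner_commute)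
    have "(flat k has_derivative (\<lambda>h. h * (flat (k + 2) t - real k * flat (k + 1) t))) (at t)" for t
      using flat_has_derivative[of k t] by (simp add: has_field_derivative_def mult.commute[of _ "_ - _"] mult_commute_abs)
    from has_derivative_compose[OF q this]
    show "((\<lambda>x. flat k (d - (x - c) \<bullet> (x - c))) has_derivative
       (\<lambda>h. ((- 2) *\<^sub>R ((x - c) \<bullet> h)) *\<^sub>R (flat (k + 2) (d - (x - c) \<bullet> (x - c)) + (- real k) *\<^sub>R flat (k + 1) (d - (x - c) \<bullet> (x - c))))) (at x)"
      by simp
  next
    fix b :: 'a assume "b \<in> Basis"
    have "Ck_on n UNIV (\<lambda>x. x \<bullet> b + - (c \<bullet> b))"
      by (intro Ck_on_add Ck_on_const Ck_on_bounded_linear bounded_linear_inner_left)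
    then have "Ck_on n UNIV (\<lambda>x. (x - c) \<bullet> b)"
      by (simp add: inner_diff_left)
    then show "Ck_on n UNIV (\<lambda>x. ((- 2) *\<^sub>R ((x - c) \<bullet> b)) *\<^sub>R (flat (k + 2) (d - (x - c) \<bullet> (x - c)) + (- real k) *\<^sub>R flat (k + 1) (d - (x - c) \<bullet> (x - c))))"
      by (intro Ck_on_add Ck_on_scaleR Ck_on_const Suc.IH)
  qed
qed

text \<open>
  \<open>flat 0\<close> composed with \<open>r\<^sup>2 - (norm (x - c))\<^sup>2\<close>, normalised. Its integral is positive because a
  continuous function that is zero almost everywhere is zero.
\<close>

lemma bump_exists:
  fixes c :: "'a::euclidean_space"
  assumes "0 < r"
  obtains \<eta> :: "'a \<Rightarrow> real"
  where "smooth \<eta>" "\<And>x. 0 \<le> \<eta> x" "\<And>x. x \<notin> ball c r \<Longrightarrow> \<eta> x = 0"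
    "integrable lebesgue \<eta>" "integral\<^sup>L lebesgue \<eta> = 1"
proof -
  define b where "b x = flat 0 (r\<^sup>2 - (x - c) \<bullet> (x - c))" for x
  have sm: "Ck_on k UNIV b" for k
    unfolding b_def by (rule Ck_on_flat_ball)
  have cont: "continuous_on UNIV b" using Ck_on_continuous[OF sm] .
  have nn: "0 \<le> b x" for x by (simp add: b_def flat_nonneg)
  have out: "b x = 0" if "x \<notin> ball c r" for x
  proof -
    have "r\<^sup>2 \<le> (norm (x - c))\<^sup>2"
      using that assms by (intro power_mono) (auto simp: dist_norm norm_minus_commute)
    then show ?thesis by (simp add: b_def flat_def dot_square_norm)
  qed
  have "integrable lborel (\<lambda>x. indicator (cball c r) x *\<^sub>R b x)"
    by (rule borel_integrable_compact) (auto intro: continuous_on_subset[OF cont])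
  also have "(\<lambda>x. indicator (cball c r) x *\<^sub>R b x) = b"
    using out by (auto simp: fun_eq_iff indicator_def)
  finally have intb: "integrable lborel b" .
  have "integral\<^sup>L lborel b \<noteq> 0"
  proof
    assume "integral\<^sup>L lborel b = 0"
    then have "AE x in lborel. b x = 0"
      using integral_nonneg_eq_0_iff_AE[OF intb] nn by auto
    then have "AE x in lebesgue. b x = 0" by (rule AE_completion)
    then have "negligible {x. b x \<noteq> 0}"
      by (simp add: eventually_ae_filter_negligible negligible_iff_null_sets) 
         (metis (mono_tags, lifting) mem_Collect_eq negligible_iff_null_sets negligible_subset subsetI)
    moreover have "open {x. b x \<noteq> 0}"
      using cont by (auto intro!: open_Collect_neq continuous_intros)
    moreover have "b c \<noteq> 0"
      using assms by (simp add: b_def flat_def)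
    ultimately show False
      using open_not_negligible by blast
  qed
  moreover have "0 \<le> integral\<^sup>L lborel b" by (simp add: nn)
  ultimately have pos: "0 < integral\<^sup>L lborel b" by linarith
  have bm: "b \<in> borel_measurable borel" using cont by (rule borel_measurable_continuous_onI)
  define I where "I = integral\<^sup>L lborel b"
  show ?thesis
  proof (rule that[of "\<lambda>x. (1 / I) *\<^sub>R b x"])
    show "smooth (\<lambda>x. (1 / I) *\<^sub>R b x)" unfolding smooth_def
      by (intro allI Ck_on_scaleR Ck_on_const sm)
    show "0 \<le> (1 / I) *\<^sub>R b x" for x using nn pos by (simp add: I_def)
    show "(1 / I) *\<^sub>R b x = 0" if "x \<notin> ball c r" for x using out[OF that] by simp
    show "integrable lebesgue (\<lambda>x. (1 / I) *\<^sub>R b x)"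
      using intb bm by (simp add: integrable_completion)
    show "integral\<^sup>L lebesgue (\<lambda>x. (1 / I) *\<^sub>R b x) = 1"
      using pos bm by (simp add: integral_completion I_def)
  qed
qed

section \<open>Convolution with smooth kernels\<close>

lemma smooth_continuous: "smooth f \<Longrightarrow> continuous_on UNIV f"
  unfolding smooth_def using Ck_on_continuous by blast

lemma smooth_has_derivative: "smooth f \<Longrightarrow> (f has_derivative frechet_derivative f (at x)) (at x)"
  unfolding smooth_def using Ck_on_SucD(1) by blast

lemma smooth_partial: "smooth f \<Longrightarrow> b \<in> Basis \<Longrightarrow> smooth (\<lambda>x. frechet_derivative f (at x) b)"
  unfolding smooth_def using Ck_on_SucD(2) by blast

lemma smooth_borel: "smooth (f :: _ \<Rightarrow> 'b::euclidean_space) \<Longrightarrow> f \<in> borel_measurable borel"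
  by (intro borel_measurable_continuous_onI smooth_continuous)

lemma linear_sum_Basis: "linear f \<Longrightarrow> f h = (\<Sum>b\<in>Basis. (h \<bullet> b) *\<^sub>R f b)"
  for f :: "'a::euclidean_space \<Rightarrow> 'b::real_vector"
  by (subst euclidean_representation[of h, symmetric]) (simp add: linear_sum linear_scale del: euclidean_representation)

lemma frechet_derivative_eq_0_outside:
  fixes f :: "'a::euclidean_space \<Rightarrow> 'b::real_normed_vector"
  assumes "closed S" "\<And>y. y \<notin> S \<Longrightarrow> f y = 0" "x \<notin> S"
  shows "frechet_derivative f (at x) = (\<lambda>h. 0)"
proof -
  have "((\<lambda>y. 0) has_derivative (\<lambda>h. 0)) (at x)" by simp
  then have "(f has_derivative (\<lambda>h. 0)) (at x)"
    by (rule has_derivative_transform_within_open[of _ _ _ _ "- S"]) (use assms in auto)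
  then show ?thesis using frechet_derivative_at by metis
qed

lemma compact_support_bounded:
  fixes f :: "'a::euclidean_space \<Rightarrow> 'b::real_normed_vector"
  assumes "continuous_on UNIV f" "\<And>x. x \<notin> cball c r \<Longrightarrow> f x = 0"
  obtains B where "0 < B" "\<And>x. norm (f x) \<le> B"
proof -
  have "bounded (f ` cball c r)"
    by (intro compact_imp_bounded compact_continuous_image continuous_on_subset[OF assms(1)]) auto
  then obtain B where B: "0 < B" "\<forall>x\<in>cball c r. norm (f x) \<le> B"
    by (auto simp: bounded_pos)
  have "norm (f x) \<le> B" for x
    using B assms(2)[of x] by (cases "x \<in> cball c r") auto
  with B(1) show ?thesis using that by blast
qed

lemma norm_linear_le_sum:
  fixes f :: "'a::euclidean_space \<Rightarrow> 'b::real_normed_vector"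
  assumes "linear f"
  shows "norm (f h) \<le> (\<Sum>b\<in>Basis. norm (f b)) * norm h"
proof -
  have "norm (f h) \<le> (\<Sum>b\<in>Basis. norm ((h \<bullet> b) *\<^sub>R f b))"
    by (subst linear_sum_Basis[OF assms]) (rule norm_sum)
  also have "\<dots> \<le> (\<Sum>b\<in>Basis. norm h * norm (f b))"
    by (intro sum_mono) (auto intro!: mult_right_mono Basis_le_norm)
  finally show ?thesis by (simp add: sum_distrib_left mult.commute)
qed

lemma smooth_compact_Lipschitz:
  fixes f :: "'a::euclidean_space \<Rightarrow> real"
  assumes "smooth f" "\<And>x. x \<notin> cball c r \<Longrightarrow> f x = 0"
  obtains L where "0 \<le> L" "\<And>x y. norm (f x - f y) \<le> L * norm (x - y)"
proof -
  have "\<exists>B. \<forall>x. norm (frechet_derivative f (at x) b) \<le> B" if "b \<in> Basis" for b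
  proof -
    have out: "frechet_derivative f (at x) b = 0" if "x \<notin> cball c r" for x
      using frechet_derivative_eq_0_outside[of "cball c r" f x] assms(2) that by auto
    show ?thesis
      using compact_support_bounded[OF smooth_continuous[OF smooth_partial[OF assms(1) that]] out] by blast
  qed
  then obtain B where B: "\<And>b x. b \<in> Basis \<Longrightarrow> norm (frechet_derivative f (at x) b) \<le> B b"
    by metis
  have ons: "onorm (frechet_derivative f (at x)) \<le> (\<Sum>b\<in>Basis. B b)" for x
  proof (rule onorm_le)
    fix h
    have "norm (frechet_derivative f (at x) h) \<le> (\<Sum>b\<in>Basis. norm (frechet_derivative f (at x) b)) * norm h"
      by (intro norm_linear_le_sum has_derivative_linear[OF smooth_has_derivative[OF assms(1)]])
    also have "\<dots> \<le> (\<Sum>b\<in>Basis. B b) * norm h"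
      by (intro mult_right_mono sum_mono B) auto
    finally show "norm (frechet_derivative f (at x) h) \<le> (\<Sum>b\<in>Basis. B b) * norm h" .
  qed
  have "norm (f x - f y) \<le> (\<Sum>b\<in>Basis. B b) * norm (x - y)" for x y
    by (rule differentiable_bound[of UNIV f "\<lambda>x. frechet_derivative f (at x)"])
       (use ons smooth_has_derivative[OF assms(1)] in auto)
  moreover have "0 \<le> (\<Sum>b\<in>Basis. B b)"
    by (intro sum_nonneg) (use B order_trans norm_ge_zero in blast)
  ultimately show ?thesis using that by blast
qed

text \<open>
  A second-order remainder estimate that is uniform in the base point: all partial derivatives are
  Lipschitz, because they are again smooth with compact support.
\<close>

lemma smooth_compact_Taylor:
  fixes f :: "'a::euclidean_space \<Rightarrow> real"
  assumes "smooth f" "\<And>x. x \<notin> cball c r \<Longrightarrow> f x = 0"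
  obtains L where "0 \<le> L" "\<And>x h. norm (f (x + h) - f x - frechet_derivative f (at x) h) \<le> L * (norm h)\<^sup>2"
proof -
  have "\<exists>L. \<forall>x y. norm (frechet_derivative f (at x) b - frechet_derivative f (at y) b) \<le> L * norm (x - y)"
    if "b \<in> Basis" for b
  proof -
    have out: "frechet_derivative f (at x) b = 0" if "x \<notin> cball c r" for x
      using frechet_derivative_eq_0_outside[of "cball c r" f x] assms(2) that by auto
    show ?thesis
      using smooth_compact_Lipschitz[OF smooth_partial[OF assms(1) that] out] by blast
  qed
  then obtain B where B: "\<And>b x y. b \<in> Basis \<Longrightarrow>
      norm (frechet_derivative f (at x) b - frechet_derivative f (at y) b) \<le> B b * norm (x - y)"
    by metis
  define L where "L = (\<Sum>b\<in>Basis. \<bar>B b\<bar>)"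
  have lin: "linear (frechet_derivative f (at x))" for x
    by (rule has_derivative_linear[OF smooth_has_derivative[OF assms(1)]])
  have "norm (f (x + h) - f x - frechet_derivative f (at x) h) \<le> L * (norm h)\<^sup>2" for x h
  proof -
    have "norm (f (x + h) - f x - frechet_derivative f (at x) (x + h - x)) \<le> norm (x + h - x) * (L * norm h)"
    proof (rule differentiable_bound_linearization[where S = "closed_segment x (x + h)"])
      show "x + t *\<^sub>R (x + h - x) \<in> closed_segment x (x + h)" if "t \<in> {0..1}" for t
        using that by (auto simp: in_segment algebra_simps intro!: exI[of _ t])
      show "(f has_derivative frechet_derivative f (at y)) (at y within closed_segment x (x + h))" for y
        using smooth_has_derivative[OF assms(1)] has_derivative_at_withinI by blast
      show "onorm (frechet_derivative f (at y) - frechet_derivative f (at x)) \<le> L * norm h"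
        if "y \<in> closed_segment x (x + h)" for y
        unfolding fun_diff_def
      proof (rule onorm_le)
        fix v
        have "norm (frechet_derivative f (at y) v - frechet_derivative f (at x) v)
           \<le> (\<Sum>b\<in>Basis. norm (frechet_derivative f (at y) b - frechet_derivative f (at x) b)) * norm v"
          by (rule norm_linear_le_sum) (intro linear_compose_sub lin)
        also have "\<dots> \<le> (\<Sum>b\<in>Basis. \<bar>B b\<bar> * norm h) * norm v"
        proof (intro mult_right_mono sum_mono)
          fix b :: 'a assume b: "b \<in> Basis"
          have "norm (y - x) \<le> norm h"
            using segment_bound(1)[OF that] by simp
          then show "norm (frechet_derivative f (at y) b - frechet_derivative f (at x) b) \<le> \<bar>B b\<bar> * norm h"
            using B[OF b, of y x] mult_mono[OF abs_ge_self[of "B b"], of "norm (y - x)" "norm h"] by simp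
        qed auto
        finally show "norm (frechet_derivative f (at y) v - frechet_derivative f (at x) v) \<le> L * norm h * norm v"
          by (simp add: L_def sum_distrib_right)
      qed
    qed auto
    then show ?thesis by (simp add: power2_eq_square mult_ac)
  qed
  moreover have "0 \<le> L" by (auto simp: L_def intro: sum_nonneg)
  ultimately show ?thesis using that by blast
qed

lemma lebesgue_integral_affine:
  fixes f :: "'a::euclidean_space \<Rightarrow> 'b::euclidean_space"
  assumes [measurable]: "f \<in> borel_measurable borel" and "c \<noteq> 0"
  shows "integral\<^sup>L lebesgue f = \<bar>c\<bar> ^ DIM('a) *\<^sub>R integral\<^sup>L lebesgue (\<lambda>x. f (t + c *\<^sub>R x))"
proof -
  have "integral\<^sup>L lborel f = integral\<^sup>L (density (distr lborel borel (\<lambda>x. t + c *\<^sub>R x)) (\<lambda>_. ennreal (\<bar>c\<bar> ^ DIM('a)))) f"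
    using lborel_affine[OF assms(2), of t] by simp
  also have "\<dots> = \<bar>c\<bar> ^ DIM('a) *\<^sub>R integral\<^sup>L lborel (\<lambda>x. f (t + c *\<^sub>R x))"
    by (subst integral_density) (auto simp: integral_distr)
  finally show ?thesis by (simp add: integral_completion)
qed

text \<open>
  The kernel is evaluated at \<open>y - x\<close> rather than \<open>x - y\<close>. Thus \<open>conv \<eta> f x\<close> tests \<open>f\<close> against the
  translate of \<open>\<eta>\<close> by \<open>x\<close>, which fits the definition of weak derivatives, at the price of a sign in
  the formula for the derivative.
\<close>

definition conv :: "('a::euclidean_space \<Rightarrow> real) \<Rightarrow> ('a \<Rightarrow> 'b::euclidean_space) \<Rightarrow> 'a \<Rightarrow> 'b" where
  "conv \<eta> f x = (LINT y|lebesgue. \<eta> (y - x) *\<^sub>R f y)"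

lemma conv_integrable:
  fixes f :: "'a::euclidean_space \<Rightarrow> 'b::euclidean_space"
  assumes f: "L1_loc_on UNIV f" and \<eta>: "continuous_on UNIV \<eta>" "\<And>x. x \<notin> cball c r \<Longrightarrow> \<eta> x = 0"
  shows "integrable lebesgue (\<lambda>y. \<eta> (y - x) *\<^sub>R f y)"
proof -
  obtain B where B: "0 < B" "\<And>x. norm (\<eta> x) \<le> B"
    using compact_support_bounded[OF \<eta>] by blast
  let ?g = "\<lambda>y. indicator (cball (x + c) r) y *\<^sub>R f y"
  have g: "integrable lebesgue ?g"
    using f unfolding L1_loc_on_def set_integrable_def by auto
  have eq: "\<eta> (y - x) *\<^sub>R f y = \<eta> (y - x) *\<^sub>R ?g y" for y
    using \<eta>(2)[of "y - x"] by (auto simp: indicator_def dist_norm algebra_simps)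
  have [measurable]: "?g \<in> borel_measurable lebesgue" using g by auto
  have "(\<lambda>y. \<eta> (y - x)) \<in> borel_measurable borel"
    by (intro borel_measurable_continuous_onI continuous_on_compose2[OF \<eta>(1)] continuous_intros) auto
  then have [measurable]: "(\<lambda>y. \<eta> (y - x)) \<in> borel_measurable lebesgue"
    by (simp add: measurable_completion)
  have "integrable lebesgue (\<lambda>y. \<eta> (y - x) *\<^sub>R ?g y)"
  proof (rule Bochner_Integration.integrable_bound)
    show "integrable lebesgue (\<lambda>y. B *\<^sub>R ?g y)" using g by (rule integrable_scaleR_right)
    show "AE y in lebesgue. norm (\<eta> (y - x) *\<^sub>R ?g y) \<le> norm (B *\<^sub>R ?g y)"
      using B by (intro AE_I2) (auto simp: indicator_def intro!: mult_right_mono)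
  qed measurable
  then show ?thesis by (simp only: eq[symmetric])
qed

text \<open>
  Differentiation under the integral sign. The Taylor remainder of the kernel is uniformly quadratic and
  lives on a fixed ball, so it can be integrated against a locally integrable \<open>f\<close>.
\<close>

lemma conv_has_derivative:
  fixes f :: "'a::euclidean_space \<Rightarrow> 'b::euclidean_space"
  assumes f: "L1_loc_on UNIV f" and \<eta>: "smooth \<eta>" "\<And>x. x \<notin> cball c r \<Longrightarrow> \<eta> x = 0"
  shows "(conv \<eta> f has_derivative
     (\<lambda>h. - (\<Sum>b\<in>Basis. (h \<bullet> b) *\<^sub>R conv (\<lambda>w. frechet_derivative \<eta> (at w) b) f x))) (at x)"
proof -
  obtain L where L: "0 \<le> L" "\<And>x h. norm (\<eta> (x + h) - \<eta> x - frechet_derivative \<eta> (at x) h) \<le> L * (norm h)\<^sup>2"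
    using smooth_compact_Taylor[OF \<eta>] by blast
  define D where "D b w = frechet_derivative \<eta> (at w) b" for b w
  have D0: "D b w = 0" if "w \<notin> cball c r" for b w
    using frechet_derivative_eq_0_outside[of "cball c r" \<eta> w] \<eta>(2) that by (auto simp: D_def)
  have Dc: "continuous_on UNIV (D b)" if "b \<in> Basis" for b
    unfolding D_def by (rule smooth_continuous[OF smooth_partial[OF \<eta>(1) that]])
  have Dsum: "frechet_derivative \<eta> (at w) h = (\<Sum>b\<in>Basis. (h \<bullet> b) * D b w)" for w h
    using linear_sum_Basis[OF has_derivative_linear[OF smooth_has_derivative[OF \<eta>(1)]], of w h]
    by (simp add: D_def)
  have int0: "integrable lebesgue (\<lambda>y. \<eta> (y - z) *\<^sub>R f y)" for z
    by (rule conv_integrable[OF f smooth_continuous[OF \<eta>(1)] \<eta>(2)])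
  have int1: "integrable lebesgue (\<lambda>y. D b (y - x) *\<^sub>R f y)" if "b \<in> Basis" for b
    using conv_integrable[OF f Dc[OF that] D0] by blast
  define S where "S = cball (x + c) (r + 1)"
  have intS: "integrable lebesgue (\<lambda>y. indicator S y *\<^sub>R norm (f y))"
  proof -
    have "integrable lebesgue (\<lambda>y. indicator S y *\<^sub>R f y)"
      using f[unfolded L1_loc_on_def, THEN spec, of S] by (simp add: S_def set_integrable_def)
    then have "integrable lebesgue (\<lambda>y. norm (indicator S y *\<^sub>R f y))" by (rule integrable_norm)
    then show ?thesis by simp
  qed
  define K where "K = integral\<^sup>L lebesgue (\<lambda>y. indicator S y *\<^sub>R norm (f y))"
  have K0: "0 \<le> K" by (auto simp: K_def)
  have bnd: "norm (conv \<eta> f (x + h) - conv \<eta> f x - - (\<Sum>b\<in>Basis. (h \<bullet> b) *\<^sub>R conv (D b) f x)) \<le> L * K * (norm h)\<^sup>2"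
    if h: "norm h \<le> 1" for h
  proof -
    define g where "g y = (\<eta> (y - (x + h)) - \<eta> (y - x) + (\<Sum>b\<in>Basis. (h \<bullet> b) * D b (y - x)))" for y
    have sumint: "integrable lebesgue (\<lambda>y. \<Sum>b\<in>Basis. (h \<bullet> b) *\<^sub>R (D b (y - x) *\<^sub>R f y))"
      by (intro Bochner_Integration.integrable_sum Bochner_Integration.integrable_scaleR_right int1)
    have eqg: "g y *\<^sub>R f y = \<eta> (y - (x + h)) *\<^sub>R f y - \<eta> (y - x) *\<^sub>R f y + (\<Sum>b\<in>Basis. (h \<bullet> b) *\<^sub>R (D b (y - x) *\<^sub>R f y))" for y
      by (simp add: g_def scaleR_left.diff scaleR_left.add scaleR_left.sum)
    have gint: "integrable lebesgue (\<lambda>y. g y *\<^sub>R f y)"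
      unfolding eqg by (intro Bochner_Integration.integrable_add Bochner_Integration.integrable_diff int0 sumint)
    have "conv \<eta> f (x + h) - conv \<eta> f x - - (\<Sum>b\<in>Basis. (h \<bullet> b) *\<^sub>R conv (D b) f x) = integral\<^sup>L lebesgue (\<lambda>y. g y *\<^sub>R f y)"
      unfolding eqg conv_def
      using sumint int1
      by (simp add: int0 Bochner_Integration.integral_sum del: scaleR_scaleR)
    also have "norm \<dots> \<le> integral\<^sup>L lebesgue (\<lambda>y. L * (norm h)\<^sup>2 * (indicator S y *\<^sub>R norm (f y)))"
    proof (rule order_trans[OF integral_norm_bound], rule integral_mono)
      show "integrable lebesgue (\<lambda>y. norm (g y *\<^sub>R f y))" using gint by (rule integrable_norm)
      show "integrable lebesgue (\<lambda>y. L * (norm h)\<^sup>2 * (indicator S y *\<^sub>R norm (f y)))"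
        using intS by (rule integrable_mult_right)
      fix y :: 'a
      show "norm (g y *\<^sub>R f y) \<le> L * (norm h)\<^sup>2 * (indicator S y *\<^sub>R norm (f y))"
      proof (cases "y \<in> S")
        case True
        have "\<bar>g y\<bar> \<le> L * (norm h)\<^sup>2"
          using L(2)[of "y - x" "- h"] by (simp add: g_def Dsum algebra_simps sum_negf)
        then show ?thesis using True by (simp add: mult_right_mono)
      next
        case False
        then have n: "r + 1 < norm (x + c - y)" by (simp add: S_def dist_norm)
        moreover have "norm (x + c - y) \<le> norm (x + h + c - y) + norm h"
          using norm_triangle_ineq4[of "x + h + c - y" h] by (simp add: algebra_simps)
        ultimately have "y - (x + h) \<notin> cball c r" "y - x \<notin> cball c r"
          using h by (auto simp: dist_norm algebra_simps)
        then have "g y = 0" using \<eta>(2) D0 by (simp add: g_def)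
        then show ?thesis using L by simp
      qed
    qed
    also have "\<dots> = L * K * (norm h)\<^sup>2" by (simp add: K_def)
    finally show ?thesis .
  qed
  show ?thesis unfolding has_derivative_at_alt D_def[symmetric]
  proof (intro conjI allI impI)
    show "bounded_linear (\<lambda>h. - (\<Sum>b\<in>Basis. (h \<bullet> b) *\<^sub>R conv (D b) f x))"
      by (intro bounded_linear_minus bounded_linear_sum bounded_linear_scaleR_const bounded_linear_inner_left)
    fix e :: real assume e: "0 < e"
    define d where "d = min 1 (e / (L * K + 1))"
    have d: "0 < d" "d \<le> 1" using e L K0 by (auto simp: d_def add_nonneg_pos)
    have LK: "0 \<le> L * K" using L K0 by simp
    show "\<exists>d>0. \<forall>y. norm (y - x) < d \<longrightarrow>
        norm (conv \<eta> f y - conv \<eta> f x - - (\<Sum>b\<in>Basis. ((y - x) \<bullet> b) *\<^sub>R conv (D b) f x)) \<le> e * norm (y - x)"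
    proof (intro exI[of _ d] conjI allI impI)
      fix y assume y: "norm (y - x) < d"
      have "L * K * norm (y - x) \<le> L * K * (e / (L * K + 1))"
        using y LK by (intro mult_left_mono) (auto simp: d_def)
      also have "\<dots> \<le> e" using LK e by (simp add: divide_le_eq field_simps)
      finally have "L * K * (norm (y - x))\<^sup>2 \<le> e * norm (y - x)"
        by (simp add: power2_eq_square mult_right_mono flip: mult.assoc)
      then show "norm (conv \<eta> f y - conv \<eta> f x - - (\<Sum>b\<in>Basis. ((y - x) \<bullet> b) *\<^sub>R conv (D b) f x)) \<le> e * norm (y - x)"
        using bnd[of "y - x"] y d by auto
    qed (use d in auto)
  qed
qed

lemma conv_smooth:
  fixes f :: "'a::euclidean_space \<Rightarrow> 'b::euclidean_space"
  assumes f: "L1_loc_on UNIV f" and \<eta>: "smooth \<eta>" "\<And>x. x \<notin> cball c r \<Longrightarrow> \<eta> x = 0"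
  shows "smooth (conv \<eta> f)"
proof -
  have "Ck_on k UNIV (conv \<eta> f)" if "smooth \<eta>" "\<And>x. x \<notin> cball c r \<Longrightarrow> \<eta> x = 0" for k \<eta>
    using that
  proof (induction k arbitrary: \<eta>)
    case 0
    have "continuous_on UNIV (conv \<eta> f)"
      by (intro continuous_at_imp_continuous_on ballI has_derivative_continuous[OF conv_has_derivative[OF f 0]])
    then show ?case by simp
  next
    case (Suc k)
    show ?case
    proof (rule Ck_on_SucI[OF conv_has_derivative[OF f Suc.prems]])
      fix b :: 'a assume b: "b \<in> Basis"
      have "frechet_derivative \<eta> (at x) b = 0" if "x \<notin> cball c r" for x
        using frechet_derivative_eq_0_outside[of "cball c r" \<eta> x] Suc.prems(2) that by auto
      then have "Ck_on k UNIV (conv (\<lambda>w. frechet_derivative \<eta> (at w) b) f)"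
        by (intro Suc.IH smooth_partial Suc.prems b) auto
      then have "Ck_on k UNIV (\<lambda>x. (-1) *\<^sub>R conv (\<lambda>w. frechet_derivative \<eta> (at w) b) f x)"
        by (intro Ck_on_scaleR Ck_on_const)
      moreover have "- (\<Sum>b'\<in>Basis. (b \<bullet> b') *\<^sub>R conv (\<lambda>w. frechet_derivative \<eta> (at w) b') f x)
          = (-1) *\<^sub>R conv (\<lambda>w. frechet_derivative \<eta> (at w) b) f x" for x
        using b by (simp add: inner_Basis if_distrib[of "\<lambda>t. t *\<^sub>R _"] cong: if_cong)
      ultimately show "Ck_on k UNIV (\<lambda>x. - (\<Sum>b'\<in>Basis. (b \<bullet> b') *\<^sub>R conv (\<lambda>w. frechet_derivative \<eta> (at w) b') f x))"
        by simp
    qed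
  qed
  then show ?thesis using \<eta> unfolding smooth_def[of "conv \<eta> f"] by blast
qed

lemma conv_bound:
  fixes f :: "'a::euclidean_space \<Rightarrow> 'b::euclidean_space"
  assumes "AE x in lebesgue. norm (f x) \<le> K"
    and \<eta>: "\<eta> \<in> borel_measurable borel" "\<And>x. 0 \<le> \<eta> x" "integrable lebesgue \<eta>" "integral\<^sup>L lebesgue \<eta> = 1"
  shows "norm (conv \<eta> f x) \<le> K"
proof -
  have eq: "integral\<^sup>L lebesgue (\<lambda>y. \<eta> (y - x)) = 1"
    using lebesgue_integral_affine[OF \<eta>(1), of 1 "- x"] \<eta>(4) by simp
  then have int: "integrable lebesgue (\<lambda>y. \<eta> (y - x))"
    using not_integrable_integral_eq by fastforce
  have "norm (conv \<eta> f x) \<le> integral\<^sup>L lebesgue (\<lambda>y. \<eta> (y - x) * K)"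
    unfolding conv_def
  proof (rule order_trans[OF integral_norm_bound], rule integral_mono_AE')
    show "AE y in lebesgue. norm (\<eta> (y - x) *\<^sub>R f y) \<le> \<eta> (y - x) * K"
      using assms(1) by eventually_elim (use \<eta>(2) in \<open>auto intro: mult_left_mono\<close>)
    then show "AE y in lebesgue. 0 \<le> \<eta> (y - x) * K"
      by eventually_elim (meson norm_ge_zero order_trans)
  qed (use int in auto)
  then show ?thesis using eq by simp
qed

section \<open>Mollification\<close>

text \<open>
  The differentiation theorem for cubes, applied to \<open>norm (f y - q)\<close> for \<open>q\<close> in a countable dense set,
  gives the statement after approximating \<open>f x\<close> by such a \<open>q\<close>. The cubes have \<open>x\<close> as a corner.
\<close>

lemma lebesgue_points:
  fixes f :: "'a::euclidean_space \<Rightarrow> 'b::euclidean_space"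
  assumes f: "L1_loc_on UNIV f"
  shows "AE x in lebesgue. \<forall>e>0. \<exists>d>0. \<forall>h. 0 < h \<and> h < d \<longrightarrow>
     integral (cbox x (x + h *\<^sub>R One)) (\<lambda>y. norm (f y - f x)) \<le> e * h ^ DIM('a)"
proof -
  \<comment> \<open>countably many centres, so that the exceptional null sets can be united\<close>
  obtain D :: "'b set" where D: "countable D" "\<And>X. open X \<Longrightarrow> X \<noteq> {} \<Longrightarrow> \<exists>d\<in>D. d \<in> X"
    using countable_dense_setE by blast
  have abs: "(\<lambda>y. norm (f y - q)) absolutely_integrable_on cbox a b" for a b q
  proof -
    have "f absolutely_integrable_on cbox a b" using f by (simp add: L1_loc_on_def)
    then have "(\<lambda>y. f y - q) absolutely_integrable_on cbox a b"
      by (intro set_integral_diff) auto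
    then show ?thesis using absolutely_integrable_norm by (auto simp: o_def)
  qed
  then have intq: "(\<lambda>y. norm (f y - q)) integrable_on cbox a b" for a b q
    using set_lebesgue_integral_eq_integral(1) by blast
  have "\<exists>N. negligible N \<and> (\<forall>x e. x \<notin> N \<and> 0 < e \<longrightarrow>
               (\<exists>d>0. \<forall>h. 0 < h \<and> h < d \<longrightarrow>
                 norm (integral (cbox x (x + h *\<^sub>R One)) (\<lambda>y. norm (f y - q)) /\<^sub>R h ^ DIM('a) - norm (f x - q)) < e))" for q
    using integrable_ccontinuous_explicit[of "\<lambda>y. norm (f y - q)"] intq by metis
  then obtain N where N: "\<And>q. negligible (N q)"
      "\<And>q x e. x \<notin> N q \<Longrightarrow> 0 < e \<Longrightarrow>
               (\<exists>d>0. \<forall>h. 0 < h \<and> h < d \<longrightarrow>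
                 norm (integral (cbox x (x + h *\<^sub>R One)) (\<lambda>y. norm (f y - q)) /\<^sub>R h ^ DIM('a) - norm (f x - q)) < e)"
    by metis
  have "negligible (\<Union>(N ` D))"
    using D(1) N(1) by (intro negligible_countable_Union) auto
  then have "AE x in lebesgue. x \<notin> \<Union>(N ` D)"
    unfolding eventually_ae_filter_negligible by (intro exI[of _ "\<Union>(N ` D)"]) auto
  then show ?thesis
  proof eventually_elim
    case (elim x)
    show ?case
    proof (intro allI impI)
      fix e :: real assume e: "0 < e"
      then obtain q where q: "q \<in> D" "q \<in> ball (f x) (e / 3)"
        using D(2)[of "ball (f x) (e / 3)"] by auto
      then have qn: "norm (f x - q) < e / 3" by (simp add: dist_norm)
      obtain d where d: "0 < d" "\<And>h. 0 < h \<Longrightarrow> h < d \<Longrightarrow>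
          norm (integral (cbox x (x + h *\<^sub>R One)) (\<lambda>y. norm (f y - q)) /\<^sub>R h ^ DIM('a) - norm (f x - q)) < e / 3"
        using N(2)[of x q "e/3"] elim q e by auto
      show "\<exists>d>0. \<forall>h. 0 < h \<and> h < d \<longrightarrow>
          integral (cbox x (x + h *\<^sub>R One)) (\<lambda>y. norm (f y - f x)) \<le> e * h ^ DIM('a)"
      proof (intro exI[of _ d] conjI allI impI d)
        fix h assume h: "0 < h \<and> h < d"
        let ?C = "cbox x (x + h *\<^sub>R One)"
        have cont: "measure lborel ?C = h ^ DIM('a)"
          using h by (subst content_cbox) (auto simp: inner_add_left)
        have "integral ?C (\<lambda>y. norm (f y - f x)) \<le> integral ?C (\<lambda>y. norm (f y - q) + norm (f x - q))"
        proof (rule integral_le)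
          fix y show "norm (f y - f x) \<le> norm (f y - q) + norm (f x - q)"
            using norm_triangle_ineq4[of "f y - q" "f x - q"] by simp
        qed (auto intro!: intq integrable_add)
        also have "\<dots> = integral ?C (\<lambda>y. norm (f y - q)) + h ^ DIM('a) * norm (f x - q)"
          by (subst Henstock_Kurzweil_Integration.integral_add) (auto intro: intq simp: cont)
        also have "\<dots> \<le> (e / 3 + norm (f x - q)) * h ^ DIM('a) + h ^ DIM('a) * norm (f x - q)"
        proof -
          define I where "I = integral ?C (\<lambda>y. norm (f y - q))"
          define H where "H = h ^ DIM('a)"
          have H: "0 < H" using h by (simp add: H_def)
          have "norm (I /\<^sub>R H - norm (f x - q)) < e / 3"
            using d(2)[of h] h by (simp add: I_def H_def)
          then have "inverse H * I \<le> e / 3 + norm (f x - q)"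
            unfolding real_norm_def real_scaleR_def by linarith
          then have "(inverse H * I) * H \<le> (e / 3 + norm (f x - q)) * H"
            using H by (intro mult_right_mono) auto
          moreover have "(inverse H * I) * H = I" using H by simp
          ultimately show ?thesis unfolding I_def[symmetric] H_def[symmetric] by simp
        qed
        also have "\<dots> = (e / 3 + 2 * norm (f x - q)) * h ^ DIM('a)" by (simp add: algebra_simps)
        also have "\<dots> \<le> e * h ^ DIM('a)"
          using qn h by (intro mult_right_mono) auto
        finally show "integral ?C (\<lambda>y. norm (f y - f x)) \<le> e * h ^ DIM('a)" .
      qed
    qed
  qed
qed

text \<open>
  An approximate identity adapted to \<open>lebesgue_points\<close>: the supports lie in cubes with corner 0, and
  the bound by \<open>B\<close> over the volume of the cube compares the kernel with the average over the cube. The inclusion of the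
  supports in balls follows from that in cubes and is recorded for convenience.
\<close>

definition mollifier_seq :: "real \<Rightarrow> (nat \<Rightarrow> 'a::euclidean_space \<Rightarrow> real) \<Rightarrow> bool" where
  "mollifier_seq B \<rho> \<longleftrightarrow> 0 < B \<and> (\<forall>k. smooth (\<rho> k)) \<and> (\<forall>k x. 0 \<le> \<rho> k x) \<and>
    (\<forall>k x. x \<notin> cbox 0 ((1 / Suc k) *\<^sub>R One) \<longrightarrow> \<rho> k x = 0) \<and>
    (\<forall>k x. x \<notin> cball 0 (DIM('a) / Suc k) \<longrightarrow> \<rho> k x = 0) \<and>
    (\<forall>k. integrable lebesgue (\<rho> k)) \<and> (\<forall>k. integral\<^sup>L lebesgue (\<rho> k) = 1) \<and>
    (\<forall>k x. \<rho> k x \<le> B * real (Suc k) ^ DIM('a))"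

lemma mollifier_seqD:
  fixes \<rho> :: "nat \<Rightarrow> 'a::euclidean_space \<Rightarrow> real"
  assumes "mollifier_seq B \<rho>"
  shows "0 < B" "smooth (\<rho> k)" "0 \<le> \<rho> k x"
    "x \<notin> cbox 0 ((1 / Suc k) *\<^sub>R One) \<Longrightarrow> \<rho> k x = 0"
    "x \<notin> cball 0 (DIM('a) / Suc k) \<Longrightarrow> \<rho> k x = 0"
    "integrable lebesgue (\<rho> k)" "integral\<^sup>L lebesgue (\<rho> k) = 1"
    "\<rho> k x \<le> B * real (Suc k) ^ DIM('a)"
  using assms unfolding mollifier_seq_def by blast+

lemma mollifiers_exist:
  obtains B and \<rho> :: "nat \<Rightarrow> 'a::euclidean_space \<Rightarrow> real" where "mollifier_seq B \<rho>"
proof -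
  obtain \<eta> :: "'a \<Rightarrow> real" where \<eta>: "smooth \<eta>" "\<And>x. 0 \<le> \<eta> x" "\<And>x. x \<notin> ball ((1/2) *\<^sub>R One) (1/2) \<Longrightarrow> \<eta> x = 0"
    "integrable lebesgue \<eta>" "integral\<^sup>L lebesgue \<eta> = 1"
    using bump_exists[of "1/2" "(1/2) *\<^sub>R (One::'a)"] by auto
  have "\<eta> x = 0" if "x \<notin> cball ((1/2) *\<^sub>R One) (1/2)" for x
    using \<eta>(3)[of x] that by auto
  then obtain B where B: "0 < B" "\<And>x. norm (\<eta> x) \<le> B"
    using compact_support_bounded[OF smooth_continuous[OF \<eta>(1)]] by blast
  define \<rho> where "\<rho> k x = (real (Suc k) ^ DIM('a)) *\<^sub>R \<eta> (real (Suc k) *\<^sub>R x)" for k x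
  have out: "\<rho> k x = 0" if "x \<notin> cbox 0 ((1 / Suc k) *\<^sub>R One)" for k x
  proof -
    have "real (Suc k) *\<^sub>R x \<notin> ball ((1/2) *\<^sub>R One) (1/2)"
    proof
      assume *: "real (Suc k) *\<^sub>R x \<in> ball ((1/2) *\<^sub>R One) (1/2)"
      have "0 \<le> x \<bullet> b \<and> x \<bullet> b \<le> 1 / Suc k" if b: "b \<in> Basis" for b
      proof -
        have "\<bar>((1/2) *\<^sub>R One - real (Suc k) *\<^sub>R x) \<bullet> b\<bar> < 1/2"
          using Basis_le_norm[OF b, of "(1/2) *\<^sub>R One - real (Suc k) *\<^sub>R x"] * by (simp add: dist_norm)
        moreover have "((1/2) *\<^sub>R One - real (Suc k) *\<^sub>R x) \<bullet> b = 1/2 - real (Suc k) * (x \<bullet> b)"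
          using b by (simp add: inner_diff_left del: of_nat_Suc)
        ultimately have "0 \<le> real (Suc k) * (x \<bullet> b)" "real (Suc k) * (x \<bullet> b) \<le> 1"
          by linarith+
        then show ?thesis by (simp add: zero_le_mult_iff le_divide_eq mult.commute del: of_nat_Suc)
      qed
      then show False using that by (auto simp: mem_box)
    qed
    then show ?thesis using \<eta>(3) by (simp add: \<rho>_def)
  qed
  show ?thesis
  proof (rule that[of B \<rho>], unfold mollifier_seq_def, intro conjI allI impI)
    show "0 < B" by (rule B(1))
    fix k :: nat and x :: 'a
    have sm: "smooth (\<lambda>x. \<eta> (real (Suc k) *\<^sub>R x + 0))"
      unfolding smooth_def using \<eta>(1) Ck_on_affine[of _ \<eta> "real (Suc k)" 0] by (simp add: smooth_def)
    then show "smooth (\<rho> k)" unfolding \<rho>_def smooth_def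
      by (intro allI Ck_on_scaleR Ck_on_const) simp
    show "0 \<le> \<rho> k x" by (simp add: \<rho>_def \<eta>(2))
    show "x \<notin> cbox 0 ((1 / Suc k) *\<^sub>R One) \<Longrightarrow> \<rho> k x = 0" by (rule out)
    show "\<rho> k x = 0" if "x \<notin> cball 0 (DIM('a) / Suc k)"
    proof (rule out, rule notI)
      assume x: "x \<in> cbox 0 ((1 / Suc k) *\<^sub>R One)"
      have "norm x \<le> (\<Sum>b\<in>Basis. \<bar>x \<bullet> b\<bar>)" by (rule norm_le_l1)
      also have "\<dots> \<le> (\<Sum>b\<in>(Basis::'a set). 1 / Suc k)"
        using x by (intro sum_mono) (auto simp: mem_box)
      finally show False using that by simp
    qed
    have "integral\<^sup>L lebesgue \<eta> = integral\<^sup>L lebesgue (\<rho> k)"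
      using lebesgue_integral_affine[OF smooth_borel[OF \<eta>(1)], of "real (Suc k)" 0] \<eta>(5)
      by (simp add: \<rho>_def[abs_def] del: of_nat_Suc)
    then show 1: "integral\<^sup>L lebesgue (\<rho> k) = 1" using \<eta>(5) by simp
    then show "integrable lebesgue (\<rho> k)" using not_integrable_integral_eq by fastforce
    show "\<rho> k x \<le> B * real (Suc k) ^ DIM('a)"
      using B(2)[of "real (Suc k) *\<^sub>R x"] by (simp add: \<rho>_def abs_le_iff mult.commute mult_left_mono del: of_nat_Suc)
  qed
qed

text \<open>
  At a Lebesgue point the error is at most \<open>B\<close> times the mean oscillation over a small cube.
\<close>

lemma mollify_tendsto_AE:
  fixes f :: "'a::euclidean_space \<Rightarrow> 'b::euclidean_space"
  assumes f: "L1_loc_on UNIV f" and mol: "mollifier_seq B \<rho>"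
  shows "AE x in lebesgue. (\<lambda>k. conv (\<rho> k) f x) \<longlonglongrightarrow> f x"
proof -
  note B = mollifier_seqD(1)[OF mol] and \<rho> = mollifier_seqD(2-5,7-8)[OF mol]
  show ?thesis using lebesgue_points[OF f]
proof eventually_elim
  case (elim x)
  have c1: "L1_loc_on UNIV (\<lambda>y. f x)"
    unfolding L1_loc_on_def using absolutely_integrable_on_const lmeasurable_compact by blast
  show ?case
  proof (rule LIMSEQ_I)
    fix e :: real assume e: "0 < e"
    then have "0 < e / (2 * B)" using B by simp
    from elim[rule_format, OF this] obtain d where d: "0 < d" "\<And>h. 0 < h \<Longrightarrow> h < d \<Longrightarrow>
       integral (cbox x (x + h *\<^sub>R One)) (\<lambda>y. norm (f y - f x)) \<le> e / (2 * B) * h ^ DIM('a)"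
      by blast
    obtain n0 where n0: "1 / real (Suc n0) < d"
      using nat_approx_posE[OF d(1)] by auto
    have "norm (conv (\<rho> k) f x - f x) < e" if "k \<ge> n0" for k
    proof -
      define h where "h = 1 / real (Suc k)"
      have "h \<le> 1 / real (Suc n0)" using that by (simp add: h_def frac_le)
      then have h: "0 < h" "h < d" using n0 by (auto simp: h_def)
      let ?C = "cbox x (x + h *\<^sub>R One)"
      have i1: "integrable lebesgue (\<lambda>y. \<rho> k (y - x) *\<^sub>R f y)"
        by (rule conv_integrable[OF f smooth_continuous[OF \<rho>(1)] \<rho>(4)])
      have i2: "integrable lebesgue (\<lambda>y. \<rho> k (y - x) *\<^sub>R f x)"
        by (rule conv_integrable[OF c1 smooth_continuous[OF \<rho>(1)] \<rho>(4)])
      have "integral\<^sup>L lebesgue (\<lambda>y. \<rho> k (y - x)) = 1"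
        using lebesgue_integral_affine[OF smooth_borel[OF \<rho>(1)], of 1 k "- x"] \<rho>(5) by simp
      moreover then have "integrable lebesgue (\<lambda>y. \<rho> k (y - x))"
        using not_integrable_integral_eq by fastforce
      ultimately have "integral\<^sup>L lebesgue (\<lambda>y. \<rho> k (y - x) *\<^sub>R f x) = f x" by simp
      then have "conv (\<rho> k) f x - f x = integral\<^sup>L lebesgue (\<lambda>y. \<rho> k (y - x) *\<^sub>R f y - \<rho> k (y - x) *\<^sub>R f x)"
        unfolding conv_def using i1 i2 by (simp add: Bochner_Integration.integral_diff)
      also have "\<dots> = integral\<^sup>L lebesgue (\<lambda>y. \<rho> k (y - x) *\<^sub>R (f y - f x))"
        by (simp add: scaleR_diff_right)
      also have "norm \<dots> \<le> integral\<^sup>L lebesgue (\<lambda>y. (B / h ^ DIM('a)) * (indicator ?C y *\<^sub>R norm (f y - f x)))"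
      proof (rule order_trans[OF integral_norm_bound], rule integral_mono_AE')
        have "f absolutely_integrable_on ?C" using f by (simp add: L1_loc_on_def)
        then have "(\<lambda>y. f y - f x) absolutely_integrable_on ?C"
          by (intro set_integral_diff) auto
        then have abs: "(\<lambda>y. norm (f y - f x)) absolutely_integrable_on ?C"
          using absolutely_integrable_norm by (auto simp: o_def)
        then show "integrable lebesgue (\<lambda>y. (B / h ^ DIM('a)) * (indicator ?C y *\<^sub>R norm (f y - f x)))"
          unfolding set_integrable_def by (rule integrable_mult_right)
        show "AE y in lebesgue. norm (\<rho> k (y - x) *\<^sub>R (f y - f x)) \<le> (B / h ^ DIM('a)) * (indicator ?C y *\<^sub>R norm (f y - f x))"
        proof (rule AE_I2)
          fix y
          show "norm (\<rho> k (y - x) *\<^sub>R (f y - f x)) \<le> (B / h ^ DIM('a)) * (indicator ?C y *\<^sub>R norm (f y - f x))"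
          proof (cases "y \<in> ?C")
            case True
            then show ?thesis using \<rho>(2)[of k "y - x"] \<rho>(6)[of k "y - x"]
              by (auto simp: h_def power_divide intro!: mult_right_mono)
          next
            case False
            then have "y - x \<notin> cbox 0 (h *\<^sub>R One)"
              by (auto simp: mem_box inner_diff_left inner_add_left algebra_simps)
            then have "\<rho> k (y - x) = 0" unfolding h_def by (rule \<rho>(3))
            then show ?thesis using False by simp
          qed
        qed
        show "AE y in lebesgue. 0 \<le> (B / h ^ DIM('a)) * (indicator ?C y *\<^sub>R norm (f y - f x))"
          using B h by simp
      qed
      also have "\<dots> = (B / h ^ DIM('a)) * integral ?C (\<lambda>y. norm (f y - f x))"
      proof -
        have "f absolutely_integrable_on ?C" using f by (simp add: L1_loc_on_def)
        then have "(\<lambda>y. f y - f x) absolutely_integrable_on ?C"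
          by (intro set_integral_diff) auto
        then have "(\<lambda>y. norm (f y - f x)) absolutely_integrable_on ?C"
          using absolutely_integrable_norm by (auto simp: o_def)
        from set_lebesgue_integral_eq_integral(2)[OF this]
        show ?thesis by (simp add: set_lebesgue_integral_def)
      qed
      also have "\<dots> \<le> (B / h ^ DIM('a)) * (e / (2 * B) * h ^ DIM('a))"
        using d(2)[OF h] B h by (intro mult_left_mono) auto
      also have "\<dots> = e / 2" using B h by (simp add: field_simps)
      finally show ?thesis using e by simp
    qed
    then show "\<exists>no. \<forall>k\<ge>no. norm (conv (\<rho> k) f x - f x) < e" by blast
  qed
qed
qed

section \<open>Weak gradients\<close>

lemma test_functionI:
  fixes \<phi> :: "'a::euclidean_space \<Rightarrow> 'b::real_normed_vector"
  assumes "smooth \<phi>" "compact S" "S \<subseteq> \<Omega>" "\<And>x. x \<notin> S \<Longrightarrow> \<phi> x = 0"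
  shows "test_function \<Omega> \<phi>"
proof -
  have sub: "closure {x. \<phi> x \<noteq> 0} \<subseteq> S"
    by (rule closure_minimal) (use assms compact_imp_closed in auto)
  then have "compact (closure {x. \<phi> x \<noteq> 0})"
    using assms(2) by (metis bounded_subset closed_closure compact_eq_bounded_closed)
  then show ?thesis using assms(1,3) sub by (auto simp: test_function_def smooth_def)
qed

lemma test_function_smooth: "test_function \<Omega> \<phi> \<Longrightarrow> smooth \<phi>"
  by (simp add: test_function_def smooth_def)

lemma test_function_support:
  assumes "test_function \<Omega> \<phi>"
  shows "\<exists>S. compact S \<and> S \<subseteq> \<Omega> \<and> (\<forall>x. x \<notin> S \<longrightarrow> \<phi> x = 0) \<and>
     (\<forall>x. x \<notin> S \<longrightarrow> frechet_derivative \<phi> (at x) = (\<lambda>h. 0))"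
proof (intro exI[of _ "closure {x. \<phi> x \<noteq> 0}"] conjI allI impI)
  show out: "\<phi> x = 0" if "x \<notin> closure {x. \<phi> x \<noteq> 0}" for x
    using closure_subset[of "{x. \<phi> x \<noteq> 0}"] that by auto
  show "frechet_derivative \<phi> (at x) = (\<lambda>h. 0)" if "x \<notin> closure {x. \<phi> x \<noteq> 0}" for x
    by (rule frechet_derivative_eq_0_outside[OF closed_closure out that])
qed (use assms in \<open>auto simp: test_function_def\<close>)

lemma compact_supportE:
  fixes S :: "'a::euclidean_space set"
  assumes "compact S"
  obtains r where "\<And>x. x \<notin> cball 0 r \<Longrightarrow> x \<notin> S"
proof -
  obtain r where "\<forall>x\<in>S. norm x \<le> r" using compact_imp_bounded[OF assms] by (auto simp: bounded_iff)
  then show ?thesis by (intro that[of r]) auto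
qed

lemma integrable_mult_compact_support:
  fixes g :: "'a::euclidean_space \<Rightarrow> 'b::euclidean_space"
  assumes g: "g absolutely_integrable_on S" and S: "compact S" "S \<subseteq> \<Omega>"
    and \<phi>: "continuous_on UNIV \<phi>" "\<And>x. x \<notin> S \<Longrightarrow> \<phi> x = (0::real)"
  shows "(\<lambda>x. \<phi> x *\<^sub>R g x) absolutely_integrable_on \<Omega>"
proof -
  obtain r where r: "\<And>x. x \<notin> cball 0 r \<Longrightarrow> x \<notin> S" using compact_supportE[OF S(1)] by blast
  then have r0: "\<And>x. x \<notin> cball 0 r \<Longrightarrow> \<phi> x = 0" using \<phi>(2) by blast
  obtain B where B: "0 < B" "\<And>x. norm (\<phi> x) \<le> B"
    using compact_support_bounded[OF \<phi>(1) r0] by blast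
  have [measurable]: "\<phi> \<in> borel_measurable lebesgue"
    using borel_measurable_continuous_onI[OF \<phi>(1)] by (simp add: measurable_completion)
  have g': "integrable lebesgue (\<lambda>x. indicator S x *\<^sub>R g x)" using g by (simp add: set_integrable_def)
  have "integrable lebesgue (\<lambda>x. \<phi> x *\<^sub>R (indicator S x *\<^sub>R g x))"
  proof (rule Bochner_Integration.integrable_bound)
    show "integrable lebesgue (\<lambda>x. B *\<^sub>R (indicator S x *\<^sub>R g x))" using g' by (rule integrable_scaleR_right)
    have [measurable]: "(\<lambda>x. indicator S x *\<^sub>R g x) \<in> borel_measurable lebesgue" using g' by auto
    show "(\<lambda>x. \<phi> x *\<^sub>R (indicator S x *\<^sub>R g x)) \<in> borel_measurable lebesgue" by measurable
    show "AE x in lebesgue. norm (\<phi> x *\<^sub>R (indicator S x *\<^sub>R g x)) \<le> norm (B *\<^sub>R (indicator S x *\<^sub>R g x))"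
      using B by (intro AE_I2) (auto simp: indicator_def intro!: mult_right_mono)
  qed
  moreover have "\<phi> x *\<^sub>R (indicator S x *\<^sub>R g x) = indicator \<Omega> x *\<^sub>R (\<phi> x *\<^sub>R g x)" for x
    using \<phi>(2)[of x] S(2) by (cases "x \<in> S") auto
  ultimately show ?thesis by (simp only: set_integrable_def)
qed

text \<open>
  Translates of mollifiers are test functions, so the mollifications of \<open>g\<close> on fine scales vanish at
  interior points of a box inside \<open>\<Omega>\<close>; but they converge to \<open>g\<close> almost everywhere. Cutting \<open>g\<close> off to the box makes it locally
  integrable on the whole space.
\<close>

lemma fundamental_lemma:
  fixes g :: "'a::euclidean_space \<Rightarrow> real"
  assumes \<Omega>: "open \<Omega>" and g: "L1_loc_on \<Omega> g"
    and 0: "\<And>\<phi>. test_function \<Omega> \<phi> \<Longrightarrow> (LINT x:\<Omega>|lebesgue. g x * \<phi> x) = 0"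
  shows "AE x in lebesgue. x \<in> \<Omega> \<longrightarrow> g x = 0"
proof -
  obtain B and \<rho> :: "nat \<Rightarrow> 'a \<Rightarrow> real" where mol: "mollifier_seq B \<rho>"
    by (rule mollifiers_exist)
  note \<rho> = mollifier_seqD(2-5)[OF mol]
  obtain \<D> where \<D>: "countable \<D>" "\<D> \<subseteq> Pow \<Omega>" "\<And>X. X \<in> \<D> \<Longrightarrow> \<exists>a b. X = cbox a b" "\<Union>\<D> = \<Omega>"
    using open_countable_Union_open_cbox[OF \<Omega>] by metis
  have "AE x in lebesgue. x \<in> X \<longrightarrow> g x = 0" if X: "X \<in> \<D>" for X
  proof -
    obtain a b where ab: "X = cbox a b" using \<D>(3)[OF X] by blast
    have sub: "cbox a b \<subseteq> \<Omega>" using \<D>(2) X ab by auto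
    define gX where "gX x = indicator (cbox a b) x *\<^sub>R g x" for x
    have "integrable lebesgue gX"
      using g sub unfolding gX_def L1_loc_on_def set_integrable_def by simp
    then have loc: "L1_loc_on UNIV gX"
      unfolding L1_loc_on_def set_integrable_def
      by (intro allI impI integrable_mult_indicator lmeasurable_compact[THEN fmeasurableD]) auto
    have "AE x in lebesgue. x \<notin> cbox a b - box a b"
      using negligible_frontier_interval[of a b] unfolding eventually_ae_filter_negligible
      by (intro exI[of _ "cbox a b - box a b"]) auto
    moreover have "AE x in lebesgue. (\<lambda>k. conv (\<rho> k) gX x) \<longlonglongrightarrow> gX x"
      by (rule mollify_tendsto_AE[OF loc mol])
    ultimately show ?thesis
    proof eventually_elim
      case (elim x)
      show ?case
      proof
        assume x: "x \<in> X"
        then have xb: "x \<in> box a b" using elim ab by auto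
        obtain e where e: "0 < e" "cball x e \<subseteq> box a b"
          using open_contains_cball[of "box a b"] open_box xb by blast
        obtain n0 where n0: "1 / real (Suc n0) < e / DIM('a)"
          using nat_approx_posE[of "e / DIM('a)"] e by auto
        have "conv (\<rho> k) gX x = 0" if "k \<ge> n0" for k
        proof -
          have "1 / real (Suc k) \<le> 1 / real (Suc n0)" using that by (simp add: frac_le)
          then have "DIM('a) * (1 / real (Suc k)) \<le> DIM('a) * (e / DIM('a))"
            using n0 by (intro mult_left_mono) auto
          then have le: "DIM('a) / real (Suc k) \<le> e" by simp
          have out: "\<rho> k (y - x) = 0" if "y \<notin> cball x e" for y
            using \<rho>(4)[of "y - x" k] that le by (auto simp: dist_norm norm_minus_commute)
          have sm: "smooth (\<lambda>y. \<rho> k (y - x))"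
            using Ck_on_affine[of _ "\<rho> k" 1 "- x"] \<rho>(1)[of k] by (simp add: smooth_def)
          have "test_function \<Omega> (\<lambda>y. \<rho> k (y - x))"
            by (rule test_functionI[OF sm compact_cball[of x e]])
               (use e sub out box_subset_cbox[of a b] in auto)
          from 0[OF this] have "(LINT y|lebesgue. indicator \<Omega> y *\<^sub>R (g y * \<rho> k (y - x))) = 0"
            by (simp add: set_lebesgue_integral_def)
          moreover have "indicator \<Omega> y *\<^sub>R (g y * \<rho> k (y - x)) = \<rho> k (y - x) *\<^sub>R gX y" for y
          proof (cases "y \<in> cball x e")
            case True
            then have "y \<in> cbox a b" using e box_subset_cbox[of a b] by blast
            moreover then have "y \<in> \<Omega>" using sub by blast
            ultimately show ?thesis by (simp add: gX_def)
          qed (simp add: out)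
          ultimately show ?thesis by (simp only: conv_def)
        qed
        then have "(\<lambda>k. conv (\<rho> k) gX x) \<longlonglongrightarrow> 0"
          by (intro tendsto_eventually) (auto simp: eventually_sequentially)
        then have "gX x = 0" using elim LIMSEQ_unique by blast
        then show "g x = 0" using x ab by (simp add: gX_def)
      qed
    qed
  qed
  then have "AE x in lebesgue. \<forall>X\<in>\<D>. x \<in> X \<longrightarrow> g x = 0"
    by (subst AE_ball_countable[OF \<D>(1)]) blast
  then show ?thesis by eventually_elim (use \<D>(4) in blast)
qed

lemma L1_loc_on_component:
  fixes f :: "'a::euclidean_space \<Rightarrow> 'b::euclidean_space ^ 'm"
  assumes "L1_loc_on \<Omega> f" shows "L1_loc_on \<Omega> (\<lambda>x. f x $ j)"
  unfolding L1_loc_on_def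
proof (intro allI impI)
  fix K assume "compact K \<and> K \<subseteq> \<Omega>"
  then have "f absolutely_integrable_on K" using assms by (auto simp: L1_loc_on_def)
  then have "((\<lambda>v. v $ j) \<circ> f) absolutely_integrable_on K"
    by (rule absolutely_integrable_linear) (rule bounded_linear_vec_nth)
  then show "(\<lambda>x. f x $ j) absolutely_integrable_on K" by (simp add: o_def)
qed

lemma is_weak_gradientD:
  fixes u :: "real ^ 'n \<Rightarrow> real ^ 'm"
  assumes "is_weak_gradient \<Omega> u G"
  shows "L1_loc_on \<Omega> u" "L1_loc_on \<Omega> G"
    "test_function \<Omega> \<phi> \<Longrightarrow> (LINT x:\<Omega>|lebesgue. u x $ j * frechet_derivative \<phi> (at x) (axis i 1)) =
              - (LINT x:\<Omega>|lebesgue. G x $ j $ i * \<phi> x)"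
  using assms by (simp_all add: is_weak_gradient_def)

text \<open>
  This is what makes \<open>weak_grad\<close>, which is defined by choice, usable: it may be replaced by any weak
  gradient that is at hand.
\<close>

lemma is_weak_gradient_unique:
  fixes u :: "real ^ 'n \<Rightarrow> real ^ 'm"
  assumes \<Omega>: "open \<Omega>" and G: "is_weak_gradient \<Omega> u G" and G': "is_weak_gradient \<Omega> u G'"
  shows "AE x in lebesgue. x \<in> \<Omega> \<longrightarrow> G x = G' x"
proof -
  have "AE x in lebesgue. x \<in> \<Omega> \<longrightarrow> G x $ j $ i - G' x $ j $ i = 0" for i j
  proof (rule fundamental_lemma[OF \<Omega>])
    have LG: "L1_loc_on \<Omega> (\<lambda>x. G x $ j $ i)" "L1_loc_on \<Omega> (\<lambda>x. G' x $ j $ i)"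
      by (intro L1_loc_on_component is_weak_gradientD(2)[OF G] is_weak_gradientD(2)[OF G'])+
    then show "L1_loc_on \<Omega> (\<lambda>x. G x $ j $ i - G' x $ j $ i)"
      by (simp add: L1_loc_on_def set_integral_diff)
    fix \<phi> :: "real ^ 'n \<Rightarrow> real" assume \<phi>: "test_function \<Omega> \<phi>"
    obtain S where S: "compact S" "S \<subseteq> \<Omega>" "\<And>x. x \<notin> S \<Longrightarrow> \<phi> x = 0"
      "\<And>x. x \<notin> S \<Longrightarrow> frechet_derivative \<phi> (at x) = (\<lambda>h. 0)"
      using test_function_support[OF \<phi>] by metis
    have int: "(\<lambda>x. H x * \<phi> x) absolutely_integrable_on \<Omega>" if "L1_loc_on \<Omega> H" for H :: "real ^ 'n \<Rightarrow> real"
    proof -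
      have "H absolutely_integrable_on S"
        using that[unfolded L1_loc_on_def, THEN spec, of S] S(1,2) by simp
      from integrable_mult_compact_support[OF this S(1,2) smooth_continuous[OF test_function_smooth[OF \<phi>]] S(3)]
      show ?thesis by (simp add: mult.commute)
    qed
    have "(LINT x:\<Omega>|lebesgue. G x $ j $ i * \<phi> x) = (LINT x:\<Omega>|lebesgue. G' x $ j $ i * \<phi> x)"
      using is_weak_gradientD(3)[OF G \<phi>, of j i] is_weak_gradientD(3)[OF G' \<phi>, of j i] by simp
    then show "(LINT x:\<Omega>|lebesgue. (G x $ j $ i - G' x $ j $ i) * \<phi> x) = 0"
      using set_integral_diff(2)[OF int[OF LG(1)] int[OF LG(2)]] by (simp add: left_diff_distrib)
  qed
  then have "AE x in lebesgue. \<forall>j i. x \<in> \<Omega> \<longrightarrow> G x $ j $ i - G' x $ j $ i = 0"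
    by (simp only: AE_all_countable simp_thms)
  then show ?thesis by eventually_elim (auto simp: vec_eq_iff)
qed

lemma weak_grad_AE_eq:
  assumes "open \<Omega>" "is_weak_gradient \<Omega> u G"
  shows "is_weak_gradient \<Omega> u (weak_grad \<Omega> u)" "AE x in lebesgue. x \<in> \<Omega> \<longrightarrow> weak_grad \<Omega> u x = G x"
proof -
  show 1: "is_weak_gradient \<Omega> u (weak_grad \<Omega> u)"
    unfolding weak_grad_def using assms(2) by (rule someI[of "is_weak_gradient \<Omega> u"])
  show "AE x in lebesgue. x \<in> \<Omega> \<longrightarrow> weak_grad \<Omega> u x = G x"
    by (rule is_weak_gradient_unique[OF assms(1) 1 assms(2)])
qed

lemma is_weak_gradient_subset:
  fixes u :: "real ^ 'n \<Rightarrow> real ^ 'm"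
  assumes "is_weak_gradient UNIV u G"
  shows "is_weak_gradient \<Omega> u G"
  unfolding is_weak_gradient_def
proof (intro conjI allI impI)
  show "L1_loc_on \<Omega> u" "L1_loc_on \<Omega> G" using assms by (auto simp: is_weak_gradient_def L1_loc_on_def)
  fix \<phi> :: "real ^ 'n \<Rightarrow> real" and i j
  assume \<phi>: "test_function \<Omega> \<phi>"
  obtain S where S: "compact S" "S \<subseteq> \<Omega>" "\<And>x. x \<notin> S \<Longrightarrow> \<phi> x = 0"
      "\<And>x. x \<notin> S \<Longrightarrow> frechet_derivative \<phi> (at x) = (\<lambda>h. 0)"
      using test_function_support[OF \<phi>] by metis
  have "test_function UNIV \<phi>" using \<phi> by (simp add: test_function_def)
  from is_weak_gradientD(3)[OF assms this, of j i]
  have eq: "(LINT x|lebesgue. u x $ j * frechet_derivative \<phi> (at x) (axis i 1)) =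
              - (LINT x|lebesgue. G x $ j $ i * \<phi> x)"
    by (simp add: set_lebesgue_integral_def)
  have "indicator \<Omega> x *\<^sub>R (u x $ j * frechet_derivative \<phi> (at x) (axis i 1)) = u x $ j * frechet_derivative \<phi> (at x) (axis i 1)"
     "indicator \<Omega> x *\<^sub>R (G x $ j $ i * \<phi> x) = G x $ j $ i * \<phi> x" for x
    using S(2-4) by (cases "x \<in> \<Omega>"; force)+
  then show "(LINT x:\<Omega>|lebesgue. u x $ j * frechet_derivative \<phi> (at x) (axis i 1)) =
              - (LINT x:\<Omega>|lebesgue. G x $ j $ i * \<phi> x)"
    unfolding set_lebesgue_integral_def by (simp only: eq)
qed

section \<open>Weak gradients of limits of smooth maps\<close>

lemma integrable_compact_support:
  fixes f :: "'a::euclidean_space \<Rightarrow> real"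
  assumes "continuous_on UNIV f" "\<And>x. x \<notin> cball c r \<Longrightarrow> f x = 0"
  shows "integrable lebesgue f"
proof -
  have "(\<lambda>x. f x *\<^sub>R (1::real)) absolutely_integrable_on UNIV"
    by (rule integrable_mult_compact_support[where S = "cball c r"]) (use assms in auto)
  then show ?thesis by (simp add: set_integrable_def)
qed

lemma bounded_absolutely_integrable:
  fixes f :: "'a::euclidean_space \<Rightarrow> 'b::euclidean_space"
  assumes f: "f \<in> borel_measurable lebesgue" "AE x in lebesgue. norm (f x) \<le> K" and S: "S \<in> lmeasurable"
  shows "f absolutely_integrable_on S"
  unfolding set_integrable_def
proof (rule Bochner_Integration.integrable_bound)
  show "integrable lebesgue (\<lambda>x. K * indicator S x)"
    using S by (intro integrable_mult_right integrable_real_indicator) (auto simp: fmeasurable_def)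
  show "(\<lambda>x. indicat_real S x *\<^sub>R f x) \<in> borel_measurable lebesgue"
    using f(1) S by (intro borel_measurable_scaleR borel_measurable_indicator) auto
  show "AE x in lebesgue. norm (indicat_real S x *\<^sub>R f x) \<le> norm (K * indicator S x)"
    using f(2) by eventually_elim (auto simp: indicator_def)
qed

lemma bounded_L1_loc_on:
  fixes f :: "'a::euclidean_space \<Rightarrow> 'b::euclidean_space"
  assumes "f \<in> borel_measurable lebesgue" "AE x in lebesgue. norm (f x) \<le> K"
  shows "L1_loc_on \<Omega> f"
  using bounded_absolutely_integrable[OF assms] lmeasurable_compact by (auto simp: L1_loc_on_def)

text \<open>
  Convolution with the constant 1 is constant in \<open>x\<close>, and its derivative is minus the convolution of
  the partial derivative with 1.
\<close>

lemma integral_partial_eq_0: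
  fixes F :: "'a::euclidean_space \<Rightarrow> real"
  assumes F: "smooth F" and zero: "\<And>x. x \<notin> cball c r \<Longrightarrow> F x = 0" and b: "b \<in> Basis"
  shows "integral\<^sup>L lebesgue (\<lambda>x. frechet_derivative F (at x) b) = 0"
proof -
  have one: "L1_loc_on UNIV (\<lambda>y::'a. 1::real)"
    by (rule bounded_L1_loc_on[where K = 1]) auto
  define D where "D b = conv (\<lambda>w. frechet_derivative F (at w) b) (\<lambda>y. 1::real) 0" for b
  have "conv F (\<lambda>y. 1::real) = (\<lambda>x. integral\<^sup>L lebesgue F)"
    using lebesgue_integral_affine[OF smooth_borel[OF F], of 1 "- _"] by (simp add: conv_def fun_eq_iff)
  then have "(conv F (\<lambda>y. 1::real) has_derivative (\<lambda>h. 0)) (at 0)" by simp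
  from has_derivative_unique[OF this conv_has_derivative[OF one F zero]]
  have eq: "(\<lambda>h. 0) = (\<lambda>h. - (\<Sum>b'\<in>Basis. (h \<bullet> b') *\<^sub>R D b'))" unfolding D_def .
  have "(\<Sum>b'\<in>Basis. (b \<bullet> b') *\<^sub>R D b') = 0" using fun_cong[OF eq, of b] by simp
  then have "D b = 0" using b by (simp add: inner_Basis if_distrib[of "\<lambda>t. t * _"] cong: if_cong)
  then show ?thesis by (simp add: D_def conv_def)
qed

lemma Ck_on_vec_nth:
  fixes f :: "'a::euclidean_space \<Rightarrow> real ^ 'm"
  shows "Ck_on k UNIV f \<Longrightarrow> Ck_on k UNIV (\<lambda>x. f x $ j)"
proof (induction k arbitrary: f)
  case (Suc k)
  show ?case
    by (rule Ck_on_SucI[OF bounded_linear.has_derivative[OF bounded_linear_vec_nth Ck_on_SucD(1)[OF Suc.prems]]])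
       (intro Suc.IH Ck_on_SucD(2)[OF Suc.prems])
qed (auto intro: continuous_intros)

lemma continuous_on_vec_nth: "continuous_on S f \<Longrightarrow> continuous_on S (\<lambda>x. f x $ j)"
  by (intro continuous_intros)

lemma borel_measurable_vec_nth:
  fixes f :: "'a \<Rightarrow> 'b::euclidean_space ^ 'm"
  assumes "f \<in> borel_measurable M" shows "(\<lambda>x. f x $ j) \<in> borel_measurable M"
proof -
  have "continuous_on UNIV (\<lambda>v::'b^'m. v $ j)" by (intro continuous_intros)
  from measurable_compose[OF assms borel_measurable_continuous_onI[OF this]] show ?thesis .
qed

text \<open>
  The one closure property from which all weak gradients below are obtained: the classical formula for
  integration by parts passes to bounded pointwise limits by dominated convergence.
\<close>

lemma is_weak_gradient_limit:
  fixes v :: "real ^ 'n \<Rightarrow> real ^ 'm"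
  assumes sm: "\<And>k. smooth (vs k)" and D: "\<And>k x. (vs k has_derivative (\<lambda>h. Ds k x *v h)) (at x)" and cont: "\<And>k. continuous_on UNIV (Ds k)"
    and bnd: "\<And>k x. norm (vs k x) \<le> K" "\<And>k x. norm (Ds k x) \<le> M"
    and meas: "v \<in> borel_measurable lebesgue" "G \<in> borel_measurable lebesgue"
    and lim: "AE x in lebesgue. (\<lambda>k. vs k x) \<longlonglongrightarrow> v x" "AE x in lebesgue. (\<lambda>k. Ds k x) \<longlonglongrightarrow> G x"
  shows "is_weak_gradient UNIV v G"
proof -
  have bv: "AE x in lebesgue. norm (v x) \<le> K"
    using lim(1) by eventually_elim (rule tendsto_upperbound[OF tendsto_norm], assumption, use bnd in auto)
  have bG: "AE x in lebesgue. norm (G x) \<le> M"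
    using lim(2) by eventually_elim (rule tendsto_upperbound[OF tendsto_norm], assumption, use bnd in auto)
  have contv: "continuous_on UNIV (vs k)" for k
    by (rule smooth_continuous[OF sm])
  have main: "(LINT x|lebesgue. v x $ j * frechet_derivative \<phi> (at x) (axis i 1)) = - (LINT x|lebesgue. G x $ j $ i * \<phi> x)"
    if \<phi>: "test_function UNIV \<phi>" for \<phi> :: "real ^ 'n \<Rightarrow> real" and i j
  proof -
    define b where "b = (axis i 1 :: real ^ 'n)"
    define \<phi>b where "\<phi>b x = frechet_derivative \<phi> (at x) b" for x
    have b: "b \<in> Basis" by (simp add: b_def axis_in_Basis_iff)
    have sm\<phi>: "smooth \<phi>" by (rule test_function_smooth[OF \<phi>])
    have c\<phi>: "continuous_on UNIV \<phi>" by (rule smooth_continuous[OF sm\<phi>])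
    have c\<phi>b: "continuous_on UNIV \<phi>b"
      unfolding \<phi>b_def by (rule smooth_continuous[OF smooth_partial[OF sm\<phi> b]])
    obtain S where S: "compact S" "\<And>x. x \<notin> S \<Longrightarrow> \<phi> x = 0" "\<And>x. x \<notin> S \<Longrightarrow> frechet_derivative \<phi> (at x) = (\<lambda>h. 0)"
      using test_function_support[OF \<phi>] by metis
    obtain r where r: "\<And>x. x \<notin> cball 0 r \<Longrightarrow> x \<notin> S" using compact_supportE[OF S(1)] by blast
    have z: "\<phi> x = 0" "\<phi>b x = 0" if "x \<notin> cball 0 r" for x
      using S(2,3) r[OF that] by (auto simp: \<phi>b_def)
    have i1: "integrable lebesgue \<phi>" by (rule integrable_compact_support[OF c\<phi> z(1)])
    have i2: "integrable lebesgue \<phi>b" by (rule integrable_compact_support[OF c\<phi>b z(2)])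
    have ib: "integrable lebesgue (\<lambda>x. g x * \<theta> x)"
      if "continuous_on UNIV g" "continuous_on UNIV \<theta>" "\<And>x. x \<notin> cball 0 r \<Longrightarrow> \<theta> x = 0" for g \<theta> :: "real ^ 'n \<Rightarrow> real"
      by (rule integrable_compact_support[where c = 0 and r = r]) (use that in \<open>auto intro!: continuous_intros\<close>)
    have ibp: "(LINT x|lebesgue. vs k x $ j * \<phi>b x) = - (LINT x|lebesgue. Ds k x $ j $ i * \<phi> x)" for k
    proof -
      have "smooth (\<lambda>x. vs k x $ j *\<^sub>R \<phi> x)"
        using sm[of k] sm\<phi> unfolding smooth_def by (intro allI Ck_on_scaleR Ck_on_vec_nth) auto
      then have F: "smooth (\<lambda>x. vs k x $ j * \<phi> x)" by simp
      have "((\<lambda>x. vs k x $ j * \<phi> x) has_derivative (\<lambda>h. vs k x $ j * frechet_derivative \<phi> (at x) h + (Ds k x *v h) $ j * \<phi> x)) (at x)" for x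
        by (intro has_derivative_mult smooth_has_derivative[OF sm\<phi>] bounded_linear.has_derivative[OF bounded_linear_vec_nth D])
      note fd = frechet_derivative_at[OF this]
      have "integral\<^sup>L lebesgue (\<lambda>x. vs k x $ j * frechet_derivative \<phi> (at x) b + (Ds k x *v b) $ j * \<phi> x) = 0"
        using integral_partial_eq_0[OF F _ b, of 0 r] z(1) by (simp add: fun_cong[OF fd])
      moreover have "(Ds k x *v b) $ j = Ds k x $ j $ i" for x
        by (simp add: b_def matrix_vector_mult_basis column_def)
      ultimately have "integral\<^sup>L lebesgue (\<lambda>x. vs k x $ j * \<phi>b x + Ds k x $ j $ i * \<phi> x) = 0"
        by (simp add: \<phi>b_def)
      then show ?thesis
        using Bochner_Integration.integral_add[OF ib[OF continuous_on_vec_nth[OF contv[of k], of j] c\<phi>b z(2)]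
            ib[OF continuous_on_vec_nth[OF continuous_on_vec_nth[OF cont[of k], of j], of i] c\<phi> z(1)]]
        by simp
    qed
    have lim1: "(\<lambda>k. LINT x|lebesgue. vs k x $ j * \<phi>b x) \<longlonglongrightarrow> (LINT x|lebesgue. v x $ j * \<phi>b x)"
    proof (rule integral_dominated_convergence)
      show "(\<lambda>x. v x $ j * \<phi>b x) \<in> borel_measurable lebesgue"
        using borel_measurable_vec_nth[OF meas(1)] i2 by (intro borel_measurable_times) auto
      show "(\<lambda>x. vs k x $ j * \<phi>b x) \<in> borel_measurable lebesgue" for k
        using ib[OF continuous_on_vec_nth[OF contv[of k], of j] c\<phi>b z(2)] by auto
      show "integrable lebesgue (\<lambda>x. K * norm (\<phi>b x))" using i2 by (intro integrable_mult_right integrable_norm)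
      show "AE x in lebesgue. (\<lambda>k. vs k x $ j * \<phi>b x) \<longlonglongrightarrow> v x $ j * \<phi>b x"
        using lim(1) by eventually_elim (intro tendsto_intros)
      have "\<bar>vs k x $ j\<bar> \<le> K" for k x
        using bnd(1)[of k x] Finite_Cartesian_Product.norm_nth_le[of "vs k x" j] by simp
      then show "AE x in lebesgue. norm (vs k x $ j * \<phi>b x) \<le> K * norm (\<phi>b x)" for k
        by (auto simp: abs_mult intro!: mult_right_mono)
    qed
    have lim2: "(\<lambda>k. LINT x|lebesgue. Ds k x $ j $ i * \<phi> x) \<longlonglongrightarrow> (LINT x|lebesgue. G x $ j $ i * \<phi> x)"
    proof (rule integral_dominated_convergence)
      show "(\<lambda>x. G x $ j $ i * \<phi> x) \<in> borel_measurable lebesgue"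
        using borel_measurable_vec_nth[OF borel_measurable_vec_nth[OF meas(2)]] i1 by (intro borel_measurable_times) auto
      show "(\<lambda>x. Ds k x $ j $ i * \<phi> x) \<in> borel_measurable lebesgue" for k
        using ib[OF continuous_on_vec_nth[OF continuous_on_vec_nth[OF cont[of k], of j], of i] c\<phi> z(1)] by auto
      show "integrable lebesgue (\<lambda>x. M * norm (\<phi> x))" using i1 by (intro integrable_mult_right integrable_norm)
      show "AE x in lebesgue. (\<lambda>k. Ds k x $ j $ i * \<phi> x) \<longlonglongrightarrow> G x $ j $ i * \<phi> x"
        using lim(2) by eventually_elim (intro tendsto_intros)
      have "\<bar>Ds k x $ j $ i\<bar> \<le> M" for k x
        using bnd(2)[of k x] Finite_Cartesian_Product.norm_nth_le[of "Ds k x" j]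
          Finite_Cartesian_Product.norm_nth_le[of "Ds k x $ j" i] by simp
      then show "AE x in lebesgue. norm (Ds k x $ j $ i * \<phi> x) \<le> M * norm (\<phi> x)" for k
        by (auto simp: abs_mult intro!: mult_right_mono)
    qed
    have "(LINT x|lebesgue. v x $ j * \<phi>b x) = - (LINT x|lebesgue. G x $ j $ i * \<phi> x)"
      by (rule LIMSEQ_unique[OF lim1]) (use tendsto_minus[OF lim2] ibp in simp)
    then show ?thesis by (simp add: \<phi>b_def b_def)
  qed
  show ?thesis
    unfolding is_weak_gradient_def
    using bounded_L1_loc_on[OF meas(1) bv] bounded_L1_loc_on[OF meas(2) bG] main
    by (simp add: set_lebesgue_integral_def)
qed

lemma sum_Basis_vec:
  fixes f :: "real ^ 'n \<Rightarrow> 'b::comm_monoid_add"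
  shows "(\<Sum>b\<in>Basis. f b) = (\<Sum>i\<in>UNIV. f (axis i 1))"
proof -
  have "(Basis :: (real ^ 'n) set) = (\<lambda>i. axis i 1) ` UNIV"
    by (auto simp: Basis_vec_def)
  moreover have "inj (\<lambda>i. axis i 1 :: real ^ 'n)" by (auto simp: inj_def axis_eq_axis)
  ultimately show ?thesis by (metis sum.reindex comp_apply sum.cong)
qed

text \<open>
  The derivative of the kernel is moved to \<open>u\<close> by the definition of the weak gradient, the translated
  kernel being the test function. Hence mollification commutes with taking the gradient.
\<close>

lemma conv_weak_derivative:
  fixes u :: "real ^ 'n \<Rightarrow> real ^ 'm"
  assumes wg: "is_weak_gradient UNIV u G" and \<eta>: "smooth \<eta>" "\<And>x. x \<notin> cball c r \<Longrightarrow> \<eta> x = 0"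
  shows "(conv \<eta> u has_derivative (\<lambda>h. conv \<eta> G x *v h)) (at x)"
proof -
  have "conv (\<lambda>w. frechet_derivative \<eta> (at w) (axis i 1)) u x $ j = - (conv \<eta> G x $ j $ i)" for i j
  proof -
    define b where "b = (axis i 1 :: real ^ 'n)"
    have b: "b \<in> Basis" by (simp add: b_def axis_in_Basis_iff)
    have zb: "frechet_derivative \<eta> (at w) b = 0" if "w \<notin> cball c r" for w
      using frechet_derivative_eq_0_outside[of "cball c r" \<eta>, OF closed_cball \<eta>(2) that] by simp
    define \<phi> where "\<phi> y = \<eta> (y - x)" for y
    have "smooth \<phi>"
      using \<eta>(1) Ck_on_affine[of _ \<eta> 1 "- x"] by (simp add: smooth_def \<phi>_def[abs_def])
    then have tf: "test_function UNIV \<phi>"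
      by (rule test_functionI[OF _ compact_cball[of "x + c" r]])
         (auto simp: \<phi>_def dist_norm algebra_simps intro!: \<eta>(2))
    have fd: "frechet_derivative \<phi> (at y) = frechet_derivative \<eta> (at (y - x))" for y
    proof -
      have "((\<lambda>y. y - x) has_derivative (\<lambda>h. h)) (at y)" by (auto intro!: derivative_eq_intros)
      from has_derivative_compose[OF this smooth_has_derivative[OF \<eta>(1)]]
      show ?thesis unfolding \<phi>_def using frechet_derivative_at by metis
    qed
    have int1: "integrable lebesgue (\<lambda>y. frechet_derivative \<eta> (at (y - x)) b *\<^sub>R u y)"
      by (rule conv_integrable[OF is_weak_gradientD(1)[OF wg] smooth_continuous[OF smooth_partial[OF \<eta>(1) b]] zb])
    have int2: "integrable lebesgue (\<lambda>y. \<eta> (y - x) *\<^sub>R G y)"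
      by (rule conv_integrable[OF is_weak_gradientD(2)[OF wg] smooth_continuous[OF \<eta>(1)] \<eta>(2)])
    have "conv (\<lambda>w. frechet_derivative \<eta> (at w) b) u x $ j = (LINT y|lebesgue. (frechet_derivative \<eta> (at (y - x)) b *\<^sub>R u y) $ j)"
      unfolding conv_def by (rule integral_bounded_linear[OF bounded_linear_vec_nth int1, symmetric])
    also have "\<dots> = (LINT y|lebesgue. u y $ j * frechet_derivative \<phi> (at y) b)"
      by (simp add: fd mult.commute)
    also have "\<dots> = - (LINT y|lebesgue. G y $ j $ i * \<phi> y)"
      using is_weak_gradientD(3)[OF wg tf, of j i] by (simp add: set_lebesgue_integral_def b_def)
    also have "(LINT y|lebesgue. G y $ j $ i * \<phi> y) = (LINT y|lebesgue. (\<eta> (y - x) *\<^sub>R G y) $ j $ i)"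
      by (simp add: \<phi>_def mult.commute)
    also have "\<dots> = conv \<eta> G x $ j $ i"
      unfolding conv_def
      by (rule integral_bounded_linear[OF bounded_linear_compose[OF bounded_linear_vec_nth bounded_linear_vec_nth] int2])
    finally show ?thesis by (simp add: b_def)
  qed
  then have "- (\<Sum>b\<in>Basis. (h \<bullet> b) *\<^sub>R conv (\<lambda>w. frechet_derivative \<eta> (at w) b) u x) = conv \<eta> G x *v h" for h
    by (simp add: vec_eq_iff sum_Basis_vec inner_axis sum_component matrix_vector_mult_def sum_negf mult.commute)
  then show ?thesis
    using conv_has_derivative[OF is_weak_gradientD(1)[OF wg] \<eta>, where x = x] by (simp only:)
qed

text \<open>
  The properties of mollifications that are used later on. The bounds hold at every point, while the
  convergence is almost everywhere.
\<close>

definition smooth_approx ::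
  "(nat \<Rightarrow> real ^ 'n \<Rightarrow> real ^ 'm) \<Rightarrow> (nat \<Rightarrow> real ^ 'n \<Rightarrow> real ^ 'n ^ 'm) \<Rightarrow> real \<Rightarrow> real \<Rightarrow>
   (real ^ 'n \<Rightarrow> real ^ 'm) \<Rightarrow> (real ^ 'n \<Rightarrow> real ^ 'n ^ 'm) \<Rightarrow> bool" where
  "smooth_approx us Ds K M u G \<longleftrightarrow>
     (\<forall>k. smooth (us k)) \<and> (\<forall>k x. (us k has_derivative (\<lambda>h. Ds k x *v h)) (at x)) \<and>
     (\<forall>k. continuous_on UNIV (Ds k)) \<and> (\<forall>k x. norm (us k x) \<le> K) \<and> (\<forall>k x. norm (Ds k x) \<le> M) \<and>
     (AE x in lebesgue. (\<lambda>k. us k x) \<longlonglongrightarrow> u x) \<and> (AE x in lebesgue. (\<lambda>k. Ds k x) \<longlonglongrightarrow> G x)"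

lemma smooth_approxD:
  assumes "smooth_approx us Ds K M u G"
  shows "smooth (us k)" "(us k has_derivative (\<lambda>h. Ds k x *v h)) (at x)"
    "continuous_on UNIV (Ds k)" "norm (us k x) \<le> K" "norm (Ds k x) \<le> M"
    "AE x in lebesgue. (\<lambda>k. us k x) \<longlonglongrightarrow> u x" "AE x in lebesgue. (\<lambda>k. Ds k x) \<longlonglongrightarrow> G x"
  using assms unfolding smooth_approx_def by blast+

lemma smooth_approximation:
  fixes u :: "real ^ 'n \<Rightarrow> real ^ 'm"
  assumes wg: "is_weak_gradient UNIV u G"
    and bnd: "AE x in lebesgue. norm (u x) \<le> K" "AE x in lebesgue. norm (G x) \<le> M"
  obtains us Ds where "smooth_approx us Ds K M u G"
proof -
  obtain B and \<rho> :: "nat \<Rightarrow> real ^ 'n \<Rightarrow> real" where mol: "mollifier_seq B \<rho>"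
    by (rule mollifiers_exist)
  note \<rho> = mollifier_seqD[OF mol]
  note L = is_weak_gradientD(1,2)[OF wg]
  show ?thesis
  proof (rule that[of "\<lambda>k. conv (\<rho> k) u" "\<lambda>k. conv (\<rho> k) G"], unfold smooth_approx_def, intro conjI allI)
    fix k x
    show "smooth (conv (\<rho> k) u)" by (rule conv_smooth[OF L(1) \<rho>(2,5)])
    show "(conv (\<rho> k) u has_derivative (\<lambda>h. conv (\<rho> k) G x *v h)) (at x)"
      by (rule conv_weak_derivative[OF wg \<rho>(2,5)])
    show "continuous_on UNIV (conv (\<rho> k) G)" by (rule smooth_continuous[OF conv_smooth[OF L(2) \<rho>(2,5)]])
    show "norm (conv (\<rho> k) u x) \<le> K" by (rule conv_bound[OF bnd(1) smooth_borel[OF \<rho>(2)] \<rho>(3,6,7)])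
    show "norm (conv (\<rho> k) G x) \<le> M" by (rule conv_bound[OF bnd(2) smooth_borel[OF \<rho>(2)] \<rho>(3,6,7)])
  qed (rule mollify_tendsto_AE[OF L(1) mol] mollify_tendsto_AE[OF L(2) mol])+
qed

section \<open>Cut-off competitors\<close>

text \<open>
  The matrix with rows \<open>c $ j *\<^sub>R g\<close>: the gradient of \<open>\<psi> *\<^sub>R w\<close> is \<open>outer w (grad \<psi>)\<close> plus \<open>\<psi>\<close> times the
  gradient of \<open>w\<close>.
\<close>

definition outer :: "real ^ 'm \<Rightarrow> real ^ 'n \<Rightarrow> real ^ 'n ^ 'm" where
  "outer c g = (\<chi> j. c $ j *\<^sub>R g)"

lemma norm_outer: "norm (outer c g) = norm c * norm g"
proof -
  have "norm (outer c g) = L2_set (\<lambda>j. norm (c $ j) * norm g) UNIV"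
    by (subst norm_vec_def) (simp add: outer_def)
  also have "\<dots> = L2_set (\<lambda>j. norm (c $ j)) UNIV * norm g"
    by (rule L2_set_left_distrib[symmetric]) simp
  finally show ?thesis by (subst norm_vec_def[of c]) simp
qed

lemma bounded_bilinear_outer: "bounded_bilinear outer"
  by (rule bounded_bilinear.intro)
     (auto simp: outer_def vec_eq_iff scaleR_left_distrib scaleR_right_distrib algebra_simps norm_outer[unfolded outer_def] intro!: exI[of _ 1])

lemma outer_mult_vec: "outer c g *v h = (g \<bullet> h) *\<^sub>R c"
  by (simp add: outer_def vec_eq_iff matrix_vector_mult_def inner_vec_def sum_distrib_right sum_distrib_left mult_ac)

lemma continuous_on_outer [continuous_intros]:
  "continuous_on S f \<Longrightarrow> continuous_on S g \<Longrightarrow> continuous_on S (\<lambda>x. outer (f x) (g x))"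
  by (rule bounded_bilinear.continuous_on[OF bounded_bilinear_outer])

lemma borel_measurable_outer:
  assumes "f \<in> borel_measurable M" "g \<in> borel_measurable M"
  shows "(\<lambda>x. outer (f x) (g x)) \<in> borel_measurable M"
  by (rule borel_measurable_continuous_Pair[OF assms]) (intro continuous_intros)

lemma grad_inner:
  fixes f :: "'a::euclidean_space \<Rightarrow> real"
  assumes "f differentiable (at x)"
  shows "frechet_derivative f (at x) h = grad f x \<bullet> h"
proof -
  have "linear (frechet_derivative f (at x))" by (rule linear_frechet_derivative[OF assms])
  from linear_sum_Basis[OF this, of h] show ?thesis
    by (simp add: grad_def inner_sum_right inner_commute[of _ h] mult.commute)
qed

lemma smooth_grad_continuous:
  fixes \<psi> :: "'a::euclidean_space \<Rightarrow> real"
  assumes "smooth \<psi>" shows "continuous_on UNIV (grad \<psi>)"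
  unfolding grad_def by (intro continuous_intros smooth_continuous[OF smooth_partial[OF assms]])

lemma smooth_has_derivative_grad:
  fixes \<psi> :: "'a::euclidean_space \<Rightarrow> real"
  assumes "smooth \<psi>" shows "(\<psi> has_derivative (\<lambda>h. grad \<psi> x \<bullet> h)) (at x)"
proof -
  have d: "(\<psi> has_derivative frechet_derivative \<psi> (at x)) (at x)" by (rule smooth_has_derivative[OF assms])
  then have "frechet_derivative \<psi> (at x) = (\<lambda>h. grad \<psi> x \<bullet> h)"
    using grad_inner[of \<psi> x] by (auto simp: differentiable_def fun_eq_iff)
  with d show ?thesis by simp
qed

lemma grad_eq_0_outside:
  fixes \<psi> :: "'a::euclidean_space \<Rightarrow> real"
  assumes "closed S" "\<And>y. y \<notin> S \<Longrightarrow> \<psi> y = 0" "x \<notin> S"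
  shows "grad \<psi> x = 0"
  using frechet_derivative_eq_0_outside[OF assms] by (simp add: grad_def)

lemma L2_on_bounded:
  fixes f :: "'a::euclidean_space \<Rightarrow> 'b::euclidean_space"
  assumes "f \<in> borel_measurable lebesgue" "AE x in lebesgue. norm (f x) \<le> K" "S \<in> lmeasurable"
  shows "L2_on S f"
  unfolding L2_on_def
proof
  show "f \<in> borel_measurable (lebesgue_on S)" by (rule measurable_restrict_space1[OF assms(1)])
  have "(\<lambda>x. (norm (f x))\<^sup>2) \<in> borel_measurable lebesgue" using assms(1) by measurable
  moreover have "AE x in lebesgue. norm ((norm (f x))\<^sup>2) \<le> K\<^sup>2"
    using assms(2) by eventually_elim (auto intro: power_mono)
  ultimately show "(\<lambda>x. (norm (f x))\<^sup>2) absolutely_integrable_on S"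
    using assms(3) by (rule bounded_absolutely_integrable)
qed

lemma energy_eq_weak_gradient:
  assumes "open \<Omega>" "is_weak_gradient UNIV u G"
  shows "energy W \<Omega> u = (\<integral>\<^sup>+x\<in>\<Omega>. ennreal (1 / 2 * (norm (G x))\<^sup>2 + W (u x)) \<partial>lebesgue)"
  unfolding energy_def
proof (rule nn_integral_cong_AE)
  have "AE x in lebesgue. x \<in> \<Omega> \<longrightarrow> weak_grad \<Omega> u x = G x"
    by (rule weak_grad_AE_eq(2)[OF assms(1) is_weak_gradient_subset[OF assms(2)]])
  then show "AE x in lebesgue. ennreal (1 / 2 * (norm (weak_grad \<Omega> u x))\<^sup>2 + W (u x)) * indicator \<Omega> x =
             ennreal (1 / 2 * (norm (G x))\<^sup>2 + W (u x)) * indicator \<Omega> x"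
    by eventually_elim (auto simp: indicator_def)
qed

text \<open>
  The map \<open>u + \<psi> *\<^sub>R (a - u)\<close> moves \<open>u\<close> to \<open>a\<close> where \<open>\<psi> = 1\<close>. The approximating test
  functions for the perturbation are \<open>\<psi> *\<^sub>R (a - us k)\<close>, with the same cut-off and \<open>us\<close> the mollifications of \<open>u\<close>.
\<close>

lemma cutoff_competitor:
  fixes u :: "real ^ 'n \<Rightarrow> real ^ 'm" and \<psi> :: "real ^ 'n \<Rightarrow> real"
  assumes wg: "is_weak_gradient UNIV u G"
    and meas: "u \<in> borel_measurable lebesgue" "G \<in> borel_measurable lebesgue"
    and bnd: "AE x in lebesgue. norm (u x) \<le> K" "AE x in lebesgue. norm (G x) \<le> M"
    and \<psi>: "smooth \<psi>" "compact S" "S \<subseteq> \<Omega>" "\<And>x. x \<notin> S \<Longrightarrow> \<psi> x = 0" "\<And>x. 0 \<le> \<psi> x" "\<And>x. \<psi> x \<le> 1"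
    and \<Omega>: "open \<Omega>" "bounded \<Omega>"
  shows "W12_zero_on \<Omega> (\<lambda>x. \<psi> x *\<^sub>R (a - u x))"
    and "is_weak_gradient UNIV (\<lambda>x. u x + \<psi> x *\<^sub>R (a - u x)) (\<lambda>x. (1 - \<psi> x) *\<^sub>R G x + outer (a - u x) (grad \<psi> x))"
proof -
  obtain us Ds where sa: "smooth_approx us Ds K M u G"
    by (rule smooth_approximation[OF wg bnd])
  note ap = smooth_approxD[OF sa]
  have K: "0 \<le> K" using ap(4) norm_ge_zero order_trans by blast
  have M: "0 \<le> M" using ap(5) norm_ge_zero order_trans by blast
  obtain r where r: "\<And>x. x \<notin> cball 0 r \<Longrightarrow> x \<notin> S" using compact_supportE[OF \<psi>(2)] by blast
  have gz: "grad \<psi> x = 0" if "x \<notin> S" for x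
    by (rule grad_eq_0_outside[OF compact_imp_closed[OF \<psi>(2)] \<psi>(4) that])
  obtain B where B: "0 < B" "\<And>x. norm (grad \<psi> x) \<le> B"
    using compact_support_bounded[OF smooth_grad_continuous[OF \<psi>(1)], of 0 r] gz r by metis
  have c\<psi>: "continuous_on UNIV \<psi>" by (rule smooth_continuous[OF \<psi>(1)])
  have cu: "continuous_on UNIV (us k)" for k by (rule smooth_continuous[OF ap(1)])
  have m\<psi>: "\<psi> \<in> borel_measurable lebesgue" "grad \<psi> \<in> borel_measurable lebesgue"
    using borel_measurable_continuous_onI[OF c\<psi>] borel_measurable_continuous_onI[OF smooth_grad_continuous[OF \<psi>(1)]]
    by (auto simp: measurable_completion)
  define v where "v x = \<psi> x *\<^sub>R (a - u x)" for x
  define Dv where "Dv x = outer (a - u x) (grad \<psi> x) - \<psi> x *\<^sub>R G x" for x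
  define vs where "vs k x = \<psi> x *\<^sub>R (a - us k x)" for k x
  define Dvs where "Dvs k x = outer (a - us k x) (grad \<psi> x) - \<psi> x *\<^sub>R Ds k x" for k x
  have sm: "smooth (vs k)" for k
  proof -
    have "Ck_on n UNIV (\<lambda>x. \<psi> x *\<^sub>R (a + (- 1) *\<^sub>R us k x))" for n
      using \<psi>(1) ap(1)[of k] unfolding smooth_def by (intro Ck_on_scaleR Ck_on_add Ck_on_const) auto
    then show ?thesis by (simp add: smooth_def vs_def[abs_def])
  qed
  have dvs: "(vs k has_derivative (\<lambda>h. Dvs k x *v h)) (at x)" for k x
  proof -
    have "((\<lambda>x. \<psi> x *\<^sub>R (a - us k x)) has_derivative
        (\<lambda>h. \<psi> x *\<^sub>R (0 - Ds k x *v h) + (grad \<psi> x \<bullet> h) *\<^sub>R (a - us k x))) (at x)"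
      by (intro has_derivative_scaleR has_derivative_diff has_derivative_const ap(2) smooth_has_derivative_grad \<psi>(1))
    moreover have "(\<lambda>h. \<psi> x *\<^sub>R (0 - Ds k x *v h) + (grad \<psi> x \<bullet> h) *\<^sub>R (a - us k x)) = (\<lambda>h. Dvs k x *v h)"
      by (rule ext) (simp add: Dvs_def matrix_vector_mult_diff_rdistrib outer_mult_vec scaleR_matrix_vector_assoc)
    ultimately show ?thesis unfolding vs_def[abs_def] by simp
  qed
  have cDvs: "continuous_on UNIV (Dvs k)" for k
    unfolding Dvs_def[abs_def] by (intro continuous_intros cu smooth_grad_continuous \<psi>(1) c\<psi> ap(3))
  have meask: "vs k \<in> borel_measurable lebesgue" "Dvs k \<in> borel_measurable lebesgue" for k
    using borel_measurable_continuous_onI[OF cDvs[of k]] smooth_borel[OF sm[of k]]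
    by (auto simp: measurable_completion)
  have bvs: "norm (vs k x) \<le> norm a + K" for k x
  proof -
    have "norm (vs k x) \<le> 1 * norm (a - us k x)"
      unfolding vs_def norm_scaleR using \<psi>(5,6) by (intro mult_right_mono) auto
    also have "\<dots> \<le> norm a + K" using norm_triangle_ineq4[of a "us k x"] ap(4)[of k x] by simp
    finally show ?thesis .
  qed
  have bDvs: "norm (Dvs k x) \<le> (norm a + K) * B + M" for k x
  proof -
    have "norm (Dvs k x) \<le> norm (outer (a - us k x) (grad \<psi> x)) + norm (\<psi> x *\<^sub>R Ds k x)"
      unfolding Dvs_def by (rule norm_triangle_ineq4)
    also have "\<dots> \<le> (norm a + K) * B + 1 * M"
      unfolding norm_outer norm_scaleR
      using norm_triangle_ineq4[of a "us k x"] ap(4,5)[of k x] B(2)[of x] \<psi>(5,6)[of x] K M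
      by (intro add_mono mult_mono) auto
    finally show ?thesis by simp
  qed
  have mv: "v \<in> borel_measurable lebesgue" "Dv \<in> borel_measurable lebesgue"
    unfolding v_def[abs_def] Dv_def[abs_def]
    by (intro borel_measurable_scaleR borel_measurable_diff borel_measurable_outer m\<psi> meas borel_measurable_const)+
  have lim: "AE x in lebesgue. (\<lambda>k. vs k x) \<longlonglongrightarrow> v x"
    using ap(6) unfolding v_def vs_def by eventually_elim (intro tendsto_intros)
  have limD: "AE x in lebesgue. (\<lambda>k. Dvs k x) \<longlonglongrightarrow> Dv x"
    using ap(6,7) unfolding Dv_def Dvs_def
    by eventually_elim (intro tendsto_intros bounded_bilinear.tendsto[OF bounded_bilinear_outer])
  have wgv: "is_weak_gradient UNIV v Dv"
    by (rule is_weak_gradient_limit[OF sm dvs cDvs bvs bDvs mv lim limD])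
  have bv: "AE x in lebesgue. norm (v x) \<le> norm a + K"
    using lim by eventually_elim (rule tendsto_upperbound[OF tendsto_norm], assumption, use bvs in auto)
  have bDv: "AE x in lebesgue. norm (Dv x) \<le> (norm a + K) * B + M"
    using limD by eventually_elim (rule tendsto_upperbound[OF tendsto_norm], assumption, use bDvs in auto)
  have \<Omega>m: "\<Omega> \<in> lmeasurable" by (rule bounded_set_imp_lmeasurable[OF \<Omega>(2)]) (use \<Omega> in auto)
  show "W12_zero_on \<Omega> (\<lambda>x. \<psi> x *\<^sub>R (a - u x))"
    unfolding W12_zero_on_def v_def[symmetric]
  proof (intro conjI exI[of _ vs] allI)
    show "W12_on \<Omega> v" unfolding W12_on_def
      using L2_on_bounded[OF mv(1) bv \<Omega>m] L2_on_bounded[OF mv(2) bDv \<Omega>m] is_weak_gradient_subset[OF wgv] by blast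
    show "test_function \<Omega> (vs k)" for k
    proof (rule test_functionI[OF _ \<psi>(2,3)])
      show "smooth (vs k)" by (rule sm)
      show "vs k x = 0" if "x \<notin> S" for x using \<psi>(4)[OF that] by (simp add: vs_def)
    qed
    have wd: "AE x in lebesgue. x \<in> \<Omega> \<longrightarrow> weak_grad \<Omega> (\<lambda>x. vs k x - v x) x = Dvs k x - Dv x" for k
    proof (rule weak_grad_AE_eq(2)[OF \<Omega>(1) is_weak_gradient_subset])
      show "is_weak_gradient UNIV (\<lambda>x. vs k x - v x) (\<lambda>x. Dvs k x - Dv x)"
      proof (rule is_weak_gradient_limit[where vs = "\<lambda>l x. vs k x - vs l x" and Ds = "\<lambda>l x. Dvs k x - Dvs l x"])
        show "smooth (\<lambda>x. vs k x - vs l x)" for l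
        proof -
          have "smooth (\<lambda>x. vs k x + (-1) *\<^sub>R vs l x)"
            using sm unfolding smooth_def by (intro allI Ck_on_add Ck_on_scaleR Ck_on_const) auto
          then show ?thesis by simp
        qed
        show "((\<lambda>x. vs k x - vs l x) has_derivative (\<lambda>h. (Dvs k x - Dvs l x) *v h)) (at x)" for l x
          using has_derivative_diff[OF dvs[of k x] dvs[of l x]] by (simp add: matrix_vector_mult_diff_rdistrib)
        show "continuous_on UNIV (\<lambda>x. Dvs k x - Dvs l x)" for l by (intro continuous_intros cDvs)
        show "norm (vs k x - vs l x) \<le> (norm a + K) + (norm a + K)" for l x
          using norm_triangle_ineq4[of "vs k x" "vs l x"] bvs[of k x] bvs[of l x] by linarith
        show "norm (Dvs k x - Dvs l x) \<le> ((norm a + K) * B + M) + ((norm a + K) * B + M)" for l x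
          using norm_triangle_ineq4[of "Dvs k x" "Dvs l x"] bDvs[of k x] bDvs[of l x] by linarith
        show "(\<lambda>x. vs k x - v x) \<in> borel_measurable lebesgue" "(\<lambda>x. Dvs k x - Dv x) \<in> borel_measurable lebesgue"
          using mv meask[of k] by (auto intro: borel_measurable_diff)
        show "AE x in lebesgue. (\<lambda>l. vs k x - vs l x) \<longlonglongrightarrow> vs k x - v x"
          using lim by eventually_elim (intro tendsto_intros)
        show "AE x in lebesgue. (\<lambda>l. Dvs k x - Dvs l x) \<longlonglongrightarrow> Dvs k x - Dv x"
          using limD by eventually_elim (intro tendsto_intros)
      qed
    qed
    have eq: "W12_norm \<Omega> (\<lambda>x. vs k x - v x) =
       sqrt (LINT x|lebesgue. indicator \<Omega> x *\<^sub>R ((norm (vs k x - v x))\<^sup>2 + (norm (Dvs k x - Dv x))\<^sup>2))" for k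
    proof -
      have "(\<lambda>x. indicator \<Omega> x *\<^sub>R ((norm (vs k x - v x))\<^sup>2 + (norm (Dvs k x - Dv x))\<^sup>2)) \<in> borel_measurable lebesgue"
        using meask[of k] mv \<Omega>m by (intro borel_measurable_scaleR borel_measurable_add borel_measurable_power borel_measurable_norm borel_measurable_diff borel_measurable_indicator) auto
      moreover have AE: "AE x in lebesgue. indicator \<Omega> x *\<^sub>R ((norm (vs k x - v x))\<^sup>2 + (norm (Dvs k x - Dv x))\<^sup>2)
         = indicator \<Omega> x *\<^sub>R ((norm (vs k x - v x))\<^sup>2 + (norm (weak_grad \<Omega> (\<lambda>x. vs k x - v x) x))\<^sup>2)"
        using wd[of k] by eventually_elim (auto simp: indicator_def)
      moreover have "(\<lambda>x. indicator \<Omega> x *\<^sub>R ((norm (vs k x - v x))\<^sup>2 + (norm (weak_grad \<Omega> (\<lambda>x. vs k x - v x) x))\<^sup>2)) \<in> borel_measurable lebesgue"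
        by (rule borel_measurable_AE[OF calculation])
      ultimately show ?thesis unfolding W12_norm_def set_lebesgue_integral_def
        by (intro arg_cong[where f = sqrt] integral_cong_AE) (auto elim!: AE_mp)
    qed
    let ?C = "(2 * (norm a + K))\<^sup>2 + (2 * ((norm a + K) * B + M))\<^sup>2"
    have "(\<lambda>k. LINT x|lebesgue. indicator \<Omega> x *\<^sub>R ((norm (vs k x - v x))\<^sup>2 + (norm (Dvs k x - Dv x))\<^sup>2))
       \<longlonglongrightarrow> integral\<^sup>L lebesgue (\<lambda>x :: real ^ 'n. 0 :: real)"
    proof (rule integral_dominated_convergence)
      fix k
      show "(\<lambda>x. indicator \<Omega> x *\<^sub>R ((norm (vs k x - v x))\<^sup>2 + (norm (Dvs k x - Dv x))\<^sup>2)) \<in> borel_measurable lebesgue"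
        using meask[of k] mv \<Omega>m by (intro borel_measurable_scaleR borel_measurable_add borel_measurable_power borel_measurable_norm borel_measurable_diff borel_measurable_indicator) auto
      show "AE x in lebesgue. norm (indicator \<Omega> x *\<^sub>R ((norm (vs k x - v x))\<^sup>2 + (norm (Dvs k x - Dv x))\<^sup>2)) \<le> ?C * indicator \<Omega> x"
        using bv bDv
      proof eventually_elim
        case (elim x)
        have "norm (vs k x - v x) \<le> 2 * (norm a + K)"
          using norm_triangle_le_diff[OF add_mono[OF bvs[of k x] elim(1)]] by (simp only: mult_2)
        moreover have "norm (Dvs k x - Dv x) \<le> 2 * ((norm a + K) * B + M)"
          using norm_triangle_le_diff[OF add_mono[OF bDvs[of k x] elim(2)]] by (simp only: mult_2)
        ultimately have "(norm (vs k x - v x))\<^sup>2 + (norm (Dvs k x - Dv x))\<^sup>2 \<le> ?C"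
          by (intro add_mono power_mono) auto
        then show ?case by (auto simp: indicator_def)
      qed
    next
      show "integrable lebesgue (\<lambda>x. ?C * indicator \<Omega> x)"
        using \<Omega>m by (intro integrable_mult_right integrable_real_indicator) (auto simp: fmeasurable_def)
      show "AE x in lebesgue. (\<lambda>k. indicator \<Omega> x *\<^sub>R ((norm (vs k x - v x))\<^sup>2 + (norm (Dvs k x - Dv x))\<^sup>2)) \<longlonglongrightarrow> 0"
        using lim limD
      proof eventually_elim
        case (elim x)
        have "(\<lambda>k. indicator \<Omega> x *\<^sub>R ((norm (vs k x - v x))\<^sup>2 + (norm (Dvs k x - Dv x))\<^sup>2)) \<longlonglongrightarrow>
           indicator \<Omega> x *\<^sub>R ((norm (v x - v x))\<^sup>2 + (norm (Dv x - Dv x))\<^sup>2)"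
          by (intro tendsto_intros elim)
        then show ?case by simp
      qed
    qed simp
    then have "(\<lambda>k. sqrt (LINT x|lebesgue. indicator \<Omega> x *\<^sub>R ((norm (vs k x - v x))\<^sup>2 + (norm (Dvs k x - Dv x))\<^sup>2)))
       \<longlonglongrightarrow> sqrt (integral\<^sup>L lebesgue (\<lambda>x :: real ^ 'n. 0 :: real))"
      by (rule tendsto_real_sqrt)
    then show "(\<lambda>k. W12_norm \<Omega> (\<lambda>x. vs k x - v x)) \<longlonglongrightarrow> 0"
      unfolding eq by simp
  qed
  have "is_weak_gradient UNIV (\<lambda>x. u x + v x) (\<lambda>x. G x + Dv x)"
  proof (rule is_weak_gradient_limit[where vs = "\<lambda>l x. us l x + vs l x" and Ds = "\<lambda>l x. Ds l x + Dvs l x"])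
    show "smooth (\<lambda>x. us l x + vs l x)" for l
      using sm[of l] ap(1)[of l] unfolding smooth_def by (intro allI Ck_on_add) auto
    show "((\<lambda>x. us l x + vs l x) has_derivative (\<lambda>h. (Ds l x + Dvs l x) *v h)) (at x)" for l x
      using has_derivative_add[OF ap(2)[of l x] dvs[of l x]] by (simp add: matrix_vector_mult_add_rdistrib)
    show "continuous_on UNIV (\<lambda>x. Ds l x + Dvs l x)" for l by (intro continuous_intros cDvs ap(3))
    show "norm (us l x + vs l x) \<le> K + (norm a + K)" for l x
      using norm_triangle_ineq[of "us l x" "vs l x"] bvs[of l x] ap(4)[of l x] by linarith
    show "norm (Ds l x + Dvs l x) \<le> M + ((norm a + K) * B + M)" for l x
      using norm_triangle_ineq[of "Ds l x" "Dvs l x"] bDvs[of l x] ap(5)[of l x] by linarith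
    show "(\<lambda>x. u x + v x) \<in> borel_measurable lebesgue" "(\<lambda>x. G x + Dv x) \<in> borel_measurable lebesgue"
      using mv meas by (auto intro: borel_measurable_add)
    show "AE x in lebesgue. (\<lambda>l. us l x + vs l x) \<longlonglongrightarrow> u x + v x"
      using lim ap(6) by eventually_elim (intro tendsto_intros)
    show "AE x in lebesgue. (\<lambda>l. Ds l x + Dvs l x) \<longlonglongrightarrow> G x + Dv x"
      using limD ap(7) by eventually_elim (intro tendsto_intros)
  qed
  then show "is_weak_gradient UNIV (\<lambda>x. u x + \<psi> x *\<^sub>R (a - u x)) (\<lambda>x. (1 - \<psi> x) *\<^sub>R G x + outer (a - u x) (grad \<psi> x))"
    by (simp add: v_def Dv_def algebra_simps)
qed

section \<open>The potential near and away from its zeros\<close>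

lemma locally_holder_continuous:
  assumes "locally_holder \<gamma> f" "0 < \<gamma>"
  shows "continuous_on UNIV f"
proof (rule continuous_at_imp_continuous_on, rule ballI)
  fix x
  obtain r L where r: "0 < r" and L: "\<And>y z. y \<in> ball x r \<Longrightarrow> z \<in> ball x r \<Longrightarrow> norm (f y - f z) \<le> L * norm (y - z) powr \<gamma>"
    using assms(1) unfolding locally_holder_def by metis
  have "((\<lambda>y. f y - f x) \<longlongrightarrow> 0) (at x)"
  proof (rule Lim_null_comparison)
    show "\<forall>\<^sub>F y in at x. norm (f y - f x) \<le> L * norm (y - x) powr \<gamma>"
      unfolding eventually_at by (rule exI[of _ r]) (use r in \<open>auto intro!: L simp: dist_commute\<close>)
    have "((\<lambda>y. norm (y - x)) \<longlongrightarrow> 0) (at x)"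
      by (auto intro!: tendsto_eq_intros)
    then have "((\<lambda>y. norm (y - x) powr \<gamma>) \<longlongrightarrow> 0 powr \<gamma>) (at x)"
      using assms(2) by (intro tendsto_powr2) (auto intro: tendsto_intros)
    then show "((\<lambda>y. L * norm (y - x) powr \<gamma>) \<longlongrightarrow> 0) (at x)"
      using tendsto_mult_right_zero by (simp add: tendsto_mult_right_zero)
  qed
  then show "continuous (at x) f"
    by (simp add: continuous_at LIM_zero_iff)
qed

lemma holder_class_continuous:
  assumes "holder_class \<alpha> f" "0 < \<alpha>"
  shows "continuous_on UNIV f"
proof -
  consider "\<alpha> \<le> 1" | "1 < \<alpha>" "\<alpha> < 2" | "2 \<le> \<alpha>" by linarith
  then show ?thesis
  proof cases
    case 1 then show ?thesis using assms locally_holder_continuous by (auto simp: holder_class_def)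
  next
    case 2 then have "Ck_on 1 UNIV f" using assms by (auto simp: holder_class_def)
    then show ?thesis by (rule Ck_on_continuous)
  next
    case 3 then have "Ck_on 2 UNIV f" using assms by (auto simp: holder_class_def)
    then show ?thesis by (rule Ck_on_continuous)
  qed
qed

text \<open>
  Along a ray from \<open>a\<close>, the function \<open>W - (c / \<alpha>) * t powr \<alpha>\<close> is continuous, vanishes at 0 and has a
  nonnegative derivative.
\<close>

lemma radial_lower_bound:
  fixes W :: "'a::euclidean_space \<Rightarrow> real"
  assumes cont: "continuous_on UNIV W" and W0: "W a = 0" and \<alpha>: "0 < \<alpha>" and c: "0 < c"
    and diff: "\<And>x. x \<noteq> a \<Longrightarrow> norm (x - a) \<le> r \<Longrightarrow> W differentiable (at x)"
    and low: "\<And>\<rho> \<nu>. 0 < \<rho> \<Longrightarrow> \<rho> \<le> r \<Longrightarrow> norm \<nu> = 1 \<Longrightarrow> c * \<rho> powr (\<alpha> - 1) \<le> grad W (a + \<rho> *\<^sub>R \<nu>) \<bullet> \<nu>"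
    and v: "norm (v - a) \<le> r"
  shows "(c / \<alpha>) * norm (v - a) powr \<alpha> \<le> W v"
proof (cases "v = a")
  case True
  then show ?thesis using W0 by simp
next
  case False
  define R where "R = norm (v - a)"
  define \<nu> where "\<nu> = (v - a) /\<^sub>R R"
  have R: "0 < R" "R \<le> r" using False v by (auto simp: R_def)
  have \<nu>: "norm \<nu> = 1" using R by (simp add: \<nu>_def R_def)
  then have \<nu>0: "\<nu> \<noteq> 0" by auto
  define g where "g t = W (a + t *\<^sub>R \<nu>) - (c / \<alpha>) * t powr \<alpha>" for t
  have "g 0 \<le> g R"
  proof (rule DERIV_nonneg_imp_increasing_open[of 0 R g])
    show "0 \<le> R" using R by simp
    show "continuous_on {0..R} g"
      unfolding g_def using \<alpha>
      by (intro continuous_intros continuous_on_compose2[OF cont] continuous_on_powr') auto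
    fix t assume t: "0 < t" "t < R"
    have nt: "norm (a + t *\<^sub>R \<nu> - a) = t" using t \<nu> by simp
    have d: "(W has_derivative frechet_derivative W (at (a + t *\<^sub>R \<nu>))) (at (a + t *\<^sub>R \<nu>))"
      using diff[of "a + t *\<^sub>R \<nu>"] nt t R \<nu>0 by (auto simp: frechet_derivative_works)
    have "((\<lambda>t. a + t *\<^sub>R \<nu>) has_derivative (\<lambda>h. h *\<^sub>R \<nu>)) (at t)"
      by (auto intro!: derivative_eq_intros)
    from has_derivative_compose[OF this d]
    have "((\<lambda>t. W (a + t *\<^sub>R \<nu>)) has_derivative (\<lambda>h. frechet_derivative W (at (a + t *\<^sub>R \<nu>)) (h *\<^sub>R \<nu>))) (at t)" .
    also have "(\<lambda>h. frechet_derivative W (at (a + t *\<^sub>R \<nu>)) (h *\<^sub>R \<nu>)) = (\<lambda>h. (grad W (a + t *\<^sub>R \<nu>) \<bullet> \<nu>) * h)"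
    proof -
      have "W differentiable (at (a + t *\<^sub>R \<nu>))" using d by (auto simp: differentiable_def)
      then show ?thesis by (simp add: grad_inner fun_eq_iff mult.commute)
    qed
    finally have "((\<lambda>t. W (a + t *\<^sub>R \<nu>)) has_real_derivative grad W (a + t *\<^sub>R \<nu>) \<bullet> \<nu>) (at t)"
      by (simp add: has_field_derivative_def)
    moreover have "((\<lambda>t. (c / \<alpha>) * t powr \<alpha>) has_real_derivative c * t powr (\<alpha> - 1)) (at t)"
      using t \<alpha> by (auto intro!: derivative_eq_intros)
    ultimately have "(g has_real_derivative grad W (a + t *\<^sub>R \<nu>) \<bullet> \<nu> - c * t powr (\<alpha> - 1)) (at t)"
      unfolding g_def by (rule DERIV_diff)
    moreover have "0 \<le> grad W (a + t *\<^sub>R \<nu>) \<bullet> \<nu> - c * t powr (\<alpha> - 1)"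
      using low[of t \<nu>] t R \<nu> by simp
    ultimately show "\<exists>y. (g has_real_derivative y) (at t) \<and> 0 \<le> y" by blast
  qed
  then show ?thesis using W0 R by (simp add: g_def \<nu>_def R_def)
qed

lemma gradient_upper_bound:
  fixes W :: "'a::euclidean_space \<Rightarrow> real"
  assumes W0: "W a = 0" and diff: "\<And>x. norm (x - a) \<le> r \<Longrightarrow> W differentiable (at x)" and L: "0 \<le> L" and \<alpha>: "1 < \<alpha>"
    and up: "\<And>x. norm (x - a) \<le> r \<Longrightarrow> norm (grad W x) \<le> L * norm (x - a) powr (\<alpha> - 1)"
    and v: "norm (v - a) \<le> r"
  shows "W v \<le> L * norm (v - a) powr \<alpha>"
proof -
  have "norm (W v - W a) \<le> (L * norm (v - a) powr (\<alpha> - 1)) * norm (v - a)"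
  proof (rule differentiable_bound[of "cball a (norm (v - a))" W "\<lambda>x. frechet_derivative W (at x)"])
    fix x assume "x \<in> cball a (norm (v - a))"
    then have x: "norm (x - a) \<le> norm (v - a)" "norm (x - a) \<le> r" using v by (auto simp: dist_norm norm_minus_commute)
    show "(W has_derivative frechet_derivative W (at x)) (at x within cball a (norm (v - a)))"
      using diff[OF x(2)] by (auto simp: frechet_derivative_works intro: has_derivative_at_withinI)
    show "onorm (frechet_derivative W (at x)) \<le> L * norm (v - a) powr (\<alpha> - 1)"
    proof (rule onorm_le)
      fix h
      have "norm (frechet_derivative W (at x) h) \<le> norm (grad W x) * norm h"
        unfolding grad_inner[OF diff[OF x(2)]] by (simp add: Cauchy_Schwarz_ineq2)
      also have "\<dots> \<le> (L * norm (v - a) powr (\<alpha> - 1)) * norm h"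
        using up[OF x(2)] x(1) L \<alpha>
        by (intro mult_right_mono order_trans[OF up[OF x(2)]] mult_left_mono powr_mono2) auto
      finally show "norm (frechet_derivative W (at x) h) \<le> L * norm (v - a) powr (\<alpha> - 1) * norm h" .
    qed
  qed (auto simp: dist_norm norm_minus_commute)
  moreover have "norm (v - a) powr (\<alpha> - 1) * norm (v - a) = norm (v - a) powr \<alpha>"
    by (cases "v = a") (use \<alpha> in \<open>auto simp: powr_diff\<close>)
  ultimately show ?thesis using W0 by (simp add: mult.assoc)
qed

lemma grad_zero_at_minimum:
  fixes W :: "'a::euclidean_space \<Rightarrow> real"
  assumes "W differentiable (at a)" "\<And>v. W a \<le> W v"
  shows "grad W a = 0"
proof -
  have "frechet_derivative W (at a) = (\<lambda>h. 0)"
    by (rule differential_zero_maxmin[of a UNIV W]) (use assms in \<open>auto simp: frechet_derivative_works\<close>)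
  then show ?thesis by (simp add: grad_def)
qed

text \<open>
  All cases of the hypothesis give the same two-sided growth at a zero. The lower bound is integrated
  from the radial derivative. The upper bound is the Hoelder condition itself for \<open>\<alpha> \<le> 1\<close>; for
  \<open>\<alpha> > 1\<close> it follows from the mean value theorem, since the gradient vanishes at the minimum \<open>a\<close>.
\<close>

lemma HA_growth:
  fixes W :: "real ^ 'm \<Rightarrow> real"
  assumes HA: "HA W A a" and A: "finite A"
  obtains \<alpha> c C r where "0 < \<alpha>" "\<alpha> \<le> 2" "0 < c" "0 < C" "0 < r"
    "\<And>v. norm (v - a) \<le> r \<Longrightarrow> c * norm (v - a) powr \<alpha> \<le> W v \<and> W v \<le> C * norm (v - a) powr \<alpha>"
proof -
  obtain \<alpha> where \<alpha>: "0 < \<alpha>" "\<alpha> \<le> 2" and hc: "holder_class \<alpha> W" and C1: "Ck_on 1 (UNIV - A) W"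
    and lt2: "\<alpha> < 2 \<Longrightarrow> \<exists>Cs>0. \<exists>\<rho>\<^sub>0>0. \<forall>\<rho> \<nu>. 0 < \<rho> \<and> \<rho> \<le> \<rho>\<^sub>0 \<and> norm \<nu> = 1 \<longrightarrow>
            grad W (a + \<rho> *\<^sub>R \<nu>) \<bullet> \<nu> \<ge> Cs * \<rho> powr (\<alpha> - 1)"
    and eq2: "\<alpha> = 2 \<Longrightarrow> \<exists>C\<^sub>0>0. \<forall>\<nu>. norm \<nu> = 1 \<longrightarrow> (hessian W a *v \<nu>) \<bullet> \<nu> \<ge> C\<^sub>0"
    using HA unfolding HA_def by auto
  have W0: "W a = 0" and Wn: "\<And>v. 0 \<le> W v" using HA by (auto simp: HA_def)
  have cont: "continuous_on UNIV W" by (rule holder_class_continuous[OF hc \<alpha>(1)])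
  have diffA: "W differentiable (at x)" if "x \<notin> A" for x using C1 that by simp
  \<comment> \<open>isolate a from the other zeros\<close>
  obtain r0 where r0: "0 < r0" "\<And>x. x \<in> A \<Longrightarrow> x \<noteq> a \<Longrightarrow> r0 < norm (x - a)"
  proof -
    have "finite (insert 1 ((\<lambda>x. norm (x - a)) ` (A - {a})))" using A by simp
    define m where "m = Min (insert 1 ((\<lambda>x. norm (x - a)) ` (A - {a})))"
    have "0 < m" unfolding m_def using A by (subst Min_gr_iff) auto
    moreover have "m \<le> norm (x - a)" if "x \<in> A" "x \<noteq> a" for x
      unfolding m_def using A that by (intro Min_le) auto
    ultimately show ?thesis by (intro that[of "m / 2"]) force+
  qed
  have diff: "W differentiable (at x)" if "x \<noteq> a" "norm (x - a) \<le> r0" for x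
    using diffA[of x] r0(2)[of x] that by fastforce
  \<comment> \<open>for \<alpha> = 2 the Hessian condition gives the same bounds on the gradient as the one assumed for \<alpha> < 2\<close>
  have hess: "\<exists>c L r. 0 < c \<and> 0 < L \<and> 0 < r \<and> (\<forall>\<rho> \<nu>. 0 < \<rho> \<and> \<rho> \<le> r \<and> norm \<nu> = 1 \<longrightarrow>
            c * \<rho> powr (\<alpha> - 1) \<le> grad W (a + \<rho> *\<^sub>R \<nu>) \<bullet> \<nu>) \<and> (\<forall>x. norm (x - a) \<le> r \<longrightarrow> norm (grad W x) \<le> L * norm (x - a) powr (\<alpha> - 1))"
    if \<alpha>2: "\<alpha> = 2"
  proof -
    obtain C0 where C0: "0 < C0" "\<And>\<nu>. norm \<nu> = 1 \<Longrightarrow> C0 \<le> (hessian W a *v \<nu>) \<bullet> \<nu>" using eq2[OF \<alpha>2] by blast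
    have C2: "Ck_on 2 UNIV W" using hc that by (simp add: holder_class_def)
    then have C2': "Ck_on (Suc 1) UNIV W" by (simp add: numeral_2_eq_2)
    have dW: "W differentiable (at x)" for x using C2' by simp
    have g0: "grad W a = 0" by (rule grad_zero_at_minimum[OF dW]) (simp add: W0 Wn)
    have "grad W differentiable (at a)"
      unfolding grad_def using C2' by (intro differentiable_sum finite_Basis ballI differentiable_scaleR) auto
    then have D: "(grad W has_derivative frechet_derivative (grad W) (at a)) (at a)" by (simp add: frechet_derivative_works)
    then have lin: "linear (frechet_derivative (grad W) (at a))" by (rule has_derivative_linear)
    have hv: "hessian W a *v \<nu> = frechet_derivative (grad W) (at a) \<nu>" for \<nu>
      unfolding hessian_def using lin by (simp add: matrix_works)
    define T where "T = frechet_derivative (grad W) (at a)"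
    obtain B where B: "0 < B" "\<And>h. norm (T h) \<le> B * norm h"
      using bounded_linear.pos_bounded[OF has_derivative_bounded_linear[OF D]] by (auto simp: T_def mult.commute)
    obtain d where d: "0 < d" "\<And>y. norm (y - a) < d \<Longrightarrow> norm (grad W y - T (y - a)) \<le> C0 / 2 * norm (y - a)"
      using D C0(1) g0 unfolding has_derivative_at_alt T_def[symmetric] by (metis diff_zero half_gt_zero)
    show ?thesis
    proof (rule exI[of _ "C0/2"], rule exI[of _ "B + C0/2"], rule exI[of _ "d/2"], intro conjI allI impI)
      fix \<rho> :: real and \<nu> :: "real ^ 'm" assume *: "0 < \<rho> \<and> \<rho> \<le> d / 2 \<and> norm \<nu> = 1"
      have "norm (grad W (a + \<rho> *\<^sub>R \<nu>) - T (\<rho> *\<^sub>R \<nu>)) \<le> C0 / 2 * \<rho>"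
        using d(2)[of "a + \<rho> *\<^sub>R \<nu>"] * d(1) by simp
      then have "\<bar>(grad W (a + \<rho> *\<^sub>R \<nu>) - T (\<rho> *\<^sub>R \<nu>)) \<bullet> \<nu>\<bar> \<le> C0 / 2 * \<rho>"
        using Cauchy_Schwarz_ineq2[of "grad W (a + \<rho> *\<^sub>R \<nu>) - T (\<rho> *\<^sub>R \<nu>)" \<nu>] * by simp
      moreover have "T (\<rho> *\<^sub>R \<nu>) \<bullet> \<nu> = \<rho> * ((hessian W a *v \<nu>) \<bullet> \<nu>)"
        using linear_scale[OF lin] by (simp add: T_def hv)
      moreover have "\<rho> * C0 \<le> \<rho> * ((hessian W a *v \<nu>) \<bullet> \<nu>)" using * C0(2)[of \<nu>] by (intro mult_left_mono) auto
      ultimately have "C0 / 2 * \<rho> \<le> grad W (a + \<rho> *\<^sub>R \<nu>) \<bullet> \<nu>" unfolding inner_diff_left mult.commute[of \<rho> C0] by linarith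
      then show "C0 / 2 * \<rho> powr (\<alpha> - 1) \<le> grad W (a + \<rho> *\<^sub>R \<nu>) \<bullet> \<nu>" using that * by simp
    next
      fix x assume x: "norm (x - a) \<le> d / 2"
      have "norm (grad W x) \<le> norm (grad W x - T (x - a)) + norm (T (x - a))"
        using norm_triangle_ineq[of "grad W x - T (x - a)" "T (x - a)"] by simp
      also have "\<dots> \<le> C0 / 2 * norm (x - a) + B * norm (x - a)"
        using d x B by (intro add_mono) auto
      finally show "norm (grad W x) \<le> (B + C0 / 2) * norm (x - a) powr (\<alpha> - 1)"
        using that by (simp add: algebra_simps)
    qed (use C0 B d in auto)
  qed
  obtain c r1 where c: "0 < c" "0 < r1" and low: "\<And>\<rho> \<nu>. 0 < \<rho> \<Longrightarrow> \<rho> \<le> r1 \<Longrightarrow> norm \<nu> = 1 \<Longrightarrow>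
        c * \<rho> powr (\<alpha> - 1) \<le> grad W (a + \<rho> *\<^sub>R \<nu>) \<bullet> \<nu>"
  proof (cases "\<alpha> = 2")
    case True
    then show ?thesis using hess that by blast
  next
    case False
    then have "\<alpha> < 2" using \<alpha> by simp
    then show ?thesis using lt2 that by blast
  qed
  have lower: "(c / \<alpha>) * norm (v - a) powr \<alpha> \<le> W v" if "norm (v - a) \<le> min r0 r1" for v
    by (rule radial_lower_bound[OF cont W0 \<alpha>(1) c(1), of "min r0 r1"]) (use diff low that in auto)
  have "\<exists>L>0. \<exists>r>0. \<forall>v. norm (v - a) \<le> r \<longrightarrow> W v \<le> L * norm (v - a) powr \<alpha>"
  proof -
    consider "\<alpha> \<le> 1" | "1 < \<alpha>" "\<alpha> < 2" | "\<alpha> = 2" using \<alpha> by linarith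
    then show ?thesis
    proof cases
      case 1
      then have "locally_holder \<alpha> W" using hc by (simp add: holder_class_def)
      then obtain r L where r: "0 < r" and L: "\<And>y z. y \<in> ball a r \<Longrightarrow> z \<in> ball a r \<Longrightarrow> norm (W y - W z) \<le> L * norm (y - z) powr \<alpha>"
        unfolding locally_holder_def by metis
      show ?thesis
      proof (rule exI[of _ "\<bar>L\<bar> + 1"], intro conjI, simp, rule exI[of _ "r/2"], intro conjI allI impI)
        fix v assume v: "norm (v - a) \<le> r / 2"
        then have "v \<in> ball a r" using r by (simp add: dist_norm norm_minus_commute)
        then have "W v \<le> L * norm (v - a) powr \<alpha>" using L[of v a] r W0 Wn[of v] by simp
        also have "\<dots> \<le> (\<bar>L\<bar> + 1) * norm (v - a) powr \<alpha>" by (intro mult_right_mono) auto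
        finally show "W v \<le> (\<bar>L\<bar> + 1) * norm (v - a) powr \<alpha>" .
      qed (use r in auto)
    next
      case 2
      then have hW: "Ck_on 1 UNIV W" "locally_holder (\<alpha> - 1) (grad W)" using hc by (auto simp: holder_class_def)
      have dW: "W differentiable (at x)" for x using hW(1) by simp
      have g0: "grad W a = 0" by (rule grad_zero_at_minimum[OF dW]) (simp add: W0 Wn)
      obtain r L where r: "0 < r" and L: "\<And>y z. y \<in> ball a r \<Longrightarrow> z \<in> ball a r \<Longrightarrow> norm (grad W y - grad W z) \<le> L * norm (y - z) powr (\<alpha> - 1)"
        using hW(2) unfolding locally_holder_def by metis
      have up: "norm (grad W x) \<le> (\<bar>L\<bar> + 1) * norm (x - a) powr (\<alpha> - 1)" if "norm (x - a) \<le> r / 2" for x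
      proof -
        have "x \<in> ball a r" using r that by (simp add: dist_norm norm_minus_commute)
        then have "norm (grad W x) \<le> L * norm (x - a) powr (\<alpha> - 1)" using L[of x a] r g0 by simp
        also have "\<dots> \<le> (\<bar>L\<bar> + 1) * norm (x - a) powr (\<alpha> - 1)" by (intro mult_right_mono) auto
        finally show ?thesis .
      qed
      show ?thesis
        by (rule exI[of _ "\<bar>L\<bar> + 1"], intro conjI, simp, rule exI[of _ "r/2"],
            intro conjI allI impI gradient_upper_bound[OF W0 dW _ 2(1) up]) (use r in auto)
    next
      case 3
      then obtain L r where L: "0 < L" "0 < r" and up: "\<And>x. norm (x - a) \<le> r \<Longrightarrow> norm (grad W x) \<le> L * norm (x - a) powr (\<alpha> - 1)"
        using hess by blast
      have "Ck_on 2 UNIV W" using hc 3 by (simp add: holder_class_def)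
      then have dW: "W differentiable (at x)" for x by (simp add: numeral_2_eq_2)
      show ?thesis
        by (rule exI[of _ L], intro conjI L(1), rule exI[of _ r], intro conjI L(2) allI impI gradient_upper_bound[OF W0 dW _ _ up])
           (use L 3 in auto)
    qed
  qed
  then obtain L r2 where L: "0 < L" "0 < r2" and upper: "\<And>v. norm (v - a) \<le> r2 \<Longrightarrow> W v \<le> L * norm (v - a) powr \<alpha>"
    by blast
  show ?thesis
    by (rule that[of \<alpha> "c / \<alpha>" L "min r2 (min r0 r1)"]) (use \<alpha> c L r0(1) lower upper in auto)
qed

text \<open>
  What the comparison argument needs near a zero: the two contributions to the cost of interpolating
  between \<open>v\<close> and \<open>a\<close>, namely \<open>(norm (v - a))\<^sup>2\<close> from the gradient of the cut-off and \<open>W\<close> along the segment, are bounded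
  by \<open>W v\<close>.
\<close>

definition radial_well :: "('a::real_normed_vector \<Rightarrow> real) \<Rightarrow> 'a \<Rightarrow> real \<Rightarrow> real \<Rightarrow> bool" where
  "radial_well W a r K \<longleftrightarrow> (\<forall>v. norm (v - a) \<le> r \<longrightarrow>
     (norm (v - a))\<^sup>2 \<le> K * W v \<and> (\<forall>t. 0 \<le> t \<and> t \<le> 1 \<longrightarrow> W (a + t *\<^sub>R (v - a)) \<le> K * W v))"

text \<open>
  Here \<open>\<alpha> \<le> 2\<close> is used: \<open>s\<^sup>2 \<le> s powr \<alpha>\<close> for \<open>0 \<le> s \<le> 1\<close>.
\<close>

lemma HA_radial_well:
  fixes W :: "real ^ 'm \<Rightarrow> real"
  assumes HA: "HA W A a" and A: "finite A"
  obtains r K where "0 < r" "0 < K" "radial_well W a r K"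
proof -
  obtain \<alpha> c C r where g: "0 < \<alpha>" "\<alpha> \<le> 2" "0 < c" "0 < C" "0 < r"
    "\<And>v. norm (v - a) \<le> r \<Longrightarrow> c * norm (v - a) powr \<alpha> \<le> W v \<and> W v \<le> C * norm (v - a) powr \<alpha>"
    using HA_growth[OF assms] by metis
  have Wn: "0 \<le> W v" for v using HA by (simp add: HA_def)
  define K where "K = max (1 / c) (C / c)"
  have "radial_well W a (min r 1) K"
    unfolding radial_well_def
  proof (intro allI impI conjI)
    fix v assume v: "norm (v - a) \<le> min r 1"
    then have low: "norm (v - a) powr \<alpha> \<le> W v / c" using g by (simp add: le_divide_eq mult.commute)
    have "(norm (v - a))\<^sup>2 \<le> norm (v - a) powr \<alpha>"
    proof (cases "v = a")
      case False
      then have "(norm (v - a))\<^sup>2 = norm (v - a) powr 2" by simp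
      also have "\<dots> \<le> norm (v - a) powr \<alpha>" using v g(2) by (intro powr_mono') auto
      finally show ?thesis .
    qed simp
    also have "\<dots> \<le> (1 / c) * W v" using low by simp
    also have "\<dots> \<le> K * W v" unfolding K_def by (intro mult_right_mono Wn) auto
    finally show "(norm (v - a))\<^sup>2 \<le> K * W v" .
    fix t :: real assume t: "0 \<le> t \<and> t \<le> 1"
    have n: "norm (a + t *\<^sub>R (v - a) - a) \<le> norm (v - a)"
      using t by (simp add: mult_left_le_one_le)
    have "W (a + t *\<^sub>R (v - a)) \<le> C * norm (a + t *\<^sub>R (v - a) - a) powr \<alpha>" using g(6)[of "a + t *\<^sub>R (v - a)"] n v by auto
    also have "\<dots> \<le> C * norm (v - a) powr \<alpha>" using g n by (intro mult_left_mono powr_mono2) auto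
    also have "\<dots> \<le> (C / c) * W v" using mult_left_mono[OF low, of C] g by simp
    also have "\<dots> \<le> K * W v" unfolding K_def by (intro mult_right_mono Wn) auto
    finally show "W (a + t *\<^sub>R (v - a)) \<le> K * W v" .
  qed
  moreover have "0 < K" using g by (simp add: K_def less_max_iff_disj)
  ultimately show ?thesis using that[of "min r 1" K] g by auto
qed

lemma radial_well_mono:
  assumes "radial_well W a r K" "r' \<le> r" "K \<le> K'" "\<And>v. 0 \<le> W v"
  shows "radial_well W a r' K'"
  using assms unfolding radial_well_def by (meson mult_right_mono order_trans)

text \<open>
  The factor 4 in the separation leaves a margin: a point at distance between \<open>\<delta>\<close> and
  \<open>2 * \<delta>\<close> from one zero has distance at least \<open>2 * \<delta>\<close> from all the others, so that the lower
  bound \<open>c0\<close> applies there.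
\<close>

lemma potential_constants:
  fixes W :: "real ^ 'm \<Rightarrow> real"
  assumes A: "finite A" "A \<noteq> {}" and HA0: "\<forall>a\<in>A. HA W A a" and pos0: "\<forall>v. v \<notin> A \<longrightarrow> 0 < W v"
  shows "\<exists>\<delta> K1 c0 W1. 0 < \<delta> \<and> 0 < K1 \<and> 0 < c0 \<and> 0 < W1 \<and> (\<forall>a\<in>A. radial_well W a (2 * \<delta>) K1) \<and>
     (\<forall>a\<in>A. \<forall>b\<in>A. a \<noteq> b \<longrightarrow> 4 * \<delta> \<le> norm (a - b)) \<and>
     (\<forall>v. norm v \<le> K \<and> (\<forall>a\<in>A. \<delta> \<le> norm (v - a)) \<longrightarrow> c0 \<le> W v) \<and>
     (\<forall>v. norm v \<le> K \<longrightarrow> W v \<le> W1)"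
proof -
  note HA = HA0[rule_format] and pos = pos0[rule_format]
  have "\<exists>r k. 0 < r \<and> 0 < k \<and> radial_well W a r k" if "a \<in> A" for a
    using HA_radial_well[OF HA[OF that] A(1)] by metis
  then obtain r k where rk: "\<And>a. a \<in> A \<Longrightarrow> 0 < r a" "\<And>a. a \<in> A \<Longrightarrow> 0 < k a" "\<And>a. a \<in> A \<Longrightarrow> radial_well W a (r a) (k a)"
    by metis
  obtain a0 where a0: "a0 \<in> A" using A(2) by blast
  have Wn: "0 \<le> W v" for v using HA[OF a0] by (simp add: HA_def)
  obtain \<alpha> where "0 < \<alpha>" "holder_class \<alpha> W" using HA[OF a0] unfolding HA_def by blast
  then have cont: "continuous_on UNIV W" using holder_class_continuous by blast
  define D where "D = (\<lambda>(a, b). norm (a - b)) ` {(a, b). a \<in> A \<and> b \<in> A \<and> a \<noteq> b}"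
  have "finite {(a, b). a \<in> A \<and> b \<in> A \<and> a \<noteq> b}" by (rule finite_subset[of _ "A \<times> A"]) (use A in auto)
  then have fD: "finite D" by (simp add: D_def)
  have pD: "0 < x" if "x \<in> D" for x using that by (auto simp: D_def)
  define \<delta> where "\<delta> = Min (insert 1 (r ` A \<union> D)) / 4"
  define K1 where "K1 = Max (k ` A)"
  have \<delta>: "0 < \<delta>" unfolding \<delta>_def using A fD pD rk(1) by (auto simp: Min_gr_iff)
  have \<delta>r: "2 * \<delta> \<le> r a" if "a \<in> A" for a
  proof -
    have "Min (insert 1 (r ` A \<union> D)) \<le> r a" using A fD that by (intro Min_le) auto
    then show ?thesis using \<delta> unfolding \<delta>_def by linarith
  qed
  have \<delta>D: "4 * \<delta> \<le> norm (a - b)" if "a \<in> A" "b \<in> A" "a \<noteq> b" for a b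
  proof -
    have "norm (a - b) \<in> D" using that by (auto simp: D_def)
    then have "Min (insert 1 (r ` A \<union> D)) \<le> norm (a - b)" using A fD by (intro Min_le) auto
    then show ?thesis unfolding \<delta>_def by linarith
  qed
  have K1: "k a \<le> K1" if "a \<in> A" for a unfolding K1_def using A that by (intro Max_ge) auto
  have K1p: "0 < K1" using K1[OF a0] rk(2)[OF a0] by linarith
  define S where "S = cball 0 K \<inter> {v. \<forall>a\<in>A. \<delta> \<le> norm (v - a)}"
  have "closed {v. \<forall>a\<in>A. \<delta> \<le> norm (v - a)}"
  proof -
    have "{v. \<forall>a\<in>A. \<delta> \<le> norm (v - a)} = (\<Inter>a\<in>A. {v. \<delta> \<le> norm (v - a)})" by auto
    then show ?thesis by (auto intro!: closed_INT closed_Collect_le continuous_intros)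
  qed
  then have S: "compact S" unfolding S_def by (intro compact_Int_closed compact_cball)
  have "\<exists>c0>0. \<forall>v\<in>S. c0 \<le> W v"
  proof (cases "S = {}")
    case False
    obtain v where v: "v \<in> S" "\<And>w. w \<in> S \<Longrightarrow> W v \<le> W w"
      using continuous_attains_inf[OF S False continuous_on_subset[OF cont]] by blast
    have "v \<notin> A" using v(1) \<delta> by (auto simp: S_def dest!: bspec[of A _ v])
    then show ?thesis using pos v(2) by (intro exI[of _ "W v"]) auto
  qed (auto intro: exI[of _ 1])
  then obtain c0 where c0: "0 < c0" "\<And>v. v \<in> S \<Longrightarrow> c0 \<le> W v" by blast
  have "bounded (W ` cball 0 K)"
    by (intro compact_imp_bounded compact_continuous_image continuous_on_subset[OF cont]) auto
  then obtain W1 where W1: "0 < W1" "\<And>v. v \<in> cball 0 K \<Longrightarrow> norm (W v) \<le> W1" by (auto simp: bounded_pos)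
  show ?thesis
  proof (rule exI[of _ \<delta>], rule exI[of _ K1], rule exI[of _ c0], rule exI[of _ W1], intro conjI ballI impI allI)
    show "radial_well W a (2 * \<delta>) K1" if "a \<in> A" for a
      by (rule radial_well_mono[OF rk(3)[OF that] \<delta>r[OF that] K1[OF that] Wn])
    show "c0 \<le> W v" if "norm v \<le> K \<and> (\<forall>a\<in>A. \<delta> \<le> norm (v - a))" for v
      by (rule c0(2)) (use that in \<open>auto simp: S_def\<close>)
    show "W v \<le> W1" if "norm v \<le> K" for v using W1(2)[of v] that by simp
  qed (use \<delta> K1p c0 W1 \<delta>D in auto)
qed

section \<open>A nonlocal Poincare inequality\<close>

lemma norm_matrix_vector_le: "norm (A *v h) \<le> norm A * norm h"
  for A :: "real ^ 'n ^ 'm"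
proof -
  have "norm (A *v h) = L2_set (\<lambda>j. norm (A $ j \<bullet> h)) UNIV"
    by (simp add: norm_vec_def[of "A *v h"] matrix_vector_mul_component)
  also have "\<dots> \<le> L2_set (\<lambda>j. norm (A $ j) * norm h) UNIV"
    by (rule L2_set_mono) (auto simp: Cauchy_Schwarz_ineq2)
  also have "\<dots> = L2_set (\<lambda>j. norm (A $ j)) UNIV * norm h"
    by (rule L2_set_left_distrib[symmetric]) simp
  finally show ?thesis by (simp add: norm_vec_def[of A])
qed

lemma nn_integral_lborel_shift:
  fixes f :: "'a::euclidean_space \<Rightarrow> ennreal"
  assumes [measurable]: "f \<in> borel_measurable borel"
  shows "(\<integral>\<^sup>+x. f (z + x) \<partial>lborel) = (\<integral>\<^sup>+x. f x \<partial>lborel)"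
proof -
  have "(\<integral>\<^sup>+x. f x \<partial>lborel) = (\<integral>\<^sup>+x. f x \<partial>(distr lborel borel ((+) z)))"
    by (simp add: lborel_distr_plus)
  also have "\<dots> = (\<integral>\<^sup>+x. f (z + x) \<partial>lborel)" by (rule nn_integral_distr) auto
  finally show ?thesis by simp
qed

lemma AE_lborel_shift:
  fixes z :: "'a::euclidean_space"
  assumes "AE x in lborel. P x" shows "AE x in lborel. P (z + x)"
proof (rule AE_distrD[of "(+) z" lborel borel P])
  show "(+) z \<in> lborel \<rightarrow>\<^sub>M borel" by simp
  show "AE x in distr lborel borel ((+) z). P x" using assms by (subst lborel_distr_plus)
qed

text \<open>
  The increment is the integral of the derivative along the segment from \<open>x\<close> to \<open>x + z\<close>, which stays in the
  convex set \<open>S\<close>. After interchanging the integrals, every slice is a translate of an integral over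
  part of \<open>S\<close>.
\<close>

lemma translation_estimate_C1:
  fixes f :: "'a::euclidean_space \<Rightarrow> real"
  assumes D: "\<And>x. (f has_derivative f' x) (at x)" and g: "\<And>x h. norm (f' x h) \<le> g x * norm h"
    "continuous_on UNIV g" "\<And>x. 0 \<le> g x" and S: "convex S" "S \<in> sets borel"
  shows "(\<integral>\<^sup>+x. indicator S x * indicator S (x + z) * ennreal \<bar>f (x + z) - f x\<bar> \<partial>lborel)
     \<le> ennreal (norm z) * (\<integral>\<^sup>+x. indicator S x * ennreal (g x) \<partial>lborel)"
proof -
  note [measurable] = S(2)
  have gm[measurable]: "g \<in> borel_measurable borel" by (rule borel_measurable_continuous_onI[OF g(2)])
  have "continuous_on UNIV f" by (intro continuous_at_imp_continuous_on ballI has_derivative_continuous[OF D])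
  then have fm[measurable]: "f \<in> borel_measurable borel" by (rule borel_measurable_continuous_onI)
  have line: "ennreal \<bar>f (x + z) - f x\<bar> \<le> (\<integral>\<^sup>+t. indicator {0..1} t * ennreal (norm z * g (x + t *\<^sub>R z)) \<partial>lborel)" for x
  proof -
    have der: "((\<lambda>t. f (x + t *\<^sub>R z)) has_vector_derivative f' (x + t *\<^sub>R z) z) (at t within {0..1})" for t
    proof -
      have "((\<lambda>t. x + t *\<^sub>R z) has_derivative (\<lambda>t. t *\<^sub>R z)) (at t)"
        by (auto intro!: derivative_eq_intros)
      from has_derivative_compose[OF this D]
      have "((\<lambda>t. f (x + t *\<^sub>R z)) has_derivative (\<lambda>s. f' (x + t *\<^sub>R z) (s *\<^sub>R z))) (at t)" .
      moreover have "f' y (s *\<^sub>R z) = s *\<^sub>R f' y z" for y s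
        using linear_scale[OF has_derivative_linear[OF D]] by simp
      ultimately show ?thesis by (simp add: has_vector_derivative_def has_derivative_at_withinI)
    qed
    have ftc: "((\<lambda>t. f' (x + t *\<^sub>R z) z) has_integral (f (x + 1 *\<^sub>R z) - f (x + 0 *\<^sub>R z))) {0..1}"
      by (rule fundamental_theorem_of_calculus[OF _ der]) simp
    have cont: "continuous_on {0..1} (\<lambda>t. norm z * g (x + t *\<^sub>R z))"
      by (intro continuous_intros continuous_on_compose2[OF g(2)]) auto
    define I where "I = integral {0..1} (\<lambda>t. norm z * g (x + t *\<^sub>R z))"
    have intg: "((\<lambda>t. norm z * g (x + t *\<^sub>R z)) has_integral I) {0..1}"
      unfolding I_def using integrable_continuous_real[OF cont] by (rule integrable_integral)
    have "norm (integral {0..1} (\<lambda>t. f' (x + t *\<^sub>R z) z)) \<le> I"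
      unfolding I_def
    proof (rule integral_norm_bound_integral)
      show "(\<lambda>t. f' (x + t *\<^sub>R z) z) integrable_on {0..1}" using ftc by blast
      show "(\<lambda>t. norm z * g (x + t *\<^sub>R z)) integrable_on {0..1}" by (rule integrable_continuous_real[OF cont])
      show "norm (f' (x + t *\<^sub>R z) z) \<le> norm z * g (x + t *\<^sub>R z)" for t
        using g(1)[of "x + t *\<^sub>R z" z] by (simp add: mult.commute)
    qed
    then have "\<bar>f (x + z) - f x\<bar> \<le> I" using integral_unique[OF ftc] by simp
    then have "ennreal \<bar>f (x + z) - f x\<bar> \<le> ennreal I" by (rule ennreal_leI)
    also have "ennreal I = (\<integral>\<^sup>+t. ennreal (indicator {0..1} t * (norm z * g (x + t *\<^sub>R z))) \<partial>lborel)"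
      using nn_integral_has_integral_lebesgue[OF _ intg] g(3) by simp
    also have "\<dots> = (\<integral>\<^sup>+t. indicator {0..1} t * ennreal (norm z * g (x + t *\<^sub>R z)) \<partial>lborel)"
      by (intro nn_integral_cong) (auto simp: indicator_def)
    finally show ?thesis .
  qed
  have "(\<integral>\<^sup>+x. indicator S x * indicator S (x + z) * ennreal \<bar>f (x + z) - f x\<bar> \<partial>lborel)
     \<le> (\<integral>\<^sup>+x. (\<integral>\<^sup>+t. indicator S x * indicator S (x + z) * (indicator {0..1} t * ennreal (norm z * g (x + t *\<^sub>R z))) \<partial>lborel) \<partial>lborel)"
    by (intro nn_integral_mono) (subst nn_integral_cmult, measurable, intro mult_left_mono line, simp)
  also have "\<dots> = (\<integral>\<^sup>+t. (\<integral>\<^sup>+x. indicator S x * indicator S (x + z) * (indicator {0..1} t * ennreal (norm z * g (x + t *\<^sub>R z))) \<partial>lborel) \<partial>lborel)"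
    by (rule lborel_pair.Fubini'[symmetric]) measurable
  also have "\<dots> \<le> (\<integral>\<^sup>+t. indicator {0..1::real} t * (ennreal (norm z) * (\<integral>\<^sup>+x. indicator S x * ennreal (g x) \<partial>lborel)) \<partial>lborel)"
  proof (rule nn_integral_mono)
    fix t :: real
    show "(\<integral>\<^sup>+x. indicator S x * indicator S (x + z) * (indicator {0..1} t * ennreal (norm z * g (x + t *\<^sub>R z))) \<partial>lborel)
       \<le> indicator {0..1} t * (ennreal (norm z) * (\<integral>\<^sup>+x. indicator S x * ennreal (g x) \<partial>lborel))"
    proof (cases "t \<in> {0..1}")
      case True
      have "(\<integral>\<^sup>+x. indicator S x * indicator S (x + z) * (indicator {0..1} t * ennreal (norm z * g (x + t *\<^sub>R z))) \<partial>lborel)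
         \<le> (\<integral>\<^sup>+x. ennreal (norm z) * (indicator S (t *\<^sub>R z + x) * ennreal (g (t *\<^sub>R z + x))) \<partial>lborel)"
      proof (rule nn_integral_mono)
        fix x
        have "x + t *\<^sub>R z \<in> S" if "x \<in> S" "x + z \<in> S"
        proof -
          have "(1 - t) *\<^sub>R x + t *\<^sub>R (x + z) \<in> S" using convexD_alt[OF S(1) that] True by auto
          then show ?thesis by (simp add: algebra_simps)
        qed
        then show "indicator S x * indicator S (x + z) * (indicator {0..1} t * ennreal (norm z * g (x + t *\<^sub>R z)))
          \<le> ennreal (norm z) * (indicator S (t *\<^sub>R z + x) * ennreal (g (t *\<^sub>R z + x)))"
          using True g(3) by (auto simp: indicator_def ennreal_mult add.commute)
      qed
      also have "\<dots> = ennreal (norm z) * (\<integral>\<^sup>+x. indicator S (t *\<^sub>R z + x) * ennreal (g (t *\<^sub>R z + x)) \<partial>lborel)"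
        by (rule nn_integral_cmult) measurable
      also have "\<dots> = ennreal (norm z) * (\<integral>\<^sup>+x. indicator S x * ennreal (g x) \<partial>lborel)"
      proof -
        have "(\<lambda>x. indicator S x * ennreal (g x)) \<in> borel_measurable borel" by measurable
        from nn_integral_lborel_shift[OF this, of "t *\<^sub>R z"] show ?thesis by simp
      qed
      finally show ?thesis using True by simp
    qed simp
  qed
  also have "\<dots> = ennreal (norm z) * (\<integral>\<^sup>+x. indicator S x * ennreal (g x) \<partial>lborel)"
    by (subst nn_integral_multc) auto
  finally show ?thesis .
qed

text \<open>
  The smooth case for \<open>\<Phi> \<circ> us k\<close>, followed by dominated convergence on both sides.
\<close>

lemma translation_estimate:
  fixes u :: "real ^ 'n \<Rightarrow> real ^ 'm" and \<Phi> :: "real ^ 'm \<Rightarrow> real"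
  assumes sa: "smooth_approx us Ds K M u G"
    and meas[measurable]: "u \<in> borel_measurable borel" "G \<in> borel_measurable borel"
    and sm: "smooth \<Phi>" and Q: "\<And>v. norm (grad \<Phi> v) \<le> Q" and \<Phi>: "\<And>v. 0 \<le> \<Phi> v" "\<And>v. \<Phi> v \<le> 1"
    and S: "convex S" "open S" "bounded S"
  shows "(\<integral>\<^sup>+x. indicator S x * indicator S (x + z) * ennreal \<bar>\<Phi> (u (x + z)) - \<Phi> (u x)\<bar> \<partial>lborel)
     \<le> ennreal (norm z) * (\<integral>\<^sup>+x. indicator S x * ennreal (norm (grad \<Phi> (u x)) * norm (G x)) \<partial>lborel)"
proof -
  note ap = smooth_approxD[OF sa]
  have lu: "AE x in lborel. (\<lambda>k. us k x) \<longlonglongrightarrow> u x" and lG: "AE x in lborel. (\<lambda>k. Ds k x) \<longlonglongrightarrow> G x"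
    using ap(6,7) by (simp_all add: AE_completion_iff)
  have M: "0 \<le> M" using ap(5) norm_ge_zero order_trans by blast
  have Q0: "0 \<le> Q" by (rule order_trans[OF norm_ge_zero Q])
  have c\<Phi>: "continuous_on UNIV \<Phi>" by (rule smooth_continuous[OF sm])
  have cg: "continuous_on UNIV (grad \<Phi>)" by (rule smooth_grad_continuous[OF sm])
  have [measurable]: "\<Phi> \<in> borel_measurable borel" "grad \<Phi> \<in> borel_measurable borel"
    by (rule borel_measurable_continuous_onI[OF c\<Phi>] borel_measurable_continuous_onI[OF cg])+
  have cus: "continuous_on UNIV (us k)" for k by (rule smooth_continuous[OF ap(1)])
  have [measurable]: "us k \<in> borel_measurable borel" "Ds k \<in> borel_measurable borel" for k
    by (rule borel_measurable_continuous_onI[OF cus] borel_measurable_continuous_onI[OF ap(3)])+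
  have [measurable]: "S \<in> sets borel" using S by auto
  have fin: "emeasure lborel S < \<infinity>" by (rule emeasure_bounded_finite[OF S(3)])
  let ?L = "\<lambda>k x. indicator S x * indicator S (x + z) * ennreal \<bar>\<Phi> (us k (x + z)) - \<Phi> (us k x)\<bar>"
  let ?R = "\<lambda>k x. indicator S x * ennreal (norm (grad \<Phi> (us k x)) * norm (Ds k x))"
  have est: "(\<integral>\<^sup>+x. ?L k x \<partial>lborel) \<le> ennreal (norm z) * (\<integral>\<^sup>+x. ?R k x \<partial>lborel)" for k
  proof (rule translation_estimate_C1[OF _ _ _ _ S(1)])
    show "((\<lambda>x. \<Phi> (us k x)) has_derivative (\<lambda>h. grad \<Phi> (us k x) \<bullet> (Ds k x *v h))) (at x)" for x
      by (rule has_derivative_compose[OF ap(2) smooth_has_derivative_grad[OF sm]])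
    show "norm (grad \<Phi> (us k x) \<bullet> (Ds k x *v h)) \<le> norm (grad \<Phi> (us k x)) * norm (Ds k x) * norm h" for x h
    proof -
      have "norm (grad \<Phi> (us k x) \<bullet> (Ds k x *v h)) \<le> norm (grad \<Phi> (us k x)) * norm (Ds k x *v h)"
        by (simp add: Cauchy_Schwarz_ineq2)
      also have "\<dots> \<le> norm (grad \<Phi> (us k x)) * (norm (Ds k x) * norm h)"
        by (intro mult_left_mono norm_matrix_vector_le) simp
      finally show ?thesis by (simp add: mult.assoc)
    qed
    show "continuous_on UNIV (\<lambda>x. norm (grad \<Phi> (us k x)) * norm (Ds k x))"
      by (intro continuous_intros continuous_on_compose2[OF cg cus] ap(3)) auto
    show "0 \<le> norm (grad \<Phi> (us k x)) * norm (Ds k x)" for x by simp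
  qed measurable
  have L: "(\<lambda>k. \<integral>\<^sup>+x. ?L k x \<partial>lborel) \<longlonglongrightarrow> (\<integral>\<^sup>+x. indicator S x * indicator S (x + z) * ennreal \<bar>\<Phi> (u (x + z)) - \<Phi> (u x)\<bar> \<partial>lborel)"
  proof (rule nn_integral_dominated_convergence)
    show "(\<integral>\<^sup>+x. indicator S x \<partial>lborel) < \<infinity>" using fin by simp
    have "\<bar>\<Phi> v - \<Phi> w\<bar> \<le> 1" for v w using \<Phi>(1)[of v] \<Phi>(2)[of v] \<Phi>(1)[of w] \<Phi>(2)[of w] by linarith
    then have "ennreal \<bar>\<Phi> v - \<Phi> w\<bar> \<le> 1" for v w using ennreal_leI[of _ 1] by simp
    then show "AE x in lborel. ?L k x \<le> indicator S x" for k
      by (intro AE_I2) (auto simp: indicator_def)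
    show "AE x in lborel. (\<lambda>k. ?L k x) \<longlonglongrightarrow> indicator S x * indicator S (x + z) * ennreal \<bar>\<Phi> (u (x + z)) - \<Phi> (u x)\<bar>"
      using lu AE_lborel_shift[OF lu, of z]
    proof eventually_elim
      case (elim x)
      have "(\<lambda>k. \<bar>\<Phi> (us k (x + z)) - \<Phi> (us k x)\<bar>) \<longlonglongrightarrow> \<bar>\<Phi> (u (x + z)) - \<Phi> (u x)\<bar>"
        using elim by (intro tendsto_intros continuous_on_tendsto_compose[OF c\<Phi>]) (auto simp: add.commute)
      then show ?case
        by (intro tendsto_mult_ennreal tendsto_ennrealI tendsto_const) (auto simp: indicator_def)
    qed
  qed measurable
  have R: "(\<lambda>k. \<integral>\<^sup>+x. ?R k x \<partial>lborel) \<longlonglongrightarrow> (\<integral>\<^sup>+x. indicator S x * ennreal (norm (grad \<Phi> (u x)) * norm (G x)) \<partial>lborel)"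
  proof (rule nn_integral_dominated_convergence)
    show "(\<integral>\<^sup>+x. ennreal (Q * M) * indicator S x \<partial>lborel) < \<infinity>"
      using fin by (simp add: nn_integral_cmult_indicator ennreal_mult_less_top)
    show "AE x in lborel. ?R k x \<le> ennreal (Q * M) * indicator S x" for k
      using Q ap(5) M Q0 by (intro AE_I2) (auto simp: indicator_def intro!: ennreal_leI mult_mono)
    show "AE x in lborel. (\<lambda>k. ?R k x) \<longlonglongrightarrow> indicator S x * ennreal (norm (grad \<Phi> (u x)) * norm (G x))"
      using lu lG
    proof eventually_elim
      case (elim x)
      have "(\<lambda>k. norm (grad \<Phi> (us k x)) * norm (Ds k x)) \<longlonglongrightarrow> norm (grad \<Phi> (u x)) * norm (G x)"
        using elim by (intro tendsto_intros continuous_on_tendsto_compose[OF cg]) auto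
      then show ?case by (intro tendsto_mult_ennreal tendsto_ennrealI tendsto_const) (auto simp: indicator_def)
    qed
  qed measurable
  show ?thesis
  proof (rule LIMSEQ_le[OF L])
    show "(\<lambda>k. ennreal (norm z) * (\<integral>\<^sup>+x. ?R k x \<partial>lborel)) \<longlonglongrightarrow> ennreal (norm z) * (\<integral>\<^sup>+x. indicator S x * ennreal (norm (grad \<Phi> (u x)) * norm (G x)) \<partial>lborel)"
      by (rule ennreal_tendsto_cmult[OF _ R]) simp
    show "\<exists>N. \<forall>k\<ge>N. (\<integral>\<^sup>+x. ?L k x \<partial>lborel) \<le> ennreal (norm z) * (\<integral>\<^sup>+x. ?R k x \<partial>lborel)" using est by blast
  qed
qed

text \<open>
  Integrate the translation estimate over all \<open>z\<close> with \<open>norm z < l\<close>. Each \<open>x \<in> X\<close> contributes at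
  least \<open>\<theta>\<close> to the left-hand side, because \<open>\<Phi> \<circ> u\<close> jumps from 1 to 0 between \<open>x\<close> and a set of
  nearby points of measure at least \<open>\<theta>\<close>.
\<close>

lemma nonlocal_poincare:
  fixes u :: "real ^ 'n \<Rightarrow> real ^ 'm" and \<Phi> :: "real ^ 'm \<Rightarrow> real"
  assumes sa: "smooth_approx us Ds K M u G"
    and meas[measurable]: "u \<in> borel_measurable borel" "G \<in> borel_measurable borel"
    and sm: "smooth \<Phi>" and Q: "\<And>v. norm (grad \<Phi> v) \<le> Q" and \<Phi>: "\<And>v. 0 \<le> \<Phi> v" "\<And>v. \<Phi> v \<le> 1"
    and S: "convex S" "open S" "bounded S" and l: "0 < l"
    and X[measurable]: "X \<in> sets borel" and XS: "X \<subseteq> S" and X1: "\<And>x. x \<in> X \<Longrightarrow> \<Phi> (u x) = 1"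
    and \<theta>: "\<And>x. x \<in> X \<Longrightarrow> \<theta> \<le> emeasure lborel {y \<in> S. dist x y < l \<and> \<Phi> (u y) = 0}"
  shows "\<theta> * emeasure lborel X \<le> ennreal l * emeasure lborel (ball (0 :: real ^ 'n) l) *
     (\<integral>\<^sup>+x. indicator S x * ennreal (norm (grad \<Phi> (u x)) * norm (G x)) \<partial>lborel)"
proof -
  have [measurable]: "\<Phi> \<in> borel_measurable borel" by (rule smooth_borel[OF sm])
  have Sm[measurable]: "S \<in> sets borel" using S by auto
  have [measurable]: "ball (0 :: real ^ 'n) l \<in> sets borel" by simp
  let ?A = "\<integral>\<^sup>+x. indicator S x * ennreal (norm (grad \<Phi> (u x)) * norm (G x)) \<partial>lborel"
  let ?F = "\<lambda>x z. indicator S x * indicator S (x + z) * ennreal \<bar>\<Phi> (u (x + z)) - \<Phi> (u x)\<bar>"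
  have "\<theta> * emeasure lborel X = (\<integral>\<^sup>+x. \<theta> * indicator X x \<partial>lborel)"
    by (simp add: nn_integral_cmult_indicator)
  also have "\<dots> \<le> (\<integral>\<^sup>+x. (\<integral>\<^sup>+z. indicator (ball 0 l) z * ?F x z \<partial>lborel) \<partial>lborel)"
  proof (rule nn_integral_mono)
    fix x :: "real ^ 'n"
    show "\<theta> * indicator X x \<le> (\<integral>\<^sup>+z. indicator (ball 0 l) z * ?F x z \<partial>lborel)"
    proof (cases "x \<in> X")
      case True
      let ?Y = "{y \<in> S. dist x y < l \<and> \<Phi> (u y) = 0}"
      have Y: "?Y \<in> sets borel" by measurable
      have "\<theta> \<le> (\<integral>\<^sup>+y. indicator ?Y y \<partial>lborel)" using \<theta>[OF True] Y by simp
      also have "\<dots> = (\<integral>\<^sup>+z. indicator ?Y (x + z) \<partial>lborel)"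
        by (rule nn_integral_lborel_shift[symmetric]) (use Y in measurable)
      also have "\<dots> \<le> (\<integral>\<^sup>+z. indicator (ball 0 l) z * ?F x z \<partial>lborel)"
        using True XS X1 by (intro nn_integral_mono) (auto simp: indicator_def dist_norm)
      finally show ?thesis using True by simp
    qed simp
  qed
  also have "\<dots> = (\<integral>\<^sup>+z. (\<integral>\<^sup>+x. indicator (ball 0 l) z * ?F x z \<partial>lborel) \<partial>lborel)"
    by (rule lborel_pair.Fubini'[symmetric]) measurable
  also have "\<dots> \<le> (\<integral>\<^sup>+z. (ennreal l * ?A) * indicator (ball (0 :: real ^ 'n) l) z \<partial>lborel)"
  proof (rule nn_integral_mono)
    fix z :: "real ^ 'n"
    show "(\<integral>\<^sup>+x. indicator (ball 0 l) z * ?F x z \<partial>lborel) \<le> (ennreal l * ?A) * indicator (ball 0 l) z"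
    proof (cases "z \<in> ball 0 l")
      case True
      have "(\<integral>\<^sup>+x. ?F x z \<partial>lborel) \<le> ennreal (norm z) * ?A"
        by (rule translation_estimate[OF sa meas sm Q \<Phi> S])
      also have "\<dots> \<le> ennreal l * ?A" using True by (intro mult_right_mono ennreal_leI) auto
      finally show ?thesis using True by simp
    qed simp
  qed
  also have "\<dots> = ennreal l * emeasure lborel (ball (0 :: real ^ 'n) l) * ?A"
    by (subst nn_integral_cmult_indicator) (auto simp: mult_ac)
  finally show ?thesis .
qed

section \<open>Smooth cut-offs and phase functions\<close>

definition cutoff :: "real \<Rightarrow> real \<Rightarrow> ('a::euclidean_space \<Rightarrow> real) \<Rightarrow> bool" where
  "cutoff C s \<psi> \<longleftrightarrow> smooth \<psi> \<and>
    (\<forall>x. x \<notin> cball 0 (s + 2) \<longrightarrow> \<psi> x = 0) \<and> (\<forall>x. 0 \<le> \<psi> x \<and> \<psi> x \<le> 1) \<and>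
    (\<forall>x\<in>ball 0 s. \<psi> x = 1 \<and> grad \<psi> x = 0) \<and> (\<forall>x. norm (grad \<psi> x) \<le> C)"

lemma cutoffD:
  assumes "cutoff C s \<psi>"
  shows "smooth \<psi>" "x \<notin> cball 0 (s + 2) \<Longrightarrow> \<psi> x = 0" "0 \<le> \<psi> x" "\<psi> x \<le> 1"
    "x \<in> ball 0 s \<Longrightarrow> \<psi> x = 1" "x \<in> ball 0 s \<Longrightarrow> grad \<psi> x = 0" "norm (grad \<psi> x) \<le> C"
  using assms unfolding cutoff_def by blast+

text \<open>
  Mollify the indicator function of the ball of radius \<open>s + 1\<close> with one fixed bump of radius 1. The gradient
  bound is the sum of the \<open>L\<^sup>1\<close> norms of the partial derivatives of the bump, hence independent of \<open>s\<close>.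
\<close>

lemma cutoff_exists: "\<exists>C\<ge>0. \<forall>s>0. \<exists>\<psi> :: 'a::euclidean_space \<Rightarrow> real. cutoff C s \<psi>"
proof -
  obtain \<eta> :: "'a \<Rightarrow> real" where \<eta>: "smooth \<eta>" "\<And>x. 0 \<le> \<eta> x" "\<And>x. x \<notin> ball 0 1 \<Longrightarrow> \<eta> x = 0"
    "integrable lebesgue \<eta>" "integral\<^sup>L lebesgue \<eta> = 1"
    using bump_exists[of 1 "0::'a"] by auto
  have \<eta>0: "\<eta> x = 0" if "x \<notin> cball 0 1" for x using \<eta>(3)[of x] that by auto
  define C where "C = (\<Sum>b\<in>Basis. \<bar>integral\<^sup>L lebesgue (\<lambda>y. \<bar>frechet_derivative \<eta> (at y) b\<bar>)\<bar>)"
  show ?thesis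
  proof (rule exI[of _ C], intro conjI allI impI)
    show "0 \<le> C" by (auto simp: C_def intro: sum_nonneg)
    fix s :: real assume s: "0 < s"
    define f where "f x = indicat_real (ball 0 (s + 1)) x" for x :: 'a
    define \<psi> where "\<psi> = conv \<eta> f"
    have f: "f \<in> borel_measurable lebesgue" "AE x in lebesgue. norm (f x) \<le> 1"
      unfolding f_def[abs_def] by (auto intro!: borel_measurable_indicator AE_I2)
    have L: "L1_loc_on UNIV f" by (rule bounded_L1_loc_on[OF f])
    have sm: "smooth \<psi>" unfolding \<psi>_def by (rule conv_smooth[OF L \<eta>(1) \<eta>0])
    have one: "\<psi> x = 1" if "x \<in> ball 0 s" for x
    proof -
      have "\<eta> (y - x) *\<^sub>R f y = \<eta> (y - x)" for y
      proof (cases "y - x \<in> ball 0 1")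
        case True
        then have "norm y < s + 1" using that norm_triangle_ineq[of "y - x" x] by simp
        then show ?thesis by (simp add: f_def)
      qed (simp add: \<eta>(3))
      then have "\<psi> x = integral\<^sup>L lebesgue (\<lambda>y. \<eta> (y - x))" by (simp only: \<psi>_def conv_def)
      then show ?thesis
        using lebesgue_integral_affine[OF smooth_borel[OF \<eta>(1)], of 1 "- x"] \<eta>(5) by simp
    qed
    have zero: "\<psi> x = 0" if "x \<notin> cball 0 (s + 2)" for x
    proof -
      have "\<eta> (y - x) *\<^sub>R f y = 0" for y
      proof (cases "y - x \<in> ball 0 1")
        case True
        then have "s + 1 < norm y" using that norm_triangle_ineq4[of y "y - x"] by simp
        then show ?thesis by (simp add: f_def)
      qed (simp add: \<eta>(3))
      then have "conv \<eta> f x = (LINT y :: 'a|lebesgue. 0)" by (simp only: conv_def)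
      then show ?thesis by (simp add: \<psi>_def)
    qed
    have nonneg: "0 \<le> \<psi> x" for x
      unfolding \<psi>_def conv_def by (rule Bochner_Integration.integral_nonneg) (simp add: \<eta>(2) f_def)
    have le1: "\<psi> x \<le> 1" for x
      using conv_bound[OF f(2) smooth_borel[OF \<eta>(1)] \<eta>(2,4,5), of x] by (simp add: \<psi>_def)
    have g0: "grad \<psi> x = 0" if "x \<in> ball 0 s" for x
    proof -
      have "((\<lambda>y. 1) has_derivative (\<lambda>h. 0)) (at x)" by simp
      then have "(\<psi> has_derivative (\<lambda>h. 0)) (at x)"
        by (rule has_derivative_transform_within_open[of _ _ _ _ "ball 0 s"]) (use that one in auto)
      then have "frechet_derivative \<psi> (at x) = (\<lambda>h. 0)" using frechet_derivative_at by metis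
      then show ?thesis by (simp add: grad_def)
    qed
    have gC: "norm (grad \<psi> x) \<le> C" for x
    proof -
      have "\<bar>frechet_derivative \<psi> (at x) b\<bar> \<le> \<bar>integral\<^sup>L lebesgue (\<lambda>y. \<bar>frechet_derivative \<eta> (at y) b\<bar>)\<bar>" if b: "b \<in> Basis" for b
      proof -
        define d where "d w = frechet_derivative \<eta> (at w) b" for w
        have d0: "d w = 0" if "w \<notin> cball 0 1" for w
          using frechet_derivative_eq_0_outside[of "cball 0 1" \<eta>, OF closed_cball \<eta>0 that] by (simp add: d_def)
        have dc: "continuous_on UNIV d" unfolding d_def by (rule smooth_continuous[OF smooth_partial[OF \<eta>(1) b]])
        have "frechet_derivative \<psi> (at x) = (\<lambda>h. - (\<Sum>b\<in>Basis. (h \<bullet> b) *\<^sub>R conv (\<lambda>w. frechet_derivative \<eta> (at w) b) f x))"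
          unfolding \<psi>_def by (rule frechet_derivative_at[OF conv_has_derivative[OF L \<eta>(1) \<eta>0], symmetric])
        then have "frechet_derivative \<psi> (at x) b = - conv d f x"
          using b by (simp add: inner_Basis d_def[abs_def] if_distrib[of "\<lambda>t. t * _"] cong: if_cong)
        moreover have "\<bar>conv d f x\<bar> \<le> integral\<^sup>L lebesgue (\<lambda>y. \<bar>d (y - x)\<bar>)"
        proof -
          have int: "integrable lebesgue (\<lambda>y. \<bar>d (y - x)\<bar>)"
            by (rule integrable_compact_support[where c = x and r = 1])
               (auto simp: dist_norm norm_minus_commute intro!: continuous_intros continuous_on_compose2[OF dc] d0)
          have "norm (conv d f x) \<le> integral\<^sup>L lebesgue (\<lambda>y. \<bar>d (y - x)\<bar>)"
            unfolding conv_def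
          proof (rule order_trans[OF integral_norm_bound], rule integral_mono_AE')
            show "AE y in lebesgue. norm (d (y - x) *\<^sub>R f y) \<le> \<bar>d (y - x)\<bar>"
              by (intro AE_I2) (simp add: f_def indicator_def)
          qed (use int in auto)
          then show ?thesis by simp
        qed
        moreover have "integral\<^sup>L lebesgue (\<lambda>y. \<bar>d (y - x)\<bar>) = integral\<^sup>L lebesgue (\<lambda>y. \<bar>d y\<bar>)"
        proof -
          have "(\<lambda>y. \<bar>d y\<bar>) \<in> borel_measurable borel"
            by (intro borel_measurable_continuous_onI continuous_intros dc)
          from lebesgue_integral_affine[OF this, of 1 "- x"] show ?thesis by simp
        qed
        ultimately show ?thesis by (simp add: d_def)
      qed
      then have "(\<Sum>b\<in>Basis. \<bar>frechet_derivative \<psi> (at x) b\<bar>) \<le> C"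
        unfolding C_def by (rule sum_mono)
      moreover have "norm (grad \<psi> x) \<le> (\<Sum>b\<in>Basis. \<bar>frechet_derivative \<psi> (at x) b\<bar>)"
        unfolding grad_def by (rule order_trans[OF norm_sum]) (simp add: sum_mono)
      ultimately show ?thesis by linarith
    qed
    show "\<exists>\<psi> :: 'a \<Rightarrow> real. cutoff C s \<psi>"
      unfolding cutoff_def using sm zero nonneg le1 one g0 gC by blast
  qed
qed

text \<open>
  A detector for the phase \<open>a\<close>. For suitable \<open>\<delta>\<close> the shell to which its variation is confined avoids
  neighbourhoods of all zeros of the potential, so that \<open>W\<close> is bounded below there.
\<close>

definition phase_function :: "'a::euclidean_space \<Rightarrow> real \<Rightarrow> real \<Rightarrow> ('a \<Rightarrow> real) \<Rightarrow> bool" where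
  "phase_function a \<delta> Q \<Phi> \<longleftrightarrow> smooth \<Phi> \<and> (\<forall>v. norm (grad \<Phi> v) \<le> Q) \<and> (\<forall>v. 0 \<le> \<Phi> v \<and> \<Phi> v \<le> 1) \<and>
     (\<forall>v. (norm (v - a) \<le> \<delta> \<longrightarrow> \<Phi> v = 0) \<and> (2 * \<delta> \<le> norm (v - a) \<longrightarrow> \<Phi> v = 1)) \<and>
     (\<forall>v. grad \<Phi> v \<noteq> 0 \<longrightarrow> \<delta> < norm (v - a) \<and> norm (v - a) < 2 * \<delta>)"

lemma phase_functionD:
  assumes "phase_function a \<delta> Q \<Phi>"
  shows "smooth \<Phi>" "norm (grad \<Phi> v) \<le> Q" "0 \<le> \<Phi> v" "\<Phi> v \<le> 1"
    "norm (v - a) \<le> \<delta> \<Longrightarrow> \<Phi> v = 0" "2 * \<delta> \<le> norm (v - a) \<Longrightarrow> \<Phi> v = 1"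
    "grad \<Phi> v \<noteq> 0 \<Longrightarrow> \<delta> < norm (v - a) \<and> norm (v - a) < 2 * \<delta>"
  using assms unfolding phase_function_def by blast+

text \<open>
  One minus a rescaled cut-off function with \<open>s = 3\<close>, so that \<open>Q\<close> does not depend on \<open>a\<close>.
\<close>

lemma phase_function_exists:
  assumes \<delta>: "0 < \<delta>"
  shows "\<exists>Q>0. \<forall>a :: 'a::euclidean_space. \<exists>\<Phi>. phase_function a \<delta> Q \<Phi>"
proof -
  obtain C where C: "0 \<le> C" "\<forall>s>0. \<exists>\<psi> :: 'a \<Rightarrow> real. cutoff C s \<psi>"
    using cutoff_exists by blast
  obtain \<psi> :: "'a \<Rightarrow> real" where co: "cutoff C 3 \<psi>" using C(2) zero_less_numeral by blast
  note \<psi> = cutoffD[OF co]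
  have out: "\<psi> x = 0" if "x \<notin> cball 0 5" for x using \<psi>(2)[of x] that by simp
  \<comment> \<open>any factor strictly between 5 / 2 and 3 maps norm \<delta> into the ball of radius 3 and norm 2\<delta> outside the ball of radius 5\<close>
  define l where "l = (13 / 5) / \<delta>"
  have l: "0 < l" using \<delta> by (simp add: l_def)
  have g\<psi>: "grad \<psi> x = 0" if "x \<notin> cball 0 5" for x
    by (rule grad_eq_0_outside[OF closed_cball out that])
  show ?thesis
  proof (rule exI[of _ "l * C + 1"], intro conjI allI)
    show "0 < l * C + 1" using l C by (simp add: add_nonneg_pos)
    fix a :: 'a
    define \<Phi> where "\<Phi> v = 1 + (-1) *\<^sub>R \<psi> (l *\<^sub>R v + - (l *\<^sub>R a))" for v
    have sm: "smooth \<Phi>"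
      using \<psi>(1) unfolding \<Phi>_def smooth_def by (intro allI Ck_on_add Ck_on_const Ck_on_scaleR Ck_on_affine) auto
    have arg: "l *\<^sub>R v + - (l *\<^sub>R a) = l *\<^sub>R (v - a)" for v by (simp add: scaleR_diff_right)
    have grad: "grad \<Phi> v = - (l *\<^sub>R grad \<psi> (l *\<^sub>R (v - a)))" for v
    proof -
      have "((\<lambda>v. l *\<^sub>R (v - a)) has_derivative (\<lambda>h. l *\<^sub>R h)) (at v)" by (auto intro!: derivative_eq_intros)
      from has_derivative_compose[OF this smooth_has_derivative_grad[OF \<psi>(1)]]
      have "(\<Phi> has_derivative (\<lambda>h. 0 - grad \<psi> (l *\<^sub>R (v - a)) \<bullet> (l *\<^sub>R h))) (at v)"
        unfolding \<Phi>_def[abs_def] arg by (auto intro!: derivative_eq_intros)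
      from fun_cong[OF has_derivative_unique[OF smooth_has_derivative_grad[OF sm] this]]
      have "grad \<Phi> v \<bullet> h = (- (l *\<^sub>R grad \<psi> (l *\<^sub>R (v - a)))) \<bullet> h" for h by simp
      then show ?thesis by (rule vector_eq_rdot[THEN iffD1, OF allI])
    qed
    have norm_arg: "norm (l *\<^sub>R (v - a)) = (13 / 5) * (norm (v - a) / \<delta>)" for v using \<delta> by (simp add: l_def)
    have inner: "l *\<^sub>R (v - a) \<in> ball 0 3" if "norm (v - a) \<le> \<delta>" for v
      using that \<delta> unfolding mem_ball dist_0_norm norm_arg by (simp add: divide_simps)
    have outer: "l *\<^sub>R (v - a) \<notin> cball 0 5" if "2 * \<delta> \<le> norm (v - a)" for v
      using that \<delta> unfolding mem_cball dist_0_norm norm_arg by (simp add: divide_simps)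
    have "norm (grad \<Phi> v) \<le> l * C + 1" for v
    proof -
      have "norm (grad \<Phi> v) = l * norm (grad \<psi> (l *\<^sub>R (v - a)))" using l by (simp add: grad)
      also have "\<dots> \<le> l * C" using l by (intro mult_left_mono \<psi>(7)) simp
      finally show ?thesis by simp
    qed
    moreover have "0 \<le> \<Phi> v \<and> \<Phi> v \<le> 1" for v using \<psi>(3,4) by (simp add: \<Phi>_def)
    moreover have "norm (v - a) \<le> \<delta> \<longrightarrow> \<Phi> v = 0" "2 * \<delta> \<le> norm (v - a) \<longrightarrow> \<Phi> v = 1" for v
      unfolding \<Phi>_def arg using \<psi>(5)[OF inner, of v] out[OF outer, of v] by simp_all
    moreover have "\<delta> < norm (v - a) \<and> norm (v - a) < 2 * \<delta>" if "grad \<Phi> v \<noteq> 0" for v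
      using \<psi>(6)[OF inner, of v] g\<psi>[OF outer, of v] that unfolding grad by force
    ultimately have "phase_function a \<delta> (l * C + 1) \<Phi>" using sm unfolding phase_function_def by simp
    then show "\<exists>\<Phi>. phase_function a \<delta> (l * C + 1) \<Phi>" by (rule exI[of _ \<Phi>])
  qed
qed

section \<open>Telescoping sums and dyadic scales\<close>

lemma small_telescoping_step:
  fixes F :: "nat \<Rightarrow> real"
  assumes "0 < m" shows "\<exists>i<m. F (Suc i) - F i \<le> (F m - F 0) / real m"
proof (rule ccontr)
  assume "\<not> ?thesis"
  then have "\<And>i. i < m \<Longrightarrow> (F m - F 0) / real m < F (Suc i) - F i" by (meson not_le)
  then have "(\<Sum>i<m. (F m - F 0) / real m) < (\<Sum>i<m. F (Suc i) - F i)"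
    using assms by (intro sum_strict_mono) auto
  also have "\<dots> = F m - F 0" by (rule sum_lessThan_telescope)
  finally show False using assms by simp
qed

lemma dyadic_scale:
  fixes r R :: real
  assumes "0 < r" "r \<le> R"
  shows "\<exists>k. r \<le> R / 2 ^ k \<and> R / 2 ^ k < 2 * r"
proof -
  have "(\<lambda>k. R * (1 / 2) ^ k) \<longlonglongrightarrow> R * 0" by (intro tendsto_intros) auto
  then have "\<forall>\<^sub>F k in sequentially. R * (1 / 2) ^ k < 2 * r"
    by (rule order_tendstoD(2)) (use assms in simp)
  then have "\<exists>k. R * (1 / 2) ^ k < 2 * r" by (auto simp: eventually_sequentially)
  then obtain k where k: "R / 2 ^ k < 2 * r" "\<And>j. j < k \<Longrightarrow> \<not> R / 2 ^ j < 2 * r"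
    using exists_least_iff[of "\<lambda>k. R / 2 ^ k < 2 * r"] by (auto simp: power_divide)
  have "r \<le> R / 2 ^ k"
  proof (cases k)
    case 0
    then show ?thesis using assms by simp
  next
    case (Suc j)
    then show ?thesis using k(2)[of j] by (simp add: field_simps)
  qed
  then show ?thesis using k(1) by blast
qed

section \<open>Comparison with a cut-off towards one zero\<close>

text \<open>
  The data of the problem after normalisation. The maps \<open>u\<close> and \<open>G\<close> are Borel representatives of the minimizer
  and its weak gradient, bounded at every point, so that product measures and Tonelli's theorem can be
  used. Minimality is only recorded for cut-off competitors on balls.
\<close>

locale phase_minimizer =
  fixes W :: "real ^ 'm \<Rightarrow> real" and A :: "(real ^ 'm) set" and u :: "real ^ 'n \<Rightarrow> real ^ 'm" and G :: "real ^ 'n \<Rightarrow> real ^ 'n ^ 'm"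
    and us :: "nat \<Rightarrow> real ^ 'n \<Rightarrow> real ^ 'm" and Ds :: "nat \<Rightarrow> real ^ 'n \<Rightarrow> real ^ 'n ^ 'm" and K M \<delta> K1 c0 W1 :: real
  assumes A: "finite A" "A \<noteq> {}"
    and W: "continuous_on UNIV W" "\<And>v. 0 \<le> W v" "\<And>a. a \<in> A \<Longrightarrow> W a = 0"
    and sa: "smooth_approx us Ds K M u G"
    and meas[measurable]: "u \<in> borel_measurable borel" "G \<in> borel_measurable borel"
    and bnd: "\<And>x. norm (u x) \<le> K" "\<And>x. norm (G x) \<le> M" "\<And>a. a \<in> A \<Longrightarrow> norm a \<le> K"
    and const: "0 < \<delta>" "0 < K1" "0 < c0" "0 < W1"
    and well: "\<And>a. a \<in> A \<Longrightarrow> radial_well W a (2 * \<delta>) K1"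
    and sep: "\<And>a b. a \<in> A \<Longrightarrow> b \<in> A \<Longrightarrow> a \<noteq> b \<Longrightarrow> 4 * \<delta> \<le> norm (a - b)"
    and away: "\<And>v. norm v \<le> K \<Longrightarrow> (\<And>a. a \<in> A \<Longrightarrow> \<delta> \<le> norm (v - a)) \<Longrightarrow> c0 \<le> W v"
    and top: "\<And>v. norm v \<le> K \<Longrightarrow> W v \<le> W1"
    and minimality: "\<And>\<psi> S a r. a \<in> A \<Longrightarrow> smooth \<psi> \<Longrightarrow> compact S \<Longrightarrow> S \<subseteq> ball 0 r \<Longrightarrow> (\<And>x. x \<notin> S \<Longrightarrow> \<psi> x = 0) \<Longrightarrow>
       (\<And>x. 0 \<le> \<psi> x) \<Longrightarrow> (\<And>x. \<psi> x \<le> 1) \<Longrightarrow>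
       (\<integral>\<^sup>+x. ennreal (1 / 2 * (norm (G x))\<^sup>2 + W (u x)) * indicator (ball 0 r) x \<partial>lborel) \<le>
       (\<integral>\<^sup>+x. ennreal (1 / 2 * (norm ((1 - \<psi> x) *\<^sub>R G x + outer (a - u x) (grad \<psi> x)))\<^sup>2 + W (u x + \<psi> x *\<^sub>R (a - u x))) * indicator (ball 0 r) x \<partial>lborel)"
begin

definition e :: "real ^ 'n \<Rightarrow> real" where "e x = 1 / 2 * (norm (G x))\<^sup>2 + W (u x)"
definition \<mu> :: "(real ^ 'n) measure" where "\<mu> = density lborel (\<lambda>x. ennreal (e x))"
definition E :: "real \<Rightarrow> real" where "E r = measure \<mu> (ball 0 r)"
definition off_phase :: "real ^ 'm \<Rightarrow> (real ^ 'n) set" where "off_phase a = {x. 2 * \<delta> \<le> norm (u x - a)}"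
definition phase_set :: "real ^ 'm \<Rightarrow> (real ^ 'n) set" where "phase_set a = {x. norm (u x - a) \<le> \<delta>}"
definition transition :: "real \<Rightarrow> (real ^ 'n) set" where "transition R = {x \<in> ball 0 R. \<forall>a\<in>A. \<delta> \<le> norm (u x - a)}"
abbreviation vol :: "(real ^ 'n) set \<Rightarrow> real" where "vol \<equiv> measure lborel"

lemma off_phase_borel[measurable]: "off_phase a \<in> sets borel" unfolding off_phase_def by measurable
lemma phase_set_borel[measurable]: "phase_set a \<in> sets borel" unfolding phase_set_def by measurable

lemma transition_borel[measurable]: "transition R \<in> sets borel"
proof -
  have "transition R = ball 0 R \<inter> (\<Inter>a\<in>A. {x. \<delta> \<le> norm (u x - a)})" using A by (auto simp: transition_def)
  moreover have "(\<Inter>a\<in>A. {x. \<delta> \<le> norm (u x - a)}) \<in> sets borel"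
    by (rule sets.finite_INT[OF A]) measurable
  ultimately show ?thesis by auto
qed

lemma transition_bounded: "bounded (transition R)"
  by (rule bounded_subset[OF bounded_ball[of 0 R]]) (auto simp: transition_def)

lemma W_borel[measurable]: "W \<in> borel_measurable borel"
  by (rule borel_measurable_continuous_onI[OF W(1)])

lemma e_borel[measurable]: "e \<in> borel_measurable borel"
  unfolding e_def[abs_def] by measurable

lemma e_nonneg: "0 \<le> e x" by (simp add: e_def W(2))

lemma e_bound: "e x \<le> M\<^sup>2 + W1"
proof -
  have "(norm (G x))\<^sup>2 \<le> M\<^sup>2" using bnd(2)[of x] by (intro power_mono) auto
  moreover have "1 / 2 * (norm (G x))\<^sup>2 \<le> (norm (G x))\<^sup>2" by simp
  ultimately show ?thesis using top[OF bnd(1)[of x]] unfolding e_def by linarith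
qed

lemma sets_mu[simp, measurable_cong]: "sets \<mu> = sets borel" by (simp add: \<mu>_def)

lemma emeasure_mu: "S \<in> sets borel \<Longrightarrow> emeasure \<mu> S = (\<integral>\<^sup>+x. ennreal (e x) * indicator S x \<partial>lborel)"
  unfolding \<mu>_def by (rule emeasure_density) auto

lemma mu_fmeasurable: "S \<in> sets borel \<Longrightarrow> bounded S \<Longrightarrow> S \<in> fmeasurable \<mu>"
proof (rule fmeasurableI)
  assume S: "S \<in> sets borel" "bounded S"
  show "S \<in> sets \<mu>" using S by simp
  have "emeasure \<mu> S \<le> (\<integral>\<^sup>+x. ennreal (M\<^sup>2 + W1) * indicator S x \<partial>lborel)"
    unfolding emeasure_mu[OF S(1)] by (intro nn_integral_mono mult_right_mono ennreal_leI e_bound) auto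
  also have "\<dots> = ennreal (M\<^sup>2 + W1) * emeasure lborel S" using S by (simp add: nn_integral_cmult_indicator)
  also have "\<dots> < \<infinity>" using emeasure_bounded_finite[OF S(2)] by (simp add: ennreal_mult_less_top)
  finally show "emeasure \<mu> S < \<infinity>" .
qed

lemma lborel_fmeasurable: "S \<in> sets borel \<Longrightarrow> bounded S \<Longrightarrow> S \<in> fmeasurable (lborel :: (real ^ 'n) measure)"
  by (rule fmeasurableI) (use emeasure_bounded_finite in auto)

lemma emeasure_mu_eq: "S \<in> sets borel \<Longrightarrow> bounded S \<Longrightarrow> emeasure \<mu> S = ennreal (measure \<mu> S)"
  using mu_fmeasurable by (simp add: fmeasurable_def emeasure_eq_ennreal_measure less_top)

lemma emeasure_lborel_eq: "S \<in> sets borel \<Longrightarrow> bounded S \<Longrightarrow> emeasure lborel S = ennreal (vol S)"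
  using lborel_fmeasurable by (simp add: fmeasurable_def emeasure_eq_ennreal_measure less_top)

lemma E_nonneg: "0 \<le> E r" by (simp add: E_def)

lemma E_mono: "r \<le> s \<Longrightarrow> E r \<le> E s"
  unfolding E_def by (rule measure_mono_fmeasurable) (auto intro: mu_fmeasurable)

text \<open>
  Minimality against the competitor that equals \<open>a\<close> in the ball of radius \<open>s\<close> and \<open>u\<close> outside the ball of
  radius \<open>s + 2\<close>. It has no energy in the inner ball. In the layer its energy density is at most a constant times that of \<open>u\<close>
  where \<open>u\<close> is close to \<open>a\<close>, by \<open>radial_well\<close>, and bounded elsewhere. The layer reaches out to
  radius \<open>s + 3\<close> to leave room for the compact support.
\<close>

lemma competitor_estimate:
  "\<exists>C>0. \<forall>s>0. \<forall>a\<in>A. E s \<le> C * ((E (s + 3) - E s) +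
     (vol (off_phase a \<inter> ball 0 (s + 3)) - vol (off_phase a \<inter> ball 0 s)))"
proof -
  obtain C where C: "0 \<le> C" "\<forall>s>0. \<exists>\<psi> :: real ^ 'n \<Rightarrow> real. cutoff C s \<psi>"
    using cutoff_exists by blast
  define P where "P = C\<^sup>2 * (2 * K)\<^sup>2"
  have P: "0 \<le> P" by (simp add: P_def)
  define C1 where "C1 = 2 + C\<^sup>2 * K1 + K1 + P + W1"
  have C1: "0 < C1" using const C P by (auto simp: C1_def intro!: add_pos_nonneg add_nonneg_nonneg)
  show ?thesis
  proof (intro exI[of _ C1] conjI C1 allI impI ballI)
    fix s :: real and a assume s: "0 < s" and a: "a \<in> A"
    obtain \<psi> :: "real ^ 'n \<Rightarrow> real" where co: "cutoff C s \<psi>" using C(2) s by blast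
    note \<psi> = cutoffD[OF co]
    define H where "H = off_phase a"
    have H[measurable]: "H \<in> sets borel" by (simp add: H_def)
    define L where "L = ball (0::real ^ 'n) (s + 3) - ball 0 s"
    have L[measurable]: "L \<in> sets borel" unfolding L_def by auto
    have Lb: "bounded L" unfolding L_def by (rule bounded_subset[OF bounded_ball[of 0 "s + 3"]]) auto
    let ?w = "\<lambda>x. 1 / 2 * (norm ((1 - \<psi> x) *\<^sub>R G x + outer (a - u x) (grad \<psi> x)))\<^sup>2 + W (u x + \<psi> x *\<^sub>R (a - u x))"
    have pw0: "?w x = 0" if "x \<in> ball 0 s" for x
      using \<psi>(5,6)[OF that] W(3)[OF a] by (simp add: outer_def vec_eq_iff zero_vec_def)
    have pw: "?w x \<le> C1 * e x + C1 * indicator H x" for x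
    proof -
      have n1: "norm ((1 - \<psi> x) *\<^sub>R G x) \<le> norm (G x)"
        using \<psi>(3,4)[of x] by (simp add: mult_left_le_one_le)
      have n2: "norm (outer (a - u x) (grad \<psi> x)) \<le> C * norm (u x - a)"
        unfolding norm_outer using mult_right_mono[OF \<psi>(7)[of x], of "norm (a - u x)"]
        by (simp add: mult.commute norm_minus_commute)
      have "(norm ((1 - \<psi> x) *\<^sub>R G x + outer (a - u x) (grad \<psi> x)))\<^sup>2 \<le> (norm (G x) + C * norm (u x - a))\<^sup>2"
        using norm_triangle_mono[OF n1 n2] by (intro power_mono) auto
      also have "\<dots> \<le> 2 * (norm (G x))\<^sup>2 + 2 * (C\<^sup>2 * (norm (u x - a))\<^sup>2)"
        using sum_squares_bound[of "norm (G x)" "C * norm (u x - a)"] by (simp add: power2_sum power_mult_distrib)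
      finally have g: "?w x \<le> (norm (G x))\<^sup>2 + C\<^sup>2 * (norm (u x - a))\<^sup>2 + W (a + (1 - \<psi> x) *\<^sub>R (u x - a))"
        by (simp add: algebra_simps)
      have Ge: "(norm (G x))\<^sup>2 = 2 * (e x - W (u x))" by (simp add: e_def)
      have We: "0 \<le> W (u x)" "W (u x) \<le> e x" by (simp_all add: W(2) e_def)
      show ?thesis
      proof (cases "x \<in> H")
        case False
        then have "norm (u x - a) \<le> 2 * \<delta>" by (simp add: H_def off_phase_def)
        then have w: "(norm (u x - a))\<^sup>2 \<le> K1 * W (u x)" "W (a + (1 - \<psi> x) *\<^sub>R (u x - a)) \<le> K1 * W (u x)"
          using well[OF a] \<psi>(3,4)[of x] unfolding radial_well_def by auto
        have "C\<^sup>2 * (norm (u x - a))\<^sup>2 \<le> C\<^sup>2 * (K1 * W (u x))" using w(1) by (intro mult_left_mono) auto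
        then have "?w x \<le> 2 * (e x - W (u x)) + C\<^sup>2 * (K1 * W (u x)) + K1 * W (u x)" using g w(2) Ge by linarith
        also have "\<dots> \<le> 2 * e x + (C\<^sup>2 * K1 + K1) * W (u x)" using We by (simp add: algebra_simps)
        also have "\<dots> \<le> 2 * e x + (C\<^sup>2 * K1 + K1) * e x" using We const by (intro add_left_mono mult_left_mono) auto
        also have "\<dots> = (2 + C\<^sup>2 * K1 + K1) * e x" by (simp add: algebra_simps)
        also have "\<dots> \<le> C1 * e x" unfolding C1_def using const P e_nonneg by (intro mult_right_mono) auto
        finally show ?thesis using False by simp
      next
        case True
        have "norm (u x - a) \<le> 2 * K" using norm_triangle_le_diff[OF add_mono[OF bnd(1)[of x] bnd(3)[OF a]]] by simp
        then have b1: "C\<^sup>2 * (norm (u x - a))\<^sup>2 \<le> P" unfolding P_def by (intro mult_left_mono power_mono) auto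
        have b2: "W (a + (1 - \<psi> x) *\<^sub>R (u x - a)) \<le> W1"
        proof (rule top)
          have "a + (1 - \<psi> x) *\<^sub>R (u x - a) = \<psi> x *\<^sub>R a + (1 - \<psi> x) *\<^sub>R u x" by (simp add: algebra_simps)
          also have "norm \<dots> \<le> \<psi> x * norm a + (1 - \<psi> x) * norm (u x)"
            using norm_triangle_ineq[of "\<psi> x *\<^sub>R a" "(1 - \<psi> x) *\<^sub>R u x"] \<psi>(3,4)[of x] by simp
          also have "\<dots> \<le> \<psi> x * K + (1 - \<psi> x) * K"
            using \<psi>(3,4)[of x] bnd(1)[of x] bnd(3)[OF a] by (intro add_mono mult_left_mono) auto
          finally show "norm (a + (1 - \<psi> x) *\<^sub>R (u x - a)) \<le> K" by (simp add: algebra_simps)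
        qed
        note g
        also have "(norm (G x))\<^sup>2 + C\<^sup>2 * (norm (u x - a))\<^sup>2 + W (a + (1 - \<psi> x) *\<^sub>R (u x - a)) \<le> (norm (G x))\<^sup>2 + P + W1"
          by (intro add_mono b1 b2 order_refl)
        also have "\<dots> \<le> 2 * e x + (P + W1)" using Ge We by simp
        also have "\<dots> \<le> C1 * e x + C1"
          using const P e_nonneg[of x] by (intro add_mono mult_right_mono) (auto simp: C1_def)
        finally show ?thesis using True by simp
      qed
    qed
    have "emeasure \<mu> (ball 0 (s + 3)) \<le> (\<integral>\<^sup>+x. ennreal (?w x) * indicator (ball 0 (s + 3)) x \<partial>lborel)"
      unfolding emeasure_mu[OF borel_open[OF open_ball]] e_def
      by (rule minimality[OF a \<psi>(1) compact_cball[of 0 "s + 2"] _ \<psi>(2,3,4)]) auto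
    also have "\<dots> \<le> (\<integral>\<^sup>+x. ennreal C1 * (ennreal (e x) * indicator L x) + ennreal C1 * indicator (H \<inter> L) x \<partial>lborel)"
    proof (rule nn_integral_mono)
      fix x :: "real ^ 'n"
      show "ennreal (?w x) * indicator (ball 0 (s + 3)) x \<le> ennreal C1 * (ennreal (e x) * indicator L x) + ennreal C1 * indicator (H \<inter> L) x"
      proof (cases "x \<in> L")
        case True
        have "ennreal (?w x) \<le> ennreal (C1 * e x + C1 * indicator H x)" by (rule ennreal_leI[OF pw])
        also have "\<dots> = ennreal C1 * ennreal (e x) + ennreal C1 * indicator H x"
          using C1 e_nonneg by (auto simp: ennreal_plus ennreal_mult indicator_def)
        finally show ?thesis using True by (auto simp: indicator_def L_def)
      next
        case False
        then show ?thesis using pw0[of x] by (auto simp: L_def indicator_def)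
      qed
    qed
    also have "\<dots> = ennreal C1 * emeasure \<mu> L + ennreal C1 * emeasure lborel (H \<inter> L)"
      by (simp add: nn_integral_add nn_integral_cmult nn_integral_cmult_indicator emeasure_mu)
    also have "\<dots> = ennreal C1 * ennreal (measure \<mu> L) + ennreal C1 * ennreal (vol (H \<inter> L))"
      using emeasure_mu_eq[OF L Lb] emeasure_lborel_eq[of "H \<inter> L"] Lb by (simp add: bounded_Int)
    also have "\<dots> = ennreal (C1 * measure \<mu> L + C1 * vol (H \<inter> L))"
      using C1 by (simp add: ennreal_mult' ennreal_plus)
    finally have "ennreal (E (s + 3)) \<le> ennreal (C1 * measure \<mu> L + C1 * vol (H \<inter> L))"
      by (simp add: E_def emeasure_mu_eq)
    then have "E (s + 3) \<le> C1 * measure \<mu> L + C1 * vol (H \<inter> L)"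
      using C1 by (subst (asm) ennreal_le_iff) (auto intro!: add_nonneg_nonneg mult_nonneg_nonneg)
    moreover have "E s \<le> E (s + 3)" by (rule E_mono) simp
    moreover have "measure \<mu> L = E (s + 3) - E s"
      unfolding L_def E_def
      by (rule measurable_measure_Diff) (auto intro: mu_fmeasurable)
    moreover have "vol (H \<inter> L) = vol (H \<inter> ball 0 (s + 3)) - vol (H \<inter> ball 0 s)"
    proof -
      have eq: "H \<inter> L = (H \<inter> ball 0 (s + 3)) - (H \<inter> ball 0 s)" by (auto simp: L_def)
      have "vol ((H \<inter> ball 0 (s + 3)) - (H \<inter> ball 0 s)) = vol (H \<inter> ball 0 (s + 3)) - vol (H \<inter> ball 0 s)"
      proof (rule measurable_measure_Diff)
        show "H \<inter> ball 0 (s + 3) \<in> fmeasurable lborel" by (rule lborel_fmeasurable) (auto intro: bounded_Int)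
      qed auto
      then show ?thesis by (simp only: eq)
    qed
    ultimately show "E s \<le> C1 * ((E (s + 3) - E s) + (vol (off_phase a \<inter> ball 0 (s + 3)) - vol (off_phase a \<inter> ball 0 s)))"
      unfolding H_def by (simp add: distrib_left)
  qed
qed

section \<open>Halving the radius\<close>

lemma vol_ball: "0 \<le> r \<Longrightarrow> vol (ball c r) = unit_ball_vol (CARD('n)) * r ^ CARD('n)"
  by (simp add: content_ball)

lemma e_indicator_measurable:
  "(\<lambda>x. ennreal (e x) * indicator (ball c r) x) \<in> borel_measurable lborel"
  by (intro borel_measurable_times_ennreal borel_measurable_indicator) auto

text \<open>
  The shell where a phase function varies lies in the region where \<open>W\<close> is bounded below.
\<close>

lemma far_from_all_zeros:
  assumes a: "a \<in> A" and v: "\<delta> \<le> norm (v - a)" "norm (v - a) \<le> 2 * \<delta>" and b: "b \<in> A"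
  shows "\<delta> \<le> norm (v - b)"
proof (cases "b = a")
  case False
  then have "4 * \<delta> \<le> norm (a - b)" using sep[OF a b] by simp
  also have "\<dots> \<le> norm (v - a) + norm (v - b)"
    using norm_triangle_ineq4[of "v - b" "v - a"] by simp
  finally show ?thesis using v const(1) by linarith
qed (use v in simp)

text \<open>
  The nonlocal Poincare inequality for the phase function of \<open>a\<close>. The integrand on its right-hand side is
  controlled by the energy density: where it is nonzero, \<open>W (u x) \<ge> c0\<close>, and
  \<open>norm (G x) \<le> (norm (G x))\<^sup>2 / 2 + 1 / 2\<close>.
\<close>

lemma off_phase_volume_estimate:
  "\<exists>C>0. \<forall>a\<in>A. \<forall>R. \<forall>l>0. \<forall>X\<in>sets borel. \<forall>\<theta>\<ge>0. X \<subseteq> off_phase a \<inter> ball 0 R \<longrightarrow>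
     (\<forall>x\<in>X. \<theta> \<le> vol (phase_set a \<inter> ball 0 R \<inter> ball x l)) \<longrightarrow>
     \<theta> * vol X \<le> l * vol (ball 0 l) * (C * E R)"
proof -
  obtain Q where Q: "0 < Q" "\<forall>a :: real ^ 'm. \<exists>\<Phi>. phase_function a \<delta> Q \<Phi>"
    using phase_function_exists[OF const(1)] by blast
  define C where "C = Q * (1 + 1 / c0)"
  have C: "0 < C" using const Q(1) by (simp add: C_def add_pos_pos)
  show ?thesis
  proof (intro exI[of _ C] conjI C ballI allI impI)
    fix a R l \<theta> :: real and X
    fix a assume a: "a \<in> A"
    assume l: "0 < l" and X: "X \<in> sets borel" and \<theta>0: "0 \<le> \<theta>" and XH: "X \<subseteq> off_phase a \<inter> ball 0 R"
      and \<theta>: "\<forall>x\<in>X. \<theta> \<le> vol (phase_set a \<inter> ball 0 R \<inter> ball x l)"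
    have XR: "X \<subseteq> ball 0 R" using XH by blast
    obtain \<Phi> where pf: "phase_function a \<delta> Q \<Phi>" using Q(2) by blast
    note ph = phase_functionD[OF pf]
    have pw: "norm (grad \<Phi> (u x)) * norm (G x) \<le> C * e x" for x
    proof (cases "grad \<Phi> (u x) = 0")
      case True
      then show ?thesis using C e_nonneg by simp
    next
      case False
      then have between: "\<delta> \<le> norm (u x - a)" "norm (u x - a) \<le> 2 * \<delta>" using ph(7)[of "u x"] by auto
      have far: "c0 \<le> W (u x)" by (rule away[OF bnd(1) far_from_all_zeros[OF a between]])
      \<comment> \<open>Young's inequality in the form 2 t \<le> t^2 + 1\<close>
      have "0 \<le> (norm (G x) - 1)\<^sup>2" by simp
      then have "norm (G x) \<le> 1 / 2 * (norm (G x))\<^sup>2 + 1 / 2" by (simp add: power2_diff)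
      also have "\<dots> \<le> e x + e x / c0"
      proof -
        have "1 \<le> W (u x) / c0" using far const by simp
        also have "\<dots> \<le> e x / c0" using const by (intro divide_right_mono) (auto simp: e_def)
        finally have "1 \<le> e x / c0" .
        moreover have "1 / 2 * (norm (G x))\<^sup>2 \<le> e x" by (simp add: e_def W(2))
        ultimately show ?thesis by linarith
      qed
      finally have "norm (G x) \<le> (1 + 1 / c0) * e x" by (simp add: algebra_simps)
      then have "norm (grad \<Phi> (u x)) * norm (G x) \<le> Q * ((1 + 1 / c0) * e x)"
        using ph(2) Q(1) by (intro mult_mono) auto
      then show ?thesis by (simp only: C_def mult.assoc)
    qed
    have "ennreal \<theta> * emeasure lborel X \<le> ennreal l * emeasure lborel (ball (0 :: real ^ 'n) l) *
       (\<integral>\<^sup>+x. indicator (ball 0 R) x * ennreal (norm (grad \<Phi> (u x)) * norm (G x)) \<partial>lborel)"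
    proof (rule nonlocal_poincare[OF sa meas ph(1-4) convex_ball open_ball bounded_ball l X XR])
      show "\<Phi> (u x) = 1" if "x \<in> X" for x using XH that ph(6) by (auto simp: off_phase_def)
      fix x assume x: "x \<in> X"
      have [measurable]: "\<Phi> \<in> borel_measurable borel" by (rule smooth_borel[OF ph(1)])
      have "ennreal \<theta> \<le> ennreal (vol (phase_set a \<inter> ball 0 R \<inter> ball x l))" using \<theta> x by (simp add: ennreal_leI)
      also have "\<dots> = emeasure lborel (phase_set a \<inter> ball 0 R \<inter> ball x l)"
        by (rule emeasure_lborel_eq[symmetric]) (auto intro: bounded_Int)
      also have "\<dots> \<le> emeasure lborel {y \<in> ball 0 R. dist x y < l \<and> \<Phi> (u y) = 0}"
        by (rule emeasure_mono) (use ph(5) in \<open>auto simp: phase_set_def\<close>)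
      finally show "ennreal \<theta> \<le> emeasure lborel {y \<in> ball 0 R. dist x y < l \<and> \<Phi> (u y) = 0}" .
    qed
    also have "(\<integral>\<^sup>+x. indicator (ball 0 R) x * ennreal (norm (grad \<Phi> (u x)) * norm (G x)) \<partial>lborel) \<le>
       (\<integral>\<^sup>+x. ennreal C * (ennreal (e x) * indicator (ball 0 R) x) \<partial>lborel)"
    proof (rule nn_integral_mono)
      fix x :: "real ^ 'n"
      have "ennreal (norm (grad \<Phi> (u x)) * norm (G x)) \<le> ennreal C * ennreal (e x)"
        using ennreal_leI[OF pw[of x]] C by (simp add: ennreal_mult')
      then show "indicator (ball 0 R) x * ennreal (norm (grad \<Phi> (u x)) * norm (G x)) \<le> ennreal C * (ennreal (e x) * indicator (ball 0 R) x)"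
        by (auto simp: indicator_def)
    qed
    also have "\<dots> = ennreal C * ennreal (E R)"
      by (simp add: nn_integral_cmult[OF e_indicator_measurable] emeasure_mu[symmetric] emeasure_mu_eq E_def)
    finally have "ennreal \<theta> * emeasure lborel X \<le> ennreal l * emeasure lborel (ball (0 :: real ^ 'n) l) * (ennreal C * ennreal (E R))"
      by (auto simp: mult_left_mono)
    moreover have "emeasure lborel X = ennreal (vol X)"
      by (rule emeasure_lborel_eq[OF X bounded_subset[OF bounded_ball XR]])
    moreover have "emeasure lborel (ball (0 :: real ^ 'n) l) = ennreal (vol (ball 0 l))"
      by (rule emeasure_lborel_eq) auto
    ultimately have "ennreal \<theta> * ennreal (vol X) \<le> ennreal l * ennreal (vol (ball 0 l)) * (ennreal C * ennreal (E R))"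
      by (simp only:)
    then have "ennreal (\<theta> * vol X) \<le> ennreal (l * vol (ball 0 l) * (C * E R))"
      using l C \<theta>0 E_nonneg[of R] by (simp add: ennreal_mult)
    then show "\<theta> * vol X \<le> l * vol (ball 0 l) * (C * E R)"
      using l C E_nonneg by (subst (asm) ennreal_le_iff) (auto intro!: mult_nonneg_nonneg)
  qed
qed

lemma transition_volume: "vol (transition R) \<le> E R / c0"
proof -
  have "ennreal c0 * emeasure lborel (transition R) = (\<integral>\<^sup>+x. ennreal c0 * indicator (transition R) x \<partial>lborel)"
    by (simp add: nn_integral_cmult_indicator)
  also have "\<dots> \<le> (\<integral>\<^sup>+x. ennreal (e x) * indicator (ball 0 R) x \<partial>lborel)"
  proof (rule nn_integral_mono)
    fix x :: "real ^ 'n"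
    show "ennreal c0 * indicator (transition R) x \<le> ennreal (e x) * indicator (ball 0 R) x"
    proof (cases "x \<in> transition R")
      case True
      then have "c0 \<le> W (u x)" by (intro away bnd) (auto simp: transition_def)
      then have "c0 \<le> e x" by (simp add: e_def add_increasing)
      then show ?thesis using True by (simp add: ennreal_leI transition_def)
    qed simp
  qed
  also have "\<dots> = ennreal (E R)" by (simp add: E_def emeasure_mu[symmetric] emeasure_mu_eq)
  finally have "ennreal (c0 * vol (transition R)) \<le> ennreal (E R)"
    using transition_bounded const by (simp add: emeasure_lborel_eq ennreal_mult')
  then have "c0 * vol (transition R) \<le> E R" using E_nonneg by (subst (asm) ennreal_le_iff) auto
  then show ?thesis using const by (simp add: le_divide_eq mult.commute)
qed

text \<open>
  The phase sets and the transition set cover the ball.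
\<close>

lemma dominant_phase_exists:
  assumes T: "2 * vol (transition R) \<le> vol (ball 0 R)"
  shows "\<exists>a\<in>A. vol (ball 0 R) / (2 * real (card A)) \<le> vol (phase_set a \<inter> ball 0 R)"
proof (rule ccontr)
  assume "\<not> ?thesis"
  then have lt: "\<And>a. a \<in> A \<Longrightarrow> vol (phase_set a \<inter> ball 0 R) < vol (ball 0 R) / (2 * real (card A))" by (meson not_le)
  let ?U = "\<Union>a\<in>A. phase_set a \<inter> ball 0 R"
  have U: "?U \<in> sets borel" by (intro sets.finite_UN A(1) sets.Int phase_set_borel) auto
  then have TU: "transition R \<union> ?U \<in> sets borel" by (intro sets.Un transition_borel)
  have "ball 0 R \<subseteq> transition R \<union> ?U"
  proof
    fix x :: "real ^ 'n" assume x: "x \<in> ball 0 R"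
    show "x \<in> transition R \<union> ?U"
    proof (cases "\<exists>a\<in>A. norm (u x - a) \<le> \<delta>")
      case False
      then have "\<forall>a\<in>A. \<delta> \<le> norm (u x - a)" by force
      then show ?thesis using x unfolding transition_def by blast
    qed (use x in \<open>unfold phase_set_def, blast\<close>)
  qed
  moreover have "bounded (transition R \<union> ?U)"
    by (rule bounded_subset[OF bounded_ball[of 0 R]]) (auto simp: transition_def)
  ultimately have "vol (ball 0 R) \<le> vol (transition R \<union> ?U)"
    using TU by (intro measure_mono_fmeasurable lborel_fmeasurable) auto
  also have "\<dots> \<le> vol (transition R) + vol ?U"
    by (rule measure_Un_le) (use U in \<open>simp_all only: sets_lborel transition_borel\<close>)
  also have "\<dots> \<le> vol (transition R) + (\<Sum>a\<in>A. vol (phase_set a \<inter> ball 0 R))"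
    using A by (intro add_left_mono measure_UNION_le) auto
  also have "\<dots> < vol (ball 0 R) / 2 + (\<Sum>a\<in>A. vol (ball 0 R) / (2 * real (card A)))"
    using T A lt by (intro add_le_less_mono sum_strict_mono) auto
  also have "(\<Sum>a\<in>A. vol (ball 0 R) / (2 * real (card A))) = vol (ball 0 R) / 2"
    using A by (simp add: card_gt_0_iff)
  finally show False by simp
qed

text \<open>
  What is missing from the phase set of \<open>a\<close> in a small ball is contained in the two sets that are
  assumed to be small in the big ball.
\<close>

lemma phase_set_in_small_ball:
  assumes a: "a \<in> A" and x: "x \<in> ball 0 (R - l)" and small: "vol (off_phase a \<inter> ball 0 R) + vol (transition R) \<le> vol (ball x l) / 2"
  shows "vol (ball x l) / 2 \<le> vol (phase_set a \<inter> ball 0 R \<inter> ball x l)"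
proof -
  let ?Y = "phase_set a \<inter> ball 0 R \<inter> ball x l" and ?H = "off_phase a \<inter> ball 0 R"
  have "ball x l \<subseteq> ?Y \<union> (?H \<union> transition R)"
  proof
    fix y assume y: "y \<in> ball x l"
    then have yR: "y \<in> ball 0 R" using x dist_triangle[of 0 y x] by simp
    show "y \<in> ?Y \<union> (?H \<union> transition R)"
    proof (cases "y \<in> off_phase a \<or> y \<in> phase_set a")
      case False
      then have "\<delta> \<le> norm (u y - a)" "norm (u y - a) \<le> 2 * \<delta>" by (auto simp: off_phase_def phase_set_def)
      then have "y \<in> transition R" using far_from_all_zeros[OF a] yR by (auto simp: transition_def)
      then show ?thesis by blast
    qed (use y yR in blast)
  qed
  then have "vol (ball x l) \<le> vol (?Y \<union> (?H \<union> transition R))"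
    using transition_bounded by (intro measure_mono_fmeasurable lborel_fmeasurable) (auto intro!: bounded_Int)
  also have "\<dots> \<le> vol ?Y + vol (?H \<union> transition R)" by (intro measure_Un_le) auto
  also have "vol (?H \<union> transition R) \<le> vol ?H + vol (transition R)" by (intro measure_Un_le) auto
  finally show ?thesis using small by simp
qed

text \<open>
  The order of choice of the constants matters: first \<open>\<gamma>\<close>, which makes the improved volume bound harmless,
  then \<open>\<epsilon>\<close>, so small that the crude volume bound stays below half the volume of a ball of radius
  \<open>\<gamma> * R\<close>, and finally the lower limit for \<open>R\<close>, which makes the share of one layer in the energy small.
\<close>

lemma energy_halving:
  "\<exists>\<epsilon>>0. \<exists>Rm\<ge>1. \<forall>R\<ge>Rm. E R \<le> \<epsilon> * R ^ (CARD('n) - 1) \<longrightarrow> E (R / 2) \<le> (1 / 2) ^ CARD('n) * E R"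
proof -
  define n where "n = CARD('n)"
  define \<omega> where "\<omega> = unit_ball_vol n"
  have pn: "x ^ n = x * x ^ (n - 1)" for x :: real
    unfolding n_def by (rule power_eq_if[THEN trans]) simp
  have \<omega>: "0 < \<omega>" by (simp add: \<omega>_def)
  have vb: "vol (ball c r) = \<omega> * r ^ n" if "0 \<le> r" for c r
    using vol_ball[OF that] by (simp add: \<omega>_def n_def)
  obtain C1 where C1: "0 < C1" and comp0: "\<forall>s>0. \<forall>a\<in>A. E s \<le> C1 * ((E (s + 3) - E s) +
     (vol (off_phase a \<inter> ball 0 (s + 3)) - vol (off_phase a \<inter> ball 0 s)))"
    using competitor_estimate by (elim exE conjE)
  note comp = comp0[THEN spec, THEN mp, THEN bspec]
  obtain C2 where C2: "0 < C2" and est0: "\<forall>a\<in>A. \<forall>R. \<forall>l>0. \<forall>X\<in>sets borel. \<forall>\<theta>\<ge>0. X \<subseteq> off_phase a \<inter> ball 0 R \<longrightarrow>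
     (\<forall>x\<in>X. \<theta> \<le> vol (phase_set a \<inter> ball 0 R \<inter> ball x l)) \<longrightarrow>
     \<theta> * vol X \<le> l * vol (ball 0 l) * (C2 * E R)"
    using off_phase_volume_estimate by (elim exE conjE)
  note est = est0[THEN bspec, THEN spec, THEN spec, THEN mp, THEN bspec, THEN spec, THEN mp, THEN mp, THEN mp]
  define N where "N = real (card A)"
  have N: "0 < N" using A by (simp add: N_def card_gt_0_iff)
  define C3 where "C3 = 4 * N * 2 ^ n * C2"
  have C3: "0 < C3" using N C2 by (simp add: C3_def)
  \<comment> \<open>\<gamma> \<le> 1 / 4 keeps the layers between R / 2 and 3 R / 4 inside the ball of radius R - \<gamma> R\<close>
  define \<gamma> where "\<gamma> = min (1 / 4) (1 / (96 * C1 * C2 * 2 ^ n))"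
  have \<gamma>: "0 < \<gamma>" "\<gamma> \<le> 1 / 4" "96 * C1 * C2 * 2 ^ n * \<gamma> \<le> 1"
    using C1 C2 by (auto simp: \<gamma>_def min_def field_simps)
  define P where "P = C3 + 1 / c0"
  have P: "0 < P" using C3 const by (simp add: P_def add_pos_pos)
  \<comment> \<open>the first bound yields a dominant phase, the second one its dominance in all balls of radius \<gamma> R\<close>
  define \<epsilon> where "\<epsilon> = min (\<omega> * c0 / 2) (\<omega> * \<gamma> ^ n / (2 * P))"
  have \<epsilon>: "0 < \<epsilon>" using \<omega> const \<gamma> P by (auto simp: \<epsilon>_def intro!: divide_pos_pos mult_pos_pos)
  have \<epsilon>1: "\<epsilon> \<le> \<omega> * c0 / 2" and \<epsilon>2: "\<epsilon> \<le> \<omega> * \<gamma> ^ n / (2 * P)"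
    by (simp_all only: \<epsilon>_def min.cobounded1 min.cobounded2)
  define Rm where "Rm = max 24 (48 * C1 * 2 ^ n)"
  show ?thesis
  proof (rule exI[of _ \<epsilon>], intro conjI \<epsilon>, rule exI[of _ Rm], intro conjI allI impI)
    show "1 \<le> Rm" by (simp add: Rm_def)
    fix R assume R: "Rm \<le> R" and "E R \<le> \<epsilon> * R ^ (CARD('n) - 1)"
    then have small: "E R \<le> \<epsilon> * R ^ (n - 1)" by (simp add: n_def)
    have R24: "24 \<le> R" and RC: "48 * C1 * 2 ^ n \<le> R" using R by (auto simp: Rm_def)
    have ER: "R * E R \<le> \<epsilon> * R ^ n"
      using mult_left_mono[OF small, of R] R24 by (simp add: pn[of R] mult.left_commute)
    have "1 * E R \<le> R * E R" using R24 E_nonneg by (intro mult_right_mono) auto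
    then have EER: "E R \<le> R * E R" by simp
    have "E R / c0 \<le> \<epsilon> * R ^ n / c0" using EER ER const by (intro divide_right_mono) auto
    also have "\<dots> \<le> (\<omega> * c0 / 2) * R ^ n / c0"
      using const R24 \<epsilon>1 by (intro divide_right_mono mult_right_mono) auto
    also have "\<dots> = \<omega> * R ^ n / 2" using const by simp
    finally have "E R / c0 \<le> \<omega> * R ^ n / 2" .
    then have "2 * vol (transition R) \<le> vol (ball 0 R)"
      unfolding vb[of R 0, OF order_trans[OF _ R24], simplified] using transition_volume[of R] by linarith
    then obtain a where a: "a \<in> A" and maj: "\<omega> * R ^ n / (2 * N) \<le> vol (phase_set a \<inter> ball 0 R)"
      using dominant_phase_exists[of R] vb[of R 0] R24 by (auto simp: N_def)
    \<comment> \<open>first pass, with pairs of points at arbitrary distance in the ball\<close>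
    have HR: "vol (off_phase a \<inter> ball 0 R) \<le> C3 * (R * E R)"
    proof -
      have "(\<omega> * R ^ n / (2 * N)) * vol (off_phase a \<inter> ball 0 R) \<le> (2 * R) * vol (ball 0 (2 * R)) * (C2 * E R)"
      proof (rule est[OF a])
        show "\<forall>x\<in>off_phase a \<inter> ball 0 R. \<omega> * R ^ n / (2 * N) \<le> vol (phase_set a \<inter> ball 0 R \<inter> ball x (2 * R))"
        proof
          fix x assume x: "x \<in> off_phase a \<inter> ball 0 R"
          have "y \<in> ball x (2 * R)" if "y \<in> ball 0 R" for y
            using x that dist_triangle[of x y 0] by (simp add: dist_commute)
          then have "ball 0 R \<inter> ball x (2 * R) = ball 0 R" by blast
          then show "\<omega> * R ^ n / (2 * N) \<le> vol (phase_set a \<inter> ball 0 R \<inter> ball x (2 * R))"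
            using maj by (simp add: Int_assoc)
        qed
      qed (use R24 \<omega> N in auto)
      also have "\<dots> = (\<omega> * R ^ n / (2 * N)) * (C3 * (R * E R))"
        using vb[of "2 * R" 0] R24 N by (simp add: C3_def power_mult_distrib)
      finally show ?thesis using \<omega> R24 N by (subst (asm) mult_le_cancel_left_pos) auto
    qed
    define l where "l = \<gamma> * R"
    have l: "0 < l" "l \<le> R / 4" using \<gamma> R24 by (auto simp: l_def)
    have local: "vol (off_phase a \<inter> ball 0 R) + vol (transition R) \<le> \<omega> * l ^ n / 2"
    proof -
      have "E R / c0 \<le> (R * E R) / c0" using EER const by (intro divide_right_mono) auto
      then have "vol (off_phase a \<inter> ball 0 R) + vol (transition R) \<le> C3 * (R * E R) + (R * E R) / c0"
        using HR transition_volume[of R] by linarith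
      also have "\<dots> = P * (R * E R)" by (simp add: P_def algebra_simps)
      also have "\<dots> \<le> P * (\<epsilon> * R ^ n)" using ER P by (intro mult_left_mono) auto
      also have "\<dots> \<le> P * ((\<omega> * \<gamma> ^ n / (2 * P)) * R ^ n)"
        using P R24 \<epsilon>2 by (intro mult_left_mono mult_right_mono) auto
      also have "\<dots> = \<omega> * l ^ n / 2" using P by (simp add: l_def power_mult_distrib)
      finally show ?thesis .
    qed
    \<comment> \<open>second pass, with pairs of points at distance less than \<gamma> R\<close>
    have HX: "vol (off_phase a \<inter> ball 0 (R - l)) \<le> 2 * \<gamma> * R * (C2 * E R)"
    proof -
      have "(\<omega> * l ^ n / 2) * vol (off_phase a \<inter> ball 0 (R - l)) \<le> l * vol (ball 0 l) * (C2 * E R)"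
      proof (rule est[OF a])
        show "\<forall>x\<in>off_phase a \<inter> ball 0 (R - l). \<omega> * l ^ n / 2 \<le> vol (phase_set a \<inter> ball 0 R \<inter> ball x l)"
          using phase_set_in_small_ball[OF a, of _ R l] local vb[of l] l by simp
      qed (use R24 \<omega> l in auto)
      also have "\<dots> = (\<omega> * l ^ n / 2) * (2 * \<gamma> * R * (C2 * E R))"
        using vb[of l 0] l by (simp add: l_def)
      finally show ?thesis using \<omega> l by (subst (asm) mult_le_cancel_left_pos) auto
    qed
    \<comment> \<open>the number of layers of thickness 3 that fit between R / 2 and 3 R / 4\<close>
    define m where "m = nat \<lfloor>R / 12\<rfloor>"
    have m: "R / 24 \<le> real m" "real m \<le> R / 12" "0 < m"
    proof -
      have "real m = of_int \<lfloor>R / 12\<rfloor>" using R24 by (simp add: m_def)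
      then show "real m \<le> R / 12" and *: "R / 24 \<le> real m" using R24 by linarith+
      show "0 < m" using * R24 by linarith
    qed
    define F where "F r = E r + vol (off_phase a \<inter> ball 0 r)" for r
    define s where "s i = R / 2 + 3 * real i" for i
    \<comment> \<open>the cheapest layer, found by telescoping\<close>
    obtain i where i: "i < m" "F (s (Suc i)) - F (s i) \<le> (F (s m) - F (s 0)) / real m"
      using small_telescoping_step[OF m(3), of "\<lambda>i. F (s i)"] by blast
    have s: "s (Suc i) = s i + 3" "R / 2 \<le> s i" "s m \<le> R - l" using m l by (auto simp: s_def)
    have "F (s m) \<le> E R + 2 * \<gamma> * R * (C2 * E R)"
    proof -
      have "E (s m) \<le> E R" using s l by (intro E_mono) auto
      moreover have "vol (off_phase a \<inter> ball 0 (s m)) \<le> vol (off_phase a \<inter> ball 0 (R - l))"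
        using s(3) by (intro measure_mono_fmeasurable lborel_fmeasurable) (auto intro!: bounded_Int)
      ultimately show ?thesis using HX by (simp add: F_def)
    qed
    moreover have "0 \<le> F (s 0)" by (simp add: F_def E_nonneg)
    ultimately have "F (s m) - F (s 0) \<le> E R + 2 * \<gamma> * R * (C2 * E R)" by simp
    then have "(F (s m) - F (s 0)) / real m \<le> (E R + 2 * \<gamma> * R * (C2 * E R)) / real m"
      by (intro divide_right_mono) auto
    also have "\<dots> \<le> (E R + 2 * \<gamma> * R * (C2 * E R)) / (R / 24)"
      using m R24 \<gamma> C2 E_nonneg[of R] by (intro divide_left_mono add_nonneg_nonneg mult_nonneg_nonneg) auto
    finally have Fi: "F (s (Suc i)) - F (s i) \<le> (E R + 2 * \<gamma> * R * (C2 * E R)) / (R / 24)" using i(2) by simp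
    have "E (R / 2) \<le> E (s i)" by (rule E_mono[OF s(2)])
    also have "\<dots> \<le> C1 * (F (s (Suc i)) - F (s i))"
    proof -
      have "0 < s i" using s(2) R24 by linarith
      from comp[OF this a] show ?thesis by (simp add: F_def s(1) algebra_simps)
    qed
    also have "\<dots> \<le> C1 * ((E R + 2 * \<gamma> * R * (C2 * E R)) / (R / 24))" using Fi C1 by (intro mult_left_mono) auto
    also have "\<dots> = (24 * C1 / R + 48 * C1 * C2 * \<gamma>) * E R" using R24 by (simp add: field_simps)
    also have "\<dots> \<le> (1 / 2) ^ n * E R"
    proof (rule mult_right_mono[OF _ E_nonneg])
      have "24 * C1 / R \<le> (1 / 2) ^ n / 2" using RC R24 by (simp add: power_divide field_simps)
      moreover have "48 * C1 * C2 * \<gamma> \<le> (1 / 2) ^ n / 2" using \<gamma>(3) by (simp add: power_divide field_simps)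
      ultimately show "24 * C1 / R + 48 * C1 * C2 * \<gamma> \<le> (1 / 2) ^ n" by linarith
    qed
    finally show "E (R / 2) \<le> (1 / 2) ^ CARD('n) * E R" by (simp add: n_def)
  qed
qed

text \<open>
  If the lower bound fails at arbitrarily large radii, halving can be iterated from such a radius \<open>R\<close> down to
  scale \<open>r\<close>. The result decays like \<open>1 / R\<close> for fixed \<open>r\<close>, because each step gains \<open>2 ^ n\<close> while the threshold
  loses only \<open>2 ^ (n - 1)\<close>.
\<close>

lemma energy_dichotomy:
  "\<exists>\<epsilon>>0. (\<exists>R0. \<forall>R\<ge>R0. \<epsilon> * R ^ (CARD('n) - 1) \<le> E R) \<or> (\<forall>r. E r = 0)"
proof -
  define n where "n = CARD('n)"
  have n: "1 \<le> n" by (simp add: n_def Suc_leI)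
  have pn: "x ^ n = x * x ^ (n - 1)" for x :: real using n by (cases n) auto
  obtain \<epsilon> Rm where \<epsilon>: "0 < \<epsilon>" and Rm: "1 \<le> Rm" and half: "\<And>R. Rm \<le> R \<Longrightarrow> E R \<le> \<epsilon> * R ^ (n - 1) \<Longrightarrow> E (R / 2) \<le> (1 / 2) ^ n * E R"
    using energy_halving unfolding n_def by blast
  have "\<forall>r. E r = 0" if no: "\<not> (\<exists>R0. \<forall>R\<ge>R0. \<epsilon> * R ^ (n - 1) \<le> E R)"
  proof -
    have iter: "Rm \<le> R / 2 ^ k \<Longrightarrow> E (R / 2 ^ k) \<le> ((1 / 2) ^ n) ^ k * E R" if R: "0 < R" "E R \<le> \<epsilon> * R ^ (n - 1)" for R k
    proof (induction k)
      case (Suc k)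
      have ge: "Rm \<le> R / 2 ^ k"
      proof -
        have "R / 2 ^ Suc k \<le> R / 2 ^ k" using R by (simp add: field_simps)
        then show ?thesis using Suc.prems by linarith
      qed
      then have IH: "E (R / 2 ^ k) \<le> ((1 / 2) ^ n) ^ k * E R" by (rule Suc.IH)
      also have "\<dots> \<le> ((1 / 2) ^ n) ^ k * (\<epsilon> * R ^ (n - 1))" using R by (intro mult_left_mono) auto
      also have "\<dots> \<le> ((1 / 2) ^ (n - 1)) ^ k * (\<epsilon> * R ^ (n - 1))"
        using \<epsilon> R by (intro mult_right_mono power_mono power_decreasing) auto
      also have "\<dots> = \<epsilon> * (R / 2 ^ k) ^ (n - 1)"
        by (simp add: power_divide mult.commute flip: power_mult)
      finally have "E (R / 2 ^ k / 2) \<le> (1 / 2) ^ n * E (R / 2 ^ k)" by (rule half[OF ge])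
      also have "\<dots> \<le> (1 / 2) ^ n * (((1 / 2) ^ n) ^ k * E R)" using IH by (intro mult_left_mono) auto
      finally show ?case by (simp add: mult_ac)
    qed simp
    have "E r \<le> 0" if r: "Rm \<le> r" for r
    proof (rule field_le_epsilon)
      fix \<eta> :: real assume \<eta>: "0 < \<eta>"
      have r0: "0 < r" using r Rm by linarith
      \<comment> \<open>R so large that the iterated bound falls below \<eta>\<close>
      obtain R where R: "max r (\<epsilon> * (2 * r) ^ n / \<eta>) \<le> R" "E R < \<epsilon> * R ^ (n - 1)"
        using no by (meson not_le)
      have R0: "0 < R" "r \<le> R" using R r0 by auto
      obtain k where k: "r \<le> R / 2 ^ k" "R / 2 ^ k < 2 * r" using dyadic_scale[OF r0 R0(2)] by blast
      have "E r \<le> E (R / 2 ^ k)" by (rule E_mono[OF k(1)])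
      also have "\<dots> \<le> ((1 / 2) ^ n) ^ k * E R" by (rule iter) (use R R0 k r in auto)
      also have "\<dots> \<le> ((1 / 2) ^ n) ^ k * (\<epsilon> * R ^ (n - 1))" using R by (intro mult_left_mono) auto
      also have "\<dots> = \<epsilon> * (R / 2 ^ k) ^ n / R"
      proof -
        have "(R / 2 ^ k) ^ n = ((1 / 2) ^ n) ^ k * (R * R ^ (n - 1))"
          by (simp add: power_divide pn[of R] mult.commute flip: power_mult)
        then show ?thesis using R0 by simp
      qed
      also have "\<dots> \<le> \<epsilon> * (2 * r) ^ n / R"
        using \<epsilon> R0 k r0 by (intro divide_right_mono mult_left_mono power_mono) auto
      also have "\<dots> \<le> \<eta>" using R(1) R0 \<eta> by (simp add: field_simps)
      finally show "E r \<le> 0 + \<eta>" by simp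
    qed
    then have z: "E r \<le> 0" if "Rm \<le> r" for r using that by blast
    show ?thesis
    proof
      fix r
      have "E r \<le> E (max r Rm)" by (rule E_mono) simp
      then show "E r = 0" using z[of "max r Rm"] E_nonneg[of r] by simp
    qed
  qed
  then show ?thesis using \<epsilon> unfolding n_def by blast
qed

lemma zero_energy_imp_gradient_zero:
  assumes "\<And>r. E r = 0"
  shows "AE x in lborel. G x = 0"
proof -
  have "AE x in lborel. \<forall>k::nat. x \<in> ball 0 (real k) \<longrightarrow> e x = 0"
  proof (subst AE_all_countable, rule allI)
    fix k :: nat
    have "emeasure \<mu> (ball 0 (real k)) = 0" using assms[of "real k"] by (simp add: E_def emeasure_mu_eq)
    then have "(\<integral>\<^sup>+x. ennreal (e x) * indicator (ball 0 (real k)) x \<partial>lborel) = 0" by (simp add: emeasure_mu)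
    then have "AE x in lborel. ennreal (e x) * indicator (ball 0 (real k)) x = 0"
      by (simp add: nn_integral_0_iff_AE[OF e_indicator_measurable])
    then show "AE x in lborel. x \<in> ball 0 (real k) \<longrightarrow> e x = 0"
      by eventually_elim (use e_nonneg in \<open>auto simp: indicator_def ennreal_eq_0_iff split: if_splits intro: antisym\<close>)
  qed
  then show ?thesis
  proof eventually_elim
    case (elim x)
    obtain k :: nat where "norm x < real k" using reals_Archimedean2 by blast
    then have "e x = 0" using elim by auto
    then have "1 / 2 * (norm (G x))\<^sup>2 = 0"
      unfolding e_def using W(2)[of "u x"] zero_le_power2[of "norm (G x)"] by linarith
    then show ?case by simp
  qed
qed

end

section \<open>The lower bound\<close>

lemma L1_loc_on_UNIV_measurable:
  fixes f :: "'a::euclidean_space \<Rightarrow> 'b::euclidean_space"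
  assumes "L1_loc_on UNIV f" shows "f \<in> borel_measurable lebesgue"
proof (rule borel_measurable_LIMSEQ_metric)
  fix k :: nat
  have "f absolutely_integrable_on cball 0 (real k)" using assms by (simp add: L1_loc_on_def)
  then show "(\<lambda>x. indicat_real (cball 0 (real k)) x *\<^sub>R f x) \<in> borel_measurable lebesgue"
    unfolding set_integrable_def by (rule borel_measurable_integrable)
next
  fix x :: 'a
  obtain k0 :: nat where "norm x \<le> real k0" using real_arch_simple by blast
  then have "\<forall>\<^sub>F k in sequentially. indicat_real (cball 0 (real k)) x *\<^sub>R f x = f x"
    unfolding eventually_sequentially by (intro exI[of _ k0]) auto
  then show "(\<lambda>k. indicat_real (cball 0 (real k)) x *\<^sub>R f x) \<longlonglongrightarrow> f x"
    by (rule tendsto_eventually)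
qed

text \<open>
  Redefining the function by 0 where a Borel representative exceeds the essential bound changes it on a
  null set only.
\<close>

lemma bounded_borel_version:
  fixes f :: "'a::euclidean_space \<Rightarrow> 'b::euclidean_space"
  assumes f: "f \<in> borel_measurable lebesgue" "AE x in lebesgue. norm (f x) \<le> K" and K: "0 \<le> K"
  shows "\<exists>g\<in>borel_measurable borel. (\<forall>x. norm (g x) \<le> K) \<and> (AE x in lebesgue. f x = g x)"
proof -
  have "\<exists>g\<in>borel_measurable lborel. AE x in lborel. f x \<bullet> b = g x" for b
    by (rule completion_ex_borel_measurable_real) (use f(1) in measurable)
  then obtain h where h: "\<And>b. h b \<in> borel_measurable lborel" "\<And>b. AE x in lborel. f x \<bullet> b = h b x"
    by metis
  define g where "g x = (\<Sum>b\<in>Basis. h b x *\<^sub>R b)" for x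
  have hm[measurable]: "h b \<in> borel_measurable borel" for b using h(1)[of b] by simp
  have g[measurable]: "g \<in> borel_measurable borel" unfolding g_def by measurable
  have "AE x in lborel. \<forall>b\<in>Basis. f x \<bullet> b = h b x"
    by (rule AE_finite_allI) (use h(2) in auto)
  then have "AE x in lborel. f x = g x"
  proof eventually_elim
    case (elim x)
    then have "g x = (\<Sum>b\<in>Basis. (f x \<bullet> b) *\<^sub>R b)" unfolding g_def by (intro sum.cong) auto
    then show ?case by (simp add: euclidean_representation)
  qed
  then have fg: "AE x in lebesgue. f x = g x" by (rule AE_completion)
  define g' where "g' x = (if norm (g x) \<le> K then g x else 0)" for x
  show ?thesis
  proof (intro bexI[of _ g'] conjI allI)
    show "norm (g' x) \<le> K" for x using K by (simp add: g'_def)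
    show "AE x in lebesgue. f x = g' x" using fg f(2) by eventually_elim (auto simp: g'_def)
    show "g' \<in> borel_measurable borel" unfolding g'_def by measurable
  qed
qed

text \<open>
  The mollifications have zero gradient, hence are constant, and they converge almost everywhere.
\<close>

lemma zero_weak_gradient_imp_constant:
  fixes u :: "real ^ 'n \<Rightarrow> real ^ 'm"
  assumes wg: "is_weak_gradient UNIV u G" and u: "AE x in lebesgue. norm (u x) \<le> K" and G: "AE x in lebesgue. G x = 0"
  shows "\<exists>c. AE x in lebesgue. u x = c"
proof -
  have "AE x in lebesgue. norm (G x) \<le> 0" using G by eventually_elim simp
  then obtain us Ds where sa: "smooth_approx us Ds K 0 u G"
    by (rule smooth_approximation[OF wg u])
  note ap = smooth_approxD[OF sa]
  have const: "us k x = us k 0" for k x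
  proof -
    have "Ds k y = 0" for y using ap(5)[of k y] by simp
    then have "(us k has_derivative (\<lambda>h. 0)) (at y within UNIV)" for y using ap(2)[of k y] by simp
    then obtain c where "\<And>y. y \<in> UNIV \<Longrightarrow> us k y = c"
      using has_derivative_zero_constant[OF convex_UNIV, of "us k"] by blast
    then show ?thesis by simp
  qed
  have "AE x in lebesgue. u x = lim (\<lambda>k. us k 0)"
    using ap(6)
  proof eventually_elim
    case (elim x)
    have "(\<lambda>k. us k x) = (\<lambda>k. us k 0)" using const by blast
    with elim have "(\<lambda>k. us k 0) \<longlonglongrightarrow> u x" by simp
    then show ?case by (simp add: limI)
  qed
  then show ?thesis by blast
qed

text \<open>
  The energy only depends on the classes of \<open>u\<close> and its weak gradient modulo null sets, so it can be
  computed with Borel representatives.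
\<close>

lemma energy_eq_lborel:
  fixes u :: "real ^ 'n \<Rightarrow> real ^ 'm"
  assumes "open \<Omega>" "is_weak_gradient UNIV u G" and W: "continuous_on UNIV W"
    and ae: "AE x in lebesgue. u x = u' x" "AE x in lebesgue. G x = G' x"
    and [measurable]: "u' \<in> borel_measurable borel" "G' \<in> borel_measurable borel"
  shows "energy W \<Omega> u = (\<integral>\<^sup>+x. ennreal (1 / 2 * (norm (G' x))\<^sup>2 + W (u' x)) * indicator \<Omega> x \<partial>lborel)"
proof -
  have [measurable]: "W \<in> borel_measurable borel" "\<Omega> \<in> sets borel"
    using W assms(1) by (auto intro: borel_measurable_continuous_onI)
  have "energy W \<Omega> u = (\<integral>\<^sup>+x. ennreal (1 / 2 * (norm (G x))\<^sup>2 + W (u x)) * indicator \<Omega> x \<partial>lebesgue)"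
    by (rule energy_eq_weak_gradient[OF assms(1,2)])
  also have "\<dots> = (\<integral>\<^sup>+x. ennreal (1 / 2 * (norm (G' x))\<^sup>2 + W (u' x)) * indicator \<Omega> x \<partial>lebesgue)"
    by (rule nn_integral_cong_AE) (use ae in \<open>eventually_elim, simp\<close>)
  also have "\<dots> = (\<integral>\<^sup>+x. ennreal (1 / 2 * (norm (G' x))\<^sup>2 + W (u' x)) * indicator \<Omega> x \<partial>lborel)"
    by (rule nn_integral_completion) measurable
  finally show ?thesis .
qed

theorem proposition5p1:
  fixes W :: "real ^ 'm \<Rightarrow> real"
    and u :: "real ^ 'n \<Rightarrow> real ^ 'm"
    and a :: "nat \<Rightarrow> real ^ 'm"
    and N :: nat
  assumes "N \<ge> 2"
    and "inj_on a {1..N}"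
    and "\<forall>j\<in>{1..N}. W (a j) = 0"
    and "\<forall>v. v \<notin> a ` {1..N} \<longrightarrow> 0 < W v"
    and "\<forall>j\<in>{1..N}. HA W (a ` {1..N}) (a j)"
    and "\<not> (\<exists>c. AE x in lebesgue. u x = c)"
    and "HB W (a ` {1..N}) u"
    and "essentially_bounded u"
  shows "\<exists>C>0. \<forall>x0. \<exists>R0>0. \<forall>R\<ge>R0.
           ennreal (C * R ^ (CARD('n) - 1)) \<le> energy W (ball x0 R) u"
proof -
  define A where "A = a ` {1..N}"
  have A: "finite A" "A \<noteq> {}" using assms(1) by (auto simp: A_def)
  have HA: "HA W A b" if "b \<in> A" for b using assms(5) that by (auto simp: A_def)
  obtain b0 where b0: "b0 \<in> A" using A(2) by blast
  have Wn: "0 \<le> W v" for v using HA[OF b0] by (simp add: HA_def)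
  have W0: "W b = 0" if "b \<in> A" for b using HA[OF that] by (simp add: HA_def)
  have Wc: "continuous_on UNIV W"
  proof -
    obtain \<alpha> where "0 < \<alpha>" "holder_class \<alpha> W" using HA[OF b0] unfolding HA_def by blast
    then show ?thesis by (intro holder_class_continuous)
  qed
  have mini: "minimal W u" using assms(7) by (simp add: HB_def)
  define G where "G = weak_grad UNIV u"
  have "\<exists>G. is_weak_gradient UNIV u G" using assms(7) unfolding HB_def W12_loc_on_def by blast
  then have wg: "is_weak_gradient UNIV u G"
    using weak_grad_AE_eq(1)[OF open_UNIV] unfolding G_def by blast
  obtain M where M: "0 < M" "AE x in lebesgue. norm (G x) < M"
    using assms(7) unfolding HB_def G_def by blast
  have bG: "AE x in lebesgue. norm (G x) \<le> M" using M(2) by eventually_elim simp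
  obtain K0 where K0: "AE x in lebesgue. norm (u x) \<le> K0" using assms(8) unfolding essentially_bounded_def by blast
  \<comment> \<open>K has to bound the zeros as well as u, so that segments from u to a zero stay in the ball of radius K\<close>
  define K where "K = Max (insert (max 0 K0) (norm ` A))"
  have K: "max 0 K0 \<le> K" "\<And>b. b \<in> A \<Longrightarrow> norm b \<le> K"
    unfolding K_def by (rule Max_ge; use A(1) in blast)+
  have Kn: "0 \<le> K" using K(1) by simp
  have bu: "AE x in lebesgue. norm (u x) \<le> K" using K0 by eventually_elim (use K(1) in simp)
  have mu: "u \<in> borel_measurable lebesgue" and mG: "G \<in> borel_measurable lebesgue"
    using is_weak_gradientD(1,2)[OF wg] by (auto intro: L1_loc_on_UNIV_measurable)
  obtain u' where u'[measurable]: "u' \<in> borel_measurable borel" and u'b: "\<And>x. norm (u' x) \<le> K" and uu': "AE x in lebesgue. u x = u' x"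
    using bounded_borel_version[OF mu bu Kn] by blast
  obtain G' where G'[measurable]: "G' \<in> borel_measurable borel" and G'b: "\<And>x. norm (G' x) \<le> M" and GG': "AE x in lebesgue. G x = G' x"
    using bounded_borel_version[OF mG bG] M(1) by auto
  obtain us Ds where sa: "smooth_approx us Ds K M u G" by (rule smooth_approximation[OF wg bu bG])
  have lim_u: "AE x in lebesgue. (\<lambda>k. us k x) \<longlonglongrightarrow> u' x"
    using smooth_approxD(6)[OF sa] uu' by eventually_elim simp
  have lim_G: "AE x in lebesgue. (\<lambda>k. Ds k x) \<longlonglongrightarrow> G' x"
    using smooth_approxD(7)[OF sa] GG' by eventually_elim simp
  have sa': "smooth_approx us Ds K M u' G'"
    using smooth_approxD(1-5)[OF sa] lim_u lim_G by (simp add: smooth_approx_def)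
  have HA': "\<forall>a\<in>A. HA W A a" using HA by blast
  have pos: "\<forall>v. v \<notin> A \<longrightarrow> 0 < W v" using assms(4) by (simp add: A_def)
  obtain \<delta> K1 c0 W1 where pc: "0 < \<delta>" "0 < K1" "0 < c0" "0 < W1" "\<forall>a\<in>A. radial_well W a (2 * \<delta>) K1"
     "\<forall>a\<in>A. \<forall>b\<in>A. a \<noteq> b \<longrightarrow> 4 * \<delta> \<le> norm (a - b)"
     "\<forall>v. norm v \<le> K \<and> (\<forall>a\<in>A. \<delta> \<le> norm (v - a)) \<longrightarrow> c0 \<le> W v"
     "\<forall>v. norm v \<le> K \<longrightarrow> W v \<le> W1"
    using potential_constants[OF A HA' pos, of K] by (elim exE conjE)
  have en: "energy W \<Omega> u = (\<integral>\<^sup>+x. ennreal (1 / 2 * (norm (G' x))\<^sup>2 + W (u' x)) * indicator \<Omega> x \<partial>lborel)" if "open \<Omega>" for \<Omega>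
    by (rule energy_eq_lborel[OF that wg Wc uu' GG' u' G'])
  interpret phase_minimizer W A u' G' us Ds K M \<delta> K1 c0 W1
  proof
    fix \<psi> :: "real ^ 'n \<Rightarrow> real" and S b r
    assume b: "b \<in> A" and \<psi>: "smooth \<psi>" "compact S" "S \<subseteq> ball 0 r" "\<And>x. x \<notin> S \<Longrightarrow> \<psi> x = 0" "\<And>x. 0 \<le> \<psi> x" "\<And>x. \<psi> x \<le> 1"
    note comp = cutoff_competitor[OF wg mu mG bu bG \<psi> open_ball bounded_ball, of b]
    have [measurable]: "\<psi> \<in> borel_measurable borel" "grad \<psi> \<in> borel_measurable borel"
      by (intro borel_measurable_continuous_onI smooth_continuous smooth_grad_continuous \<psi>(1))+
    have "energy W (ball 0 r) u \<le> energy W (ball 0 r) (\<lambda>x. u x + \<psi> x *\<^sub>R (b - u x))"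
      using mini comp(1) unfolding minimal_def by blast
    also have "\<dots> = (\<integral>\<^sup>+x. ennreal (1 / 2 * (norm ((1 - \<psi> x) *\<^sub>R G' x + outer (b - u' x) (grad \<psi> x)))\<^sup>2 + W (u' x + \<psi> x *\<^sub>R (b - u' x))) * indicator (ball 0 r) x \<partial>lborel)"
    proof (rule energy_eq_lborel[OF open_ball comp(2) Wc])
      show "AE x in lebesgue. u x + \<psi> x *\<^sub>R (b - u x) = u' x + \<psi> x *\<^sub>R (b - u' x)"
        using uu' by eventually_elim simp
      show "AE x in lebesgue. (1 - \<psi> x) *\<^sub>R G x + outer (b - u x) (grad \<psi> x) = (1 - \<psi> x) *\<^sub>R G' x + outer (b - u' x) (grad \<psi> x)"
        using uu' GG' by eventually_elim simp
      show "(\<lambda>x. u' x + \<psi> x *\<^sub>R (b - u' x)) \<in> borel_measurable borel" by measurable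
      show "(\<lambda>x. (1 - \<psi> x) *\<^sub>R G' x + outer (b - u' x) (grad \<psi> x)) \<in> borel_measurable borel"
        by (intro borel_measurable_add borel_measurable_scaleR borel_measurable_outer) measurable
    qed
    finally show "(\<integral>\<^sup>+x. ennreal (1 / 2 * (norm (G' x))\<^sup>2 + W (u' x)) * indicator (ball 0 r) x \<partial>lborel) \<le>
       (\<integral>\<^sup>+x. ennreal (1 / 2 * (norm ((1 - \<psi> x) *\<^sub>R G' x + outer (b - u' x) (grad \<psi> x)))\<^sup>2 + W (u' x + \<psi> x *\<^sub>R (b - u' x))) * indicator (ball 0 r) x \<partial>lborel)"
      by (simp only: en[OF open_ball])
  qed (use A Wc Wn W0 sa' u' G' u'b G'b K(2) pc in blast)+
  have en_mu: "energy W (ball x r) u = ennreal (measure \<mu> (ball x r))" for x r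
  proof -
    have "energy W (ball x r) u = emeasure \<mu> (ball x r)"
      unfolding en[OF open_ball] by (subst emeasure_mu) (auto simp: e_def)
    also have "\<dots> = ennreal (measure \<mu> (ball x r))" by (rule emeasure_mu_eq) auto
    finally show ?thesis .
  qed
  obtain \<epsilon> where \<epsilon>: "0 < \<epsilon>" "(\<exists>R0. \<forall>R\<ge>R0. \<epsilon> * R ^ (CARD('n) - 1) \<le> E R) \<or> (\<forall>r. E r = 0)"
    using energy_dichotomy by blast
  have "\<not> (\<forall>r. E r = 0)"
  proof
    assume "\<forall>r. E r = 0"
    then have "AE x in lebesgue. G' x = 0" using zero_energy_imp_gradient_zero by (intro AE_completion) blast
    then have "AE x in lebesgue. G x = 0" using GG' by eventually_elim simp
    from zero_weak_gradient_imp_constant[OF wg bu this] show False using assms(6) by blast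
  qed
  with \<epsilon> obtain R0 where R0: "\<And>R. R0 \<le> R \<Longrightarrow> \<epsilon> * R ^ (CARD('n) - 1) \<le> E R" by blast
  show ?thesis
  proof (rule exI[of _ "\<epsilon> / 2 ^ (CARD('n) - 1)"], intro conjI allI)
    show "0 < \<epsilon> / 2 ^ (CARD('n) - 1)" using \<epsilon>(1) by simp
    fix x0 :: "real ^ 'n"
    show "\<exists>R1>0. \<forall>R\<ge>R1. ennreal (\<epsilon> / 2 ^ (CARD('n) - 1) * R ^ (CARD('n) - 1)) \<le> energy W (ball x0 R) u"
    proof (rule exI[of _ "2 * norm x0 + 2 * \<bar>R0\<bar> + 1"], intro conjI allI impI)
      show "0 < 2 * norm x0 + 2 * \<bar>R0\<bar> + 1" by (simp add: add_nonneg_pos)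
      fix R assume R: "2 * norm x0 + 2 * \<bar>R0\<bar> + 1 \<le> R"
      have "R0 \<le> R / 2" "norm x0 \<le> R / 2" using R norm_ge_zero[of x0] by linarith+
      then have "\<epsilon> / 2 ^ (CARD('n) - 1) * R ^ (CARD('n) - 1) \<le> E (R / 2)"
        using R0[of "R / 2"] by (simp add: power_divide)
      also have "\<dots> \<le> measure \<mu> (ball x0 R)"
        unfolding E_def
      proof (rule measure_mono_fmeasurable)
        show "ball 0 (R / 2) \<subseteq> ball x0 R"
        proof
          fix y assume "y \<in> ball (0 :: real ^ 'n) (R / 2)"
          then have "norm y < R / 2" by simp
          then have "norm (x0 - y) < R" using norm_triangle_ineq4[of x0 y] \<open>norm x0 \<le> R / 2\<close> by linarith
          then show "y \<in> ball x0 R" by (simp add: dist_norm)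
        qed
      qed (auto intro: mu_fmeasurable)
      finally show "ennreal (\<epsilon> / 2 ^ (CARD('n) - 1) * R ^ (CARD('n) - 1)) \<le> energy W (ball x0 R) u"
        unfolding en_mu by (rule ennreal_leI)
    qed
  qed
qed

end
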